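(* Let $\mathcal A$ be an additive category and $\mathcal B$ an abelian category. (a) Let $F\colon\mathcal A\to\mathcal B$ be an additive functor. Set $\hat F:=\mathrm H_{\mathcal B}\circ\operatorname{Adel}(F)\colon\operatorname{Adel}(\mathcal A)\to\mathcal B$. Then $\hat F$ is exact and $\hat F\circ \mathrm I_{\mathcal A}=F$. Moreover, if $G,\tilde G\colon\operatorname{Adel}(\mathcal A)\to\mathcal B$ are exact functors and $\sigma\colon G\circ \mathrm I_{\mathcal A}\Rightarrow\tilde G\circ \mathrm I_{\mathcal A}$ is a natural isomorphism, then there exists a natural isomorphism $\tau\colon G\Rightarrow\tilde G$ with $\tau\star \mathrm I_{\mathcal A}=\sigma$. In particular, this holds for $G\circ \mathrm I_{\mathcal A}=\tilde G\circ \mathrm I_{\mathcal A}$ and $\sigma=1_{G\circ \mathrm I_{\mathcal A}}$. (b) Let $F,G\colon\mathcal A\to\mathcal B$ be additive functors and let $\alpha\colon F\Rightarrow G$ be a natural transformation. With $\hat F,\hat G$ defined as in (a), there exists a unique natural transformation $\hat\alpha\colon\hat F\Rightarrow\hat G$ satisfying $\hat\alpha\star \mathrm I_{\mathcal A}=\alpha$.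
   Context: Conventions: morphisms are composed from left to right ($fg$ means first $f$, then $g$); functors are composed in the usual order. Every additive category comes with a chosen zero object $0$. For a natural transformation $\tau\colon G\Rightarrow\tilde G$ and a functor $I$, $\tau\star I$ is the natural transformation $G\circ I\Rightarrow\tilde G\circ I$ with $(\tau\star I)_X=\tau_{I(X)}$. An exact functor between abelian categories is an additive functor that preserves kernels and cokernels. Adelman category: for an additive category $\mathcal A$, let $\mathcal A^{\Delta_2}$ be the category whose objects are diagrams $A=(A_0\xrightarrow{a_0}A_1\xrightarrow{a_1}A_2)$ in $\mathcal A$ (with no condition on $a_0a_1$) and whose morphisms $f\colon A\to B$ are triples $f=(f_0,f_1,f_2)$, $f_i\colon A_i\to B_i$, with $a_0f_1=f_0b_0$ and $a_1f_2=f_1b_1$. Such an $f$ is null-homotopic if there are morphisms $s\colon A_1\to B_0$ and $t\colon A_2\to B_1$ in $\mathcal A$ with $sb_0+a_1t=f_1$. The null-homotopic morphisms form an ideal of $\mathcal A^{\Delta_2}$, and $\operatorname{Adel}(\mathcal A)$ is the quotient category of $\mathcal A^{\Delta_2}$ by this ideal (same objects; morphisms are residue classes $[f]=[f_0,f_1,f_2]$). It is an abelian category. The inclusion functor $\mathrm I_{\mathcal A}\colon\mathcal A\to\operatorname{Adel}(\mathcal A)$ is given by $\mathrm I_{\mathcal A}(X)=(0\to X\to 0)$ and $\mathrm I_{\mathcal A}(f)=[0,f,0]$. The functor $\operatorname{Adel}(F)$: for an additive functor $F\colon\mathcal A\to\mathcal B$ between additive categories, $\operatorname{Adel}(F)\colon\operatorname{Adel}(\mathcal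 A)\to\operatorname{Adel}(\mathcal B)$ sends $X=(X_0\xrightarrow{x_0}X_1\xrightarrow{x_1}X_2)$ to $(F(X_0)\xrightarrow{F(x_0)}F(X_1)\xrightarrow{F(x_1)}F(X_2))$ and $[f]$ to $[F(f_0),F(f_1),F(f_2)]$. The homology functor $\mathrm H_{\mathcal B}\colon\operatorname{Adel}(\mathcal B)\to\mathcal B$ for $\mathcal B$ abelian: for each object $A$ of $\mathcal B^{\Delta_2}$ choose a kernel $k_A\colon K_A\to A_1$ of $a_1$ (with $k_A=1_{A_1}$ whenever $A_2$ is a zero object), a cokernel $c_A\colon A_1\to C_A$ of $a_0$ (with $c_A=1_{A_1}$ whenever $A_0$ is a zero object), and a factorisation $k_Ac_A=p_Ai_A$ with $p_A\colon K_A\to \mathrm{Im}_A$ epimorphic and $i_A\colon\mathrm{Im}_A\to C_A$ monomorphic (with $p_A=i_A=1_{A_1}$ whenever $A_0$ and $A_2$ are both zero objects). Set $\mathrm H_{\mathcal B}(A)=\mathrm{Im}_A$. For $f\colon A\to B$ in $\mathcal B^{\Delta_2}$ let $f_K\colon K_A\to K_B$ and $f_C\colon C_A\to C_B$ be the unique morphisms with $f_Kk_B=k_Af_1$ and $c_Af_C=f_1c_B$; then $\mathrm H_{\mathcal B}([f])\colon\mathrm{Im}_A\to\mathrm{Im}_B$ is the unique morphism with $p_A\mathrm H_{\mathcal B}([f])=f_Kp_B$ and $\mathrm H_{\mathcal B}([f])i_B=i_Af_C$. *)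

theory Defs
  imports "HOL-Algebra.Coset"
begin

section \<open>Categories\<close>

text \<open>
  Morphisms carry their source and target. Composition is written from left to right:
  \<open>f \<cdot> g\<close> is first \<open>f\<close>, then \<open>g\<close>. Objects and morphisms form sets, and all notions are
  relativised to them; functors and natural transformations are arbitrary outside these sets.
\<close>

record ('o, 'm) category =
  Obj :: "'o set"
  Arr :: "'m set"
  Dom :: "'m \<Rightarrow> 'o"
  Cod :: "'m \<Rightarrow> 'o"
  Ide :: "'o \<Rightarrow> 'm"
  Comp :: "'m \<Rightarrow> 'm \<Rightarrow> 'm"  (infixl "\<cdot>\<index>" 70)

definition Hom :: "('o, 'm, 'z) category_scheme \<Rightarrow> 'o \<Rightarrow> 'o \<Rightarrow> 'm set" where
  "Hom C X Y = {f \<in> Arr C. Dom C f = X \<and> Cod C f = Y}"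

locale category =
  fixes C :: "('o, 'm, 'z) category_scheme" (structure)
  assumes Dom_closed: "f \<in> Arr C \<Longrightarrow> Dom C f \<in> Obj C"
    and Cod_closed: "f \<in> Arr C \<Longrightarrow> Cod C f \<in> Obj C"
    and Ide_closed: "X \<in> Obj C \<Longrightarrow> Ide C X \<in> Hom C X X"
    and Comp_closed: "\<lbrakk>f \<in> Hom C X Y; g \<in> Hom C Y Z\<rbrakk> \<Longrightarrow> f \<cdot> g \<in> Hom C X Z"
    and Ide_left: "f \<in> Hom C X Y \<Longrightarrow> Ide C X \<cdot> f = f"
    and Ide_right: "f \<in> Hom C X Y \<Longrightarrow> f \<cdot> Ide C Y = f"
    and Comp_assoc:
      "\<lbrakk>f \<in> Hom C X Y; g \<in> Hom C Y Z; h \<in> Hom C Z W\<rbrakk> \<Longrightarrow> (f \<cdot> g) \<cdot> h = f \<cdot> (g \<cdot> h)"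

definition is_mono :: "('o, 'm, 'z) category_scheme \<Rightarrow> 'm \<Rightarrow> bool" where
  "is_mono C f \<longleftrightarrow> f \<in> Arr C \<and>
     (\<forall>X\<in>Obj C. \<forall>g\<in>Hom C X (Dom C f). \<forall>h\<in>Hom C X (Dom C f).
        g \<cdot>\<^bsub>C\<^esub> f = h \<cdot>\<^bsub>C\<^esub> f \<longrightarrow> g = h)"

definition is_epi :: "('o, 'm, 'z) category_scheme \<Rightarrow> 'm \<Rightarrow> bool" where
  "is_epi C f \<longleftrightarrow> f \<in> Arr C \<and>
     (\<forall>X\<in>Obj C. \<forall>g\<in>Hom C (Cod C f) X. \<forall>h\<in>Hom C (Cod C f) X.
        f \<cdot>\<^bsub>C\<^esub> g = f \<cdot>\<^bsub>C\<^esub> h \<longrightarrow> g = h)"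

definition is_iso :: "('o, 'm, 'z) category_scheme \<Rightarrow> 'm \<Rightarrow> bool" where
  "is_iso C f \<longleftrightarrow> f \<in> Arr C \<and>
     (\<exists>g\<in>Hom C (Cod C f) (Dom C f).
        f \<cdot>\<^bsub>C\<^esub> g = Ide C (Dom C f) \<and> g \<cdot>\<^bsub>C\<^esub> f = Ide C (Cod C f))"

definition is_zero_object :: "('o, 'm, 'z) category_scheme \<Rightarrow> 'o \<Rightarrow> bool" where
  "is_zero_object C Z \<longleftrightarrow> Z \<in> Obj C \<and>
     (\<forall>X\<in>Obj C. (\<exists>!f. f \<in> Hom C Z X) \<and> (\<exists>!f. f \<in> Hom C X Z))"


section \<open>Additive and abelian categories\<close>

text \<open>
  The field \<open>Zer\<close> gives the zero morphisms and \<open>Zob\<close> the chosen zero object.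
\<close>

record ('o, 'm) add_category = "('o, 'm) category" +
  Add :: "'m \<Rightarrow> 'm \<Rightarrow> 'm"  (infixl "\<boxplus>\<index>" 65)
  Zer :: "'o \<Rightarrow> 'o \<Rightarrow> 'm"
  Zob :: "'o"

definition hom_group :: "('o, 'm, 'z) add_category_scheme \<Rightarrow> 'o \<Rightarrow> 'o \<Rightarrow> 'm monoid" where
  "hom_group C X Y = \<lparr>carrier = Hom C X Y, monoid.mult = Add C, one = Zer C X Y\<rparr>"

definition is_biproduct ::
  "('o, 'm, 'z) add_category_scheme \<Rightarrow> 'o \<Rightarrow> 'o \<Rightarrow> 'o \<Rightarrow> 'm \<Rightarrow> 'm \<Rightarrow> 'm \<Rightarrow> 'm \<Rightarrow> bool" where
  "is_biproduct C X Y S i j p q \<longleftrightarrow> S \<in> Obj C \<and>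
     i \<in> Hom C X S \<and> j \<in> Hom C Y S \<and> p \<in> Hom C S X \<and> q \<in> Hom C S Y \<and>
     i \<cdot>\<^bsub>C\<^esub> p = Ide C X \<and> j \<cdot>\<^bsub>C\<^esub> q = Ide C Y \<and> i \<cdot>\<^bsub>C\<^esub> q = Zer C X Y \<and> j \<cdot>\<^bsub>C\<^esub> p = Zer C Y X \<and>
     (p \<cdot>\<^bsub>C\<^esub> i) \<boxplus>\<^bsub>C\<^esub> (q \<cdot>\<^bsub>C\<^esub> j) = Ide C S"

locale additive_category = category C
  for C :: "('o, 'm, 'z) add_category_scheme" (structure) +
  assumes comm_group_Hom: "\<lbrakk>X \<in> Obj C; Y \<in> Obj C\<rbrakk> \<Longrightarrow> comm_group (hom_group C X Y)"
    and Comp_Add_left: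
      "\<lbrakk>f \<in> Hom C X Y; g \<in> Hom C X Y; h \<in> Hom C Y Z\<rbrakk> \<Longrightarrow> (f \<boxplus> g) \<cdot> h = (f \<cdot> h) \<boxplus> (g \<cdot> h)"
    and Comp_Add_right:
      "\<lbrakk>f \<in> Hom C X Y; g \<in> Hom C Y Z; h \<in> Hom C Y Z\<rbrakk> \<Longrightarrow> f \<cdot> (g \<boxplus> h) = (f \<cdot> g) \<boxplus> (f \<cdot> h)"
    and zero_object_Zob: "is_zero_object C (Zob C)"
    and biproduct_exists:
      "\<lbrakk>X \<in> Obj C; Y \<in> Obj C\<rbrakk> \<Longrightarrow> \<exists>S i j p q. is_biproduct C X Y S i j p q"

definition is_kernel :: "('o, 'm, 'z) add_category_scheme \<Rightarrow> 'm \<Rightarrow> 'm \<Rightarrow> bool" where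
  "is_kernel C f k \<longleftrightarrow> f \<in> Arr C \<and> k \<in> Arr C \<and> Cod C k = Dom C f \<and>
     k \<cdot>\<^bsub>C\<^esub> f = Zer C (Dom C k) (Cod C f) \<and>
     (\<forall>X\<in>Obj C. \<forall>t\<in>Hom C X (Dom C f). t \<cdot>\<^bsub>C\<^esub> f = Zer C X (Cod C f) \<longrightarrow>
        (\<exists>!u. u \<in> Hom C X (Dom C k) \<and> u \<cdot>\<^bsub>C\<^esub> k = t))"

definition is_cokernel :: "('o, 'm, 'z) add_category_scheme \<Rightarrow> 'm \<Rightarrow> 'm \<Rightarrow> bool" where
  "is_cokernel C f c \<longleftrightarrow> f \<in> Arr C \<and> c \<in> Arr C \<and> Dom C c = Cod C f \<and>
     f \<cdot>\<^bsub>C\<^esub> c = Zer C (Dom C f) (Cod C c) \<and>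
     (\<forall>X\<in>Obj C. \<forall>t\<in>Hom C (Cod C f) X. f \<cdot>\<^bsub>C\<^esub> t = Zer C (Dom C f) X \<longrightarrow>
        (\<exists>!u. u \<in> Hom C (Cod C c) X \<and> c \<cdot>\<^bsub>C\<^esub> u = t))"

locale abelian_category = additive_category +
  assumes kernel_exists: "f \<in> Arr C \<Longrightarrow> \<exists>k. is_kernel C f k"
    and cokernel_exists: "f \<in> Arr C \<Longrightarrow> \<exists>c. is_cokernel C f c"
    and mono_is_kernel: "is_mono C f \<Longrightarrow> \<exists>g. is_kernel C g f"
    and epi_is_cokernel: "is_epi C f \<Longrightarrow> \<exists>g. is_cokernel C g f"


section \<open>Functors and natural transformations\<close>

record ('o, 'm, 'p, 'n) fctr =
  omap :: "'o \<Rightarrow> 'p"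
  amap :: "'m \<Rightarrow> 'n"

locale category_functor = C: category C + D: category D
  for C :: "('o, 'm, 'y) category_scheme" and D :: "('p, 'n, 'z) category_scheme" +
  fixes F :: "('o, 'm, 'p, 'n) fctr"
  assumes omap_closed: "X \<in> Obj C \<Longrightarrow> omap F X \<in> Obj D"
    and amap_closed: "f \<in> Hom C X Y \<Longrightarrow> amap F f \<in> Hom D (omap F X) (omap F Y)"
    and amap_Ide: "X \<in> Obj C \<Longrightarrow> amap F (Ide C X) = Ide D (omap F X)"
    and amap_Comp: "\<lbrakk>f \<in> Hom C X Y; g \<in> Hom C Y Z\<rbrakk>
      \<Longrightarrow> amap F (f \<cdot>\<^bsub>C\<^esub> g) = amap F f \<cdot>\<^bsub>D\<^esub> amap F g"

locale additive_functor =
  C: additive_category C + D: additive_category D + category_functor C D F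
  for C :: "('o, 'm, 'y) add_category_scheme" and D :: "('p, 'n, 'z) add_category_scheme"
    and F :: "('o, 'm, 'p, 'n) fctr" +
  assumes amap_Add: "\<lbrakk>f \<in> Hom C X Y; g \<in> Hom C X Y\<rbrakk>
    \<Longrightarrow> amap F (f \<boxplus>\<^bsub>C\<^esub> g) = amap F f \<boxplus>\<^bsub>D\<^esub> amap F g"

text \<open>
  Exactness is used only between abelian categories, but that the two categories are abelian is
  not part of the predicate.
\<close>

locale exact_functor = additive_functor +
  assumes preserves_kernel: "is_kernel C f k \<Longrightarrow> is_kernel D (amap F f) (amap F k)"
    and preserves_cokernel: "is_cokernel C f c \<Longrightarrow> is_cokernel D (amap F f) (amap F c)"

definition functor_comp ::
  "('p, 'n, 'q, 'l) fctr \<Rightarrow> ('o, 'm, 'p, 'n) fctr \<Rightarrow> ('o, 'm, 'q, 'l) fctr"  (infixl "\<circ>\<^sub>F" 55)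
  where "G \<circ>\<^sub>F F = \<lparr>omap = omap G \<circ> omap F, amap = amap G \<circ> amap F\<rparr>"

definition functor_eq ::
  "('o, 'm, 'z) category_scheme \<Rightarrow> ('o, 'm, 'p, 'n) fctr \<Rightarrow> ('o, 'm, 'p, 'n) fctr \<Rightarrow> bool" where
  "functor_eq C F G \<longleftrightarrow> (\<forall>X\<in>Obj C. omap F X = omap G X) \<and> (\<forall>f\<in>Arr C. amap F f = amap G f)"

locale natural_transformation = F: category_functor C D F + G: category_functor C D G
  for C :: "('o, 'm, 'y) category_scheme" and D :: "('p, 'n, 'z) category_scheme"
    and F G :: "('o, 'm, 'p, 'n) fctr" +
  fixes \<tau> :: "'o \<Rightarrow> 'n"
  assumes component: "X \<in> Obj C \<Longrightarrow> \<tau> X \<in> Hom D (omap F X) (omap G X)"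
    and naturality: "f \<in> Hom C X Y \<Longrightarrow> amap F f \<cdot>\<^bsub>D\<^esub> \<tau> Y = \<tau> X \<cdot>\<^bsub>D\<^esub> amap G f"

locale natural_isomorphism = natural_transformation +
  assumes component_iso: "X \<in> Obj C \<Longrightarrow> is_iso D (\<tau> X)"

definition nt_eq ::
  "('o, 'm, 'z) category_scheme \<Rightarrow> ('o \<Rightarrow> 'n) \<Rightarrow> ('o \<Rightarrow> 'n) \<Rightarrow> bool" where
  "nt_eq C \<sigma> \<tau> \<longleftrightarrow> (\<forall>X\<in>Obj C. \<sigma> X = \<tau> X)"

definition whisker :: "('p \<Rightarrow> 'n) \<Rightarrow> ('o, 'm, 'p, 'l) fctr \<Rightarrow> 'o \<Rightarrow> 'n"  (infixl "\<star>" 70) where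
  "\<tau> \<star> I = (\<lambda>X. \<tau> (omap I X))"

definition id_nt ::
  "('p, 'n, 'z) category_scheme \<Rightarrow> ('o, 'm, 'p, 'n) fctr \<Rightarrow> 'o \<Rightarrow> 'n" where
  "id_nt D F = (\<lambda>X. Ide D (omap F X))"


section \<open>The quotient of an additive category by an ideal\<close>

definition residue_class ::
  "('o, 'm, 'z) add_category_scheme \<Rightarrow> 'm set \<Rightarrow> 'm \<Rightarrow> 'm set" where
  "residue_class C J f =
     (J \<inter> Hom C (Dom C f) (Cod C f)) #>\<^bsub>hom_group C (Dom C f) (Cod C f)\<^esub> f"

definition quotient_category ::
  "('o, 'm, 'z) add_category_scheme \<Rightarrow> 'm set \<Rightarrow> ('o, 'm set) add_category" where
  "quotient_category C J =
     \<lparr>Obj = Obj C,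
      Arr = residue_class C J ` Arr C,
      Dom = (\<lambda>x. the_elem (Dom C ` x)),
      Cod = (\<lambda>x. the_elem (Cod C ` x)),
      Ide = (\<lambda>X. residue_class C J (Ide C X)),
      Comp = (\<lambda>x y. \<Union>f\<in>x. \<Union>g\<in>y. residue_class C J (f \<cdot>\<^bsub>C\<^esub> g)),
      Add = (\<lambda>x y. \<Union>f\<in>x. \<Union>g\<in>y. residue_class C J (f \<boxplus>\<^bsub>C\<^esub> g)),
      Zer = (\<lambda>X Y. residue_class C J (Zer C X Y)),
      Zob = Zob C\<rparr>"


section \<open>The Adelman category\<close>

text \<open>
  A diagram \<open>A\<^sub>0 \<rightarrow> A\<^sub>1 \<rightarrow> A\<^sub>2\<close> is the pair \<open>(a\<^sub>0, a\<^sub>1)\<close> of its morphisms; the three objects are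
  recovered from sources and targets. A morphism of diagrams is a triple of morphisms together
  with its source and target.
\<close>

type_synonym 'm dia = "'m \<times> 'm"
type_synonym 'm dia_arr = "'m dia \<times> ('m \<times> 'm \<times> 'm) \<times> 'm dia"

definition ob0 :: "('o, 'm, 'z) category_scheme \<Rightarrow> 'm dia \<Rightarrow> 'o" where
  "ob0 C A = Dom C (fst A)"

definition ob1 :: "('o, 'm, 'z) category_scheme \<Rightarrow> 'm dia \<Rightarrow> 'o" where
  "ob1 C A = Cod C (fst A)"

definition ob2 :: "('o, 'm, 'z) category_scheme \<Rightarrow> 'm dia \<Rightarrow> 'o" where
  "ob2 C A = Cod C (snd A)"

definition diagrams :: "('o, 'm, 'z) category_scheme \<Rightarrow> 'm dia set" where
  "diagrams C = {(a0, a1). a0 \<in> Arr C \<and> a1 \<in> Arr C \<and> Cod C a0 = Dom C a1}"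

definition diagram_arrows :: "('o, 'm, 'z) category_scheme \<Rightarrow> 'm dia_arr set" where
  "diagram_arrows C =
     {(A, (f0, f1, f2), B). A \<in> diagrams C \<and> B \<in> diagrams C \<and>
        f0 \<in> Hom C (ob0 C A) (ob0 C B) \<and>
        f1 \<in> Hom C (ob1 C A) (ob1 C B) \<and>
        f2 \<in> Hom C (ob2 C A) (ob2 C B) \<and>
        fst A \<cdot>\<^bsub>C\<^esub> f1 = f0 \<cdot>\<^bsub>C\<^esub> fst B \<and>
        snd A \<cdot>\<^bsub>C\<^esub> f2 = f1 \<cdot>\<^bsub>C\<^esub> snd B}"

definition diagram_category ::
  "('o, 'm, 'z) add_category_scheme \<Rightarrow> ('m dia, 'm dia_arr) add_category" where
  "diagram_category C =
     \<lparr>Obj = diagrams C,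
      Arr = diagram_arrows C,
      Dom = (\<lambda>(A, f, B). A),
      Cod = (\<lambda>(A, f, B). B),
      Ide = (\<lambda>A. (A, (Ide C (ob0 C A), Ide C (ob1 C A), Ide C (ob2 C A)), A)),
      Comp = (\<lambda>(A, (f0, f1, f2), _) (_, (g0, g1, g2), B).
                (A, (f0 \<cdot>\<^bsub>C\<^esub> g0, f1 \<cdot>\<^bsub>C\<^esub> g1, f2 \<cdot>\<^bsub>C\<^esub> g2), B)),
      Add = (\<lambda>(A, (f0, f1, f2), B) (_, (g0, g1, g2), _).
                (A, (f0 \<boxplus>\<^bsub>C\<^esub> g0, f1 \<boxplus>\<^bsub>C\<^esub> g1, f2 \<boxplus>\<^bsub>C\<^esub> g2), B)),
      Zer = (\<lambda>A B. (A, (Zer C (ob0 C A) (ob0 C B), Zer C (ob1 C A) (ob1 C B),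
                        Zer C (ob2 C A) (ob2 C B)), B)),
      Zob = (Zer C (Zob C) (Zob C), Zer C (Zob C) (Zob C))\<rparr>"

definition null_homotopic :: "('o, 'm, 'z) add_category_scheme \<Rightarrow> 'm dia_arr set" where
  "null_homotopic C =
     {(A, (f0, f1, f2), B) \<in> diagram_arrows C.
        \<exists>s \<in> Hom C (ob1 C A) (ob0 C B). \<exists>t \<in> Hom C (ob2 C A) (ob1 C B).
          (s \<cdot>\<^bsub>C\<^esub> fst B) \<boxplus>\<^bsub>C\<^esub> (snd A \<cdot>\<^bsub>C\<^esub> t) = f1}"

definition Adel ::
  "('o, 'm, 'z) add_category_scheme \<Rightarrow> ('m dia, 'm dia_arr set) add_category" where
  "Adel C = quotient_category (diagram_category C) (null_homotopic C)"

definition Adel_class :: "('o, 'm, 'z) add_category_scheme \<Rightarrow> 'm dia_arr \<Rightarrow> 'm dia_arr set" where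
  "Adel_class C = residue_class (diagram_category C) (null_homotopic C)"

definition Adel_incl_ob :: "('o, 'm, 'z) add_category_scheme \<Rightarrow> 'o \<Rightarrow> 'm dia" where
  "Adel_incl_ob C X = (Zer C (Zob C) X, Zer C X (Zob C))"

definition Adel_incl ::
  "('o, 'm, 'z) add_category_scheme \<Rightarrow> ('o, 'm, 'm dia, 'm dia_arr set) fctr" where
  "Adel_incl C =
     \<lparr>omap = Adel_incl_ob C,
      amap = (\<lambda>f. Adel_class C
        (Adel_incl_ob C (Dom C f),
         (Zer C (Zob C) (Zob C), f, Zer C (Zob C) (Zob C)),
         Adel_incl_ob C (Cod C f)))\<rparr>"

definition dia_map :: "('o, 'm, 'p, 'n) fctr \<Rightarrow> 'm dia \<Rightarrow> 'n dia" where
  "dia_map F = map_prod (amap F) (amap F)"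

definition dia_arr_map :: "('o, 'm, 'p, 'n) fctr \<Rightarrow> 'm dia_arr \<Rightarrow> 'n dia_arr" where
  "dia_arr_map F =
     (\<lambda>(A, (f0, f1, f2), B). (dia_map F A, (amap F f0, amap F f1, amap F f2), dia_map F B))"

definition Adel_functor ::
  "('p, 'n, 'z) add_category_scheme \<Rightarrow> ('o, 'm, 'p, 'n) fctr
    \<Rightarrow> ('m dia, 'm dia_arr set, 'n dia, 'n dia_arr set) fctr" where
  "Adel_functor D F =
     \<lparr>omap = dia_map F,
      amap = (\<lambda>x. \<Union>f\<in>x. Adel_class D (dia_arr_map F f))\<rparr>"


section \<open>The homology functor\<close>

text \<open>
  The homology functor depends on a choice of kernels, cokernels and epi-mono factorisations.
  The choice is kept as a parameter; the objects \<open>K\<^sub>A\<close>, \<open>C\<^sub>A\<close> and \<open>Im\<^sub>A\<close> are the source of \<open>k\<^sub>A\<close>,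
  the target of \<open>c\<^sub>A\<close> and the target of \<open>p\<^sub>A\<close>.
\<close>

record 'm homology_data =
  hker :: "'m dia \<Rightarrow> 'm"
  hcok :: "'m dia \<Rightarrow> 'm"
  hepi :: "'m dia \<Rightarrow> 'm"
  hmono :: "'m dia \<Rightarrow> 'm"

definition is_homology_choice ::
  "('o, 'm, 'z) add_category_scheme \<Rightarrow> 'm homology_data \<Rightarrow> bool" where
  "is_homology_choice C h \<longleftrightarrow> (\<forall>A\<in>diagrams C.
     is_kernel C (snd A) (hker h A) \<and>
     (is_zero_object C (ob2 C A) \<longrightarrow> hker h A = Ide C (ob1 C A)) \<and>
     is_cokernel C (fst A) (hcok h A) \<and>
     (is_zero_object C (ob0 C A) \<longrightarrow> hcok h A = Ide C (ob1 C A)) \<and>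
     is_epi C (hepi h A) \<and> is_mono C (hmono h A) \<and>
     Dom C (hepi h A) = Dom C (hker h A) \<and>
     Cod C (hepi h A) = Dom C (hmono h A) \<and>
     Cod C (hmono h A) = Cod C (hcok h A) \<and>
     hker h A \<cdot>\<^bsub>C\<^esub> hcok h A = hepi h A \<cdot>\<^bsub>C\<^esub> hmono h A \<and>
     (is_zero_object C (ob0 C A) \<and> is_zero_object C (ob2 C A) \<longrightarrow>
        hepi h A = Ide C (ob1 C A) \<and> hmono h A = Ide C (ob1 C A)))"

definition ker_map ::
  "('o, 'm, 'z) add_category_scheme \<Rightarrow> 'm homology_data \<Rightarrow> 'm dia_arr \<Rightarrow> 'm" where
  "ker_map C h = (\<lambda>(A, (f0, f1, f2), B).
     THE u. u \<in> Hom C (Dom C (hker h A)) (Dom C (hker h B)) \<and>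
       u \<cdot>\<^bsub>C\<^esub> hker h B = hker h A \<cdot>\<^bsub>C\<^esub> f1)"

definition cok_map ::
  "('o, 'm, 'z) add_category_scheme \<Rightarrow> 'm homology_data \<Rightarrow> 'm dia_arr \<Rightarrow> 'm" where
  "cok_map C h = (\<lambda>(A, (f0, f1, f2), B).
     THE u. u \<in> Hom C (Cod C (hcok h A)) (Cod C (hcok h B)) \<and>
       hcok h A \<cdot>\<^bsub>C\<^esub> u = f1 \<cdot>\<^bsub>C\<^esub> hcok h B)"

definition homology_map ::
  "('o, 'm, 'z) add_category_scheme \<Rightarrow> 'm homology_data \<Rightarrow> 'm dia_arr \<Rightarrow> 'm" where
  "homology_map C h = (\<lambda>(A, f, B).
     THE u. u \<in> Hom C (Cod C (hepi h A)) (Cod C (hepi h B)) \<and>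
       hepi h A \<cdot>\<^bsub>C\<^esub> u = ker_map C h (A, f, B) \<cdot>\<^bsub>C\<^esub> hepi h B \<and>
       u \<cdot>\<^bsub>C\<^esub> hmono h B = hmono h A \<cdot>\<^bsub>C\<^esub> cok_map C h (A, f, B))"

definition homology ::
  "('o, 'm, 'z) add_category_scheme \<Rightarrow> 'm homology_data
    \<Rightarrow> ('m dia, 'm dia_arr set, 'o, 'm) fctr" where
  "homology C h =
     \<lparr>omap = (\<lambda>A. Cod C (hepi h A)),
      amap = (\<lambda>x. the_elem (homology_map C h ` x))\<rparr>"

definition hat ::
  "('p, 'n, 'z) add_category_scheme \<Rightarrow> 'n homology_data \<Rightarrow> ('o, 'm, 'p, 'n) fctr
    \<Rightarrow> ('m dia, 'm dia_arr set, 'p, 'n) fctr" where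
  "hat D h F = homology D h \<circ>\<^sub>F Adel_functor D F"

end

theory Submission
  imports Defs
begin

text \<open>
  The object \<open>A\<close> of the Adelman category is the homology of the diagram
  \<open>I(A\<^sub>0) \<rightarrow> I(A\<^sub>1) \<rightarrow> I(A\<^sub>2)\<close>, that is, the image of the composite of a kernel of \<open>I(a\<^sub>1)\<close> with a
  cokernel of \<open>I(a\<^sub>0)\<close>. An exact functor \<open>G\<close> therefore sends \<open>A\<close> to the homology of the diagram
  \<open>G(I(A\<^sub>0)) \<rightarrow> G(I(A\<^sub>1)) \<rightarrow> G(I(A\<^sub>2))\<close>, and a transformation between the restrictions of two exact
  functors along \<open>I\<close> induces a unique map on homology, which is its unique extension. This gives the
  uniqueness statement of (a), and (b) as well once the functors of (a) are known to be exact.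

  For exactness one has an explicit kernel diagram for each morphism, built from biproducts and
  therefore preserved by additive functors, and in an abelian category homology turns it into a
  kernel; this is checked with generalised elements defined up to epimorphic covers. Cokernels are
  obtained by passing to the opposite category.
\<close>

section \<open>Calculus in additive categories\<close>

text \<open>The map induced on homology is characterised by the single equation
  \<open>p u i' = k f1 c'\<close>. It involves only the middle component \<open>f1\<close>, has at
  most one solution because \<open>p\<close> is epi and \<open>i'\<close> is mono, and reads the
  same in the opposite category. Functoriality of the hat functors, naturality and uniqueness of
  extensions are all instances of this uniqueness. The equation reaches an exact functor
  \<open>G\<close> because the homology data of \<open>A\<close> are classes of explicit arrows
  whose middle components are identities, so \<open>p [f] i' = k I(f1) c'\<close> holds before
  \<open>G\<close> is applied. Strict equalities along \<open>I\<close> come from normalisation: at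
  \<open>I(X)\<close> both the chosen and the explicit homology data are identities. Duality meets
  an obstacle: diagrams over \<open>opp C\<close> are not literally the opposite of diagrams over
  \<open>C\<close>, since the two arrows trade places; reversal of diagrams mediates. Exactness is
  tested on one kernel and one cokernel per morphism, because two kernels differ by an isomorphism
  and every functor preserves isomorphisms.\<close>

lemma Hom_iff: "f \<in> Hom C X Y \<longleftrightarrow> f \<in> Arr C \<and> Dom C f = X \<and> Cod C f = Y"
  by (simp add: Hom_def)

lemma is_zero_objectI:
  assumes "Z \<in> Obj C" "\<And>X. X \<in> Obj C \<Longrightarrow> z X \<in> Hom C Z X" "\<And>X. X \<in> Obj C \<Longrightarrow> z' X \<in> Hom C X Z"
    "\<And>X f. f \<in> Hom C Z X \<Longrightarrow> f = z X" "\<And>X f. f \<in> Hom C X Z \<Longrightarrow> f = z' X"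
  shows "is_zero_object C Z"
  unfolding is_zero_object_def using assms by (metis (no_types))

section \<open>Composition laws in a form suited to rewriting\<close>

context category
begin

lemma Ide_Arr: "X \<in> Obj C \<Longrightarrow> Ide C X \<in> Arr C"
  and Dom_Ide: "X \<in> Obj C \<Longrightarrow> Dom C (Ide C X) = X"
  and Cod_Ide: "X \<in> Obj C \<Longrightarrow> Cod C (Ide C X) = X"
  using Ide_closed[of X] by (simp_all add: Hom_iff)

lemma Comp_Arr: "\<lbrakk>f \<in> Arr C; g \<in> Arr C; Cod C f = Dom C g\<rbrakk> \<Longrightarrow> f \<cdot> g \<in> Arr C"
  and Dom_Comp: "\<lbrakk>f \<in> Arr C; g \<in> Arr C; Cod C f = Dom C g\<rbrakk> \<Longrightarrow> Dom C (f \<cdot> g) = Dom C f"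
  and Cod_Comp: "\<lbrakk>f \<in> Arr C; g \<in> Arr C; Cod C f = Dom C g\<rbrakk> \<Longrightarrow> Cod C (f \<cdot> g) = Cod C g"
  using Comp_closed[of f "Dom C f" "Cod C f" g "Cod C g"] by (simp_all add: Hom_iff)

lemma Comp_Ide_left: "\<lbrakk>f \<in> Arr C; Dom C f = X\<rbrakk> \<Longrightarrow> Ide C X \<cdot> f = f"
  using Ide_left[of f X "Cod C f"] by (simp add: Hom_iff)

lemma Comp_Ide_right: "\<lbrakk>f \<in> Arr C; Cod C f = X\<rbrakk> \<Longrightarrow> f \<cdot> Ide C X = f"
  using Ide_right[of f "Dom C f" X] by (simp add: Hom_iff)

lemma Comp_associative:
  "\<lbrakk>f \<in> Arr C; g \<in> Arr C; h \<in> Arr C; Cod C f = Dom C g; Cod C g = Dom C h\<rbrakk>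
    \<Longrightarrow> (f \<cdot> g) \<cdot> h = f \<cdot> (g \<cdot> h)"
  using Comp_assoc[of f "Dom C f" "Cod C f" g "Cod C g" h "Cod C h"] by (simp add: Hom_iff)

text \<open>With sources and targets as functions, rewriting can compute the side conditions of a
  composite; rules in \<open>Hom\<close> form would require guessing the intermediate objects.
  Associativity is oriented, so the normal form of a composite is nested to the right.\<close>

lemmas cat_simps = Dom_closed Cod_closed Ide_Arr Dom_Ide Cod_Ide Comp_Arr Dom_Comp Cod_Comp
  Comp_Ide_left Comp_Ide_right Comp_associative

text \<open>In a right-nested composite the left factor \<open>f\<close> faces
  \<open>g \<cdot> x\<close> and a known value of \<open>f \<cdot> g\<close> no longer matches. This
  form applies such an equation in front of a tail.\<close>

lemma Comp_reassoc:
  "\<lbrakk>f \<cdot> g = h; f \<in> Arr C; g \<in> Arr C; Cod C f = Dom C g; x \<in> Arr C; Dom C x = Cod C g\<rbrakk>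
    \<Longrightarrow> f \<cdot> (g \<cdot> x) = h \<cdot> x"
  by (metis Comp_associative)

lemma mono_cancel:
  "\<lbrakk>is_mono C f; g \<cdot> f = h \<cdot> f; g \<in> Arr C; h \<in> Arr C; Cod C g = Dom C f; Cod C h = Dom C f;
    Dom C g = Dom C h\<rbrakk> \<Longrightarrow> g = h"
  using Dom_closed[of g] unfolding is_mono_def Ball_def Hom_iff by metis

lemma epi_cancel:
  "\<lbrakk>is_epi C f; f \<cdot> g = f \<cdot> h; g \<in> Arr C; h \<in> Arr C; Dom C g = Cod C f; Dom C h = Cod C f;
    Cod C g = Cod C h\<rbrakk> \<Longrightarrow> g = h"
  using Cod_closed[of g] unfolding is_epi_def Ball_def Hom_iff by metis

lemma mono_Comp:
  assumes "is_mono C f" "is_mono C g" "Cod C f = Dom C g"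
  shows "is_mono C (f \<cdot> g)"
  unfolding is_mono_def
proof (intro conjI ballI impI)
  show "f \<cdot> g \<in> Arr C" using assms by (simp add: is_mono_def cat_simps)
  fix X x y
  assume a: "X \<in> Obj C" "x \<in> Hom C X (Dom C (f \<cdot> g))" "y \<in> Hom C X (Dom C (f \<cdot> g))"
    "x \<cdot> (f \<cdot> g) = y \<cdot> (f \<cdot> g)"
  have fg: "f \<in> Arr C" "g \<in> Arr C" using assms by (simp_all add: is_mono_def)
  have xy: "x \<in> Arr C" "y \<in> Arr C" "Cod C x = Dom C f" "Cod C y = Dom C f" "Dom C x = Dom C y"
    using a fg assms(3) by (simp_all add: Hom_iff cat_simps)
  have "(x \<cdot> f) \<cdot> g = (y \<cdot> f) \<cdot> g" using a(4) xy fg assms(3) by (simp add: cat_simps)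
  hence "x \<cdot> f = y \<cdot> f"
    by (rule mono_cancel[OF assms(2)]) (use xy fg assms(3) in \<open>simp_all add: cat_simps\<close>)
  thus "x = y" by (rule mono_cancel[OF assms(1)]) (use xy in simp_all)
qed

lemma zero_object_unique:
  assumes "is_zero_object C Z" "f \<in> Arr C" "g \<in> Arr C" "Dom C f = Dom C g" "Cod C f = Cod C g"
    "Dom C f = Z \<or> Cod C f = Z"
  shows "f = g"
  using assms unfolding is_zero_object_def Hom_iff by (metis Cod_closed Dom_closed)

end

text \<open>The record has no operation for negatives; they come from the group structure on
  \<open>Hom\<close> sets. The group is recovered from the source and target of the morphism, so no
  object arguments are carried along.\<close>

definition neg :: "('o, 'm, 'z) add_category_scheme \<Rightarrow> 'm \<Rightarrow> 'm" where
  "neg C f = m_inv (hom_group C (Dom C f) (Cod C f)) f"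

context additive_category
begin

lemmas Hom_comm_group =
  comm_groupE[OF comm_group_Hom, unfolded hom_group_def partial_object.simps monoid.simps]

lemmas Hom_group = comm_group.axioms(2)[OF comm_group_Hom]

lemma Zer_Arr: "\<lbrakk>X \<in> Obj C; Y \<in> Obj C\<rbrakk> \<Longrightarrow> Zer C X Y \<in> Arr C"
  and Dom_Zer: "\<lbrakk>X \<in> Obj C; Y \<in> Obj C\<rbrakk> \<Longrightarrow> Dom C (Zer C X Y) = X"
  and Cod_Zer: "\<lbrakk>X \<in> Obj C; Y \<in> Obj C\<rbrakk> \<Longrightarrow> Cod C (Zer C X Y) = Y"
  using Hom_comm_group(2)[of X Y] by (simp_all add: Hom_iff)

lemma Add_Arr: "\<lbrakk>f \<in> Arr C; g \<in> Arr C; Dom C f = Dom C g; Cod C f = Cod C g\<rbrakk> \<Longrightarrow> f \<boxplus> g \<in> Arr C"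
  and Dom_Add: "\<lbrakk>f \<in> Arr C; g \<in> Arr C; Dom C f = Dom C g; Cod C f = Cod C g\<rbrakk> \<Longrightarrow> Dom C (f \<boxplus> g) = Dom C f"
  and Cod_Add: "\<lbrakk>f \<in> Arr C; g \<in> Arr C; Dom C f = Dom C g; Cod C f = Cod C g\<rbrakk> \<Longrightarrow> Cod C (f \<boxplus> g) = Cod C f"
  using Hom_comm_group(1)[of "Dom C f" "Cod C f" f g] by (simp_all add: Hom_iff Dom_closed Cod_closed)

lemma neg_Arr: "f \<in> Arr C \<Longrightarrow> neg C f \<in> Arr C"
  and Dom_neg: "f \<in> Arr C \<Longrightarrow> Dom C (neg C f) = Dom C f"
  and Cod_neg: "f \<in> Arr C \<Longrightarrow> Cod C (neg C f) = Cod C f"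
  using group.inv_closed[OF Hom_group, of "Dom C f" "Cod C f" f]
  by (simp_all add: hom_group_def neg_def Hom_iff Dom_closed Cod_closed)

lemma Add_associative:
  "\<lbrakk>f \<in> Arr C; g \<in> Arr C; h \<in> Arr C; Dom C f = Dom C g; Cod C f = Cod C g;
    Dom C g = Dom C h; Cod C g = Cod C h\<rbrakk> \<Longrightarrow> (f \<boxplus> g) \<boxplus> h = f \<boxplus> (g \<boxplus> h)"
  using Hom_comm_group(3)[of "Dom C f" "Cod C f" f g h] by (simp add: Hom_iff Dom_closed Cod_closed)

lemma Add_commute:
  "\<lbrakk>f \<in> Arr C; g \<in> Arr C; Dom C f = Dom C g; Cod C f = Cod C g\<rbrakk> \<Longrightarrow> f \<boxplus> g = g \<boxplus> f"
  using Hom_comm_group(4)[of "Dom C f" "Cod C f" f g] by (simp add: Hom_iff Dom_closed Cod_closed)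

lemma Add_left_commute:
  "\<lbrakk>f \<in> Arr C; g \<in> Arr C; h \<in> Arr C; Dom C f = Dom C g; Cod C f = Cod C g;
    Dom C g = Dom C h; Cod C g = Cod C h\<rbrakk> \<Longrightarrow> f \<boxplus> (g \<boxplus> h) = g \<boxplus> (f \<boxplus> h)"
  by (metis Add_associative Add_commute)

lemma Zer_Add: "\<lbrakk>f \<in> Arr C; Dom C f = X; Cod C f = Y\<rbrakk> \<Longrightarrow> Zer C X Y \<boxplus> f = f"
  using Hom_comm_group(5)[of X Y f] by (auto simp add: Hom_iff Dom_closed Cod_closed)

lemma Add_Zer: "\<lbrakk>f \<in> Arr C; Dom C f = X; Cod C f = Y\<rbrakk> \<Longrightarrow> f \<boxplus> Zer C X Y = f"
  using Zer_Add[of f X Y] by (metis Add_commute Cod_Zer Cod_closed Dom_Zer Dom_closed Zer_Arr)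

lemma neg_Add: "f \<in> Arr C \<Longrightarrow> neg C f \<boxplus> f = Zer C (Dom C f) (Cod C f)"
  using group.l_inv[OF Hom_group, of "Dom C f" "Cod C f" f]
  by (simp add: hom_group_def neg_def Hom_iff Dom_closed Cod_closed)

lemma Add_neg: "f \<in> Arr C \<Longrightarrow> f \<boxplus> neg C f = Zer C (Dom C f) (Cod C f)"
  by (metis neg_Add Add_commute neg_Arr Dom_neg Cod_neg)

lemma Add_neg_cancel:
  "\<lbrakk>f \<in> Arr C; g \<in> Arr C; Dom C f = Dom C g; Cod C f = Cod C g\<rbrakk> \<Longrightarrow> f \<boxplus> (neg C f \<boxplus> g) = g"
  by (simp add: Add_associative[symmetric] neg_Arr Dom_neg Cod_neg Add_neg Zer_Add)

lemma neg_Add_cancel: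
  "\<lbrakk>f \<in> Arr C; g \<in> Arr C; Dom C f = Dom C g; Cod C f = Cod C g\<rbrakk> \<Longrightarrow> neg C f \<boxplus> (f \<boxplus> g) = g"
  by (simp add: Add_associative[symmetric] neg_Arr Dom_neg Cod_neg neg_Add Zer_Add)

lemma Add_right_cancel:
  "\<lbrakk>f \<boxplus> h = g \<boxplus> h; f \<in> Arr C; g \<in> Arr C; h \<in> Arr C; Dom C f = Dom C h; Cod C f = Cod C h;
    Dom C g = Dom C h; Cod C g = Cod C h\<rbrakk> \<Longrightarrow> f = g"
  by (metis Add_commute neg_Add_cancel)

lemma Comp_Add_distrib_left:
  "\<lbrakk>f \<in> Arr C; g \<in> Arr C; h \<in> Arr C; Dom C f = Dom C g; Cod C f = Cod C g; Cod C g = Dom C h\<rbrakk>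
    \<Longrightarrow> (f \<boxplus> g) \<cdot> h = (f \<cdot> h) \<boxplus> (g \<cdot> h)"
  using Comp_Add_left[of f "Dom C f" "Cod C f" g h "Cod C h"] by (simp add: Hom_iff)

lemma Comp_Add_distrib_right:
  "\<lbrakk>f \<in> Arr C; g \<in> Arr C; h \<in> Arr C; Dom C g = Dom C h; Cod C g = Cod C h; Cod C f = Dom C h\<rbrakk>
    \<Longrightarrow> f \<cdot> (g \<boxplus> h) = (f \<cdot> g) \<boxplus> (f \<cdot> h)"
  using Comp_Add_right[of f "Dom C f" "Cod C f" g "Cod C g" h] by (simp add: Hom_iff)

text \<open>Cancellation in the \<open>Hom\<close> group. Distributivity and additivity only yield
  equations of the form \<open>z + z = z\<close>, and this turns them into statements about zero
  morphisms.\<close>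

lemma idempotent_is_Zer:
  "\<lbrakk>f \<boxplus> f = f; f \<in> Arr C\<rbrakk> \<Longrightarrow> f = Zer C (Dom C f) (Cod C f)"
  by (metis Add_right_cancel Zer_Add Zer_Arr Dom_Zer Cod_Zer Dom_closed Cod_closed)

lemma Comp_Zer:
  assumes "f \<in> Arr C" "Cod C f = Y" "Z \<in> Obj C"
  shows "f \<cdot> Zer C Y Z = Zer C (Dom C f) Z"
proof -
  have Y: "Y \<in> Obj C" using assms Cod_closed by blast
  have "f \<cdot> Zer C Y Z \<boxplus> f \<cdot> Zer C Y Z = f \<cdot> Zer C Y Z"
    using assms Y by (simp add: Comp_Add_distrib_right[symmetric] Zer_Add Zer_Arr Dom_Zer Cod_Zer)
  from idempotent_is_Zer[OF this] show ?thesis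
    using assms Y by (simp add: Comp_Arr Dom_Comp Cod_Comp Zer_Arr Dom_Zer Cod_Zer)
qed

lemma Zer_Comp:
  assumes "f \<in> Arr C" "Dom C f = Y" "X \<in> Obj C"
  shows "Zer C X Y \<cdot> f = Zer C X (Cod C f)"
proof -
  have Y: "Y \<in> Obj C" using assms Dom_closed by blast
  have "Zer C X Y \<cdot> f \<boxplus> Zer C X Y \<cdot> f = Zer C X Y \<cdot> f"
    using assms Y by (simp add: Comp_Add_distrib_left[symmetric] Zer_Add Zer_Arr Dom_Zer Cod_Zer)
  from idempotent_is_Zer[OF this] show ?thesis
    using assms Y by (simp add: Comp_Arr Dom_Comp Cod_Comp Zer_Arr Dom_Zer Cod_Zer)
qed

lemma neg_unique:
  "\<lbrakk>f \<boxplus> g = Zer C (Dom C g) (Cod C g); f \<in> Arr C; g \<in> Arr C; Dom C f = Dom C g;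
    Cod C f = Cod C g\<rbrakk> \<Longrightarrow> f = neg C g"
  by (rule Add_right_cancel[of f g "neg C g"]) (simp_all add: neg_Add neg_Arr Dom_neg Cod_neg)

lemma Comp_neg:
  "\<lbrakk>f \<in> Arr C; g \<in> Arr C; Cod C f = Dom C g\<rbrakk> \<Longrightarrow> f \<cdot> neg C g = neg C (f \<cdot> g)"
  by (rule neg_unique) (simp_all add: Comp_Add_distrib_right[symmetric] neg_Add neg_Arr Dom_neg
      Cod_neg Comp_Arr Dom_Comp Cod_Comp Comp_Zer Cod_closed)

lemma neg_Comp:
  "\<lbrakk>f \<in> Arr C; g \<in> Arr C; Cod C f = Dom C g\<rbrakk> \<Longrightarrow> neg C f \<cdot> g = neg C (f \<cdot> g)"
  by (rule neg_unique) (simp_all add: Comp_Add_distrib_left[symmetric] neg_Add neg_Arr Dom_neg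
      Cod_neg Comp_Arr Dom_Comp Cod_Comp Zer_Comp Dom_closed)

lemma neg_neg: "f \<in> Arr C \<Longrightarrow> neg C (neg C f) = f"
  by (rule neg_unique[symmetric]) (simp_all add: Add_neg neg_Arr Dom_neg Cod_neg)

lemma neg_Zer: "\<lbrakk>X \<in> Obj C; Y \<in> Obj C\<rbrakk> \<Longrightarrow> neg C (Zer C X Y) = Zer C X Y"
  by (rule neg_unique[symmetric]) (simp_all add: Zer_Add Zer_Arr Dom_Zer Cod_Zer)

lemma neg_of_Add:
  assumes "f \<in> Arr C" "g \<in> Arr C" "Dom C f = Dom C g" "Cod C f = Cod C g"
  shows "neg C (f \<boxplus> g) = neg C f \<boxplus> neg C g"
proof (rule neg_unique[symmetric])
  have "(neg C f \<boxplus> neg C g) \<boxplus> (f \<boxplus> g) = neg C f \<boxplus> (f \<boxplus> (neg C g \<boxplus> g))"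
    using assms by (simp add: Add_associative Add_left_commute[of "neg C g" f g] Add_Arr Dom_Add
        Cod_Add neg_Arr Dom_neg Cod_neg)
  thus "(neg C f \<boxplus> neg C g) \<boxplus> (f \<boxplus> g) = Zer C (Dom C (f \<boxplus> g)) (Cod C (f \<boxplus> g))"
    using assms by (simp add: neg_Add neg_Add_cancel Add_Arr Dom_Add Cod_Add Zer_Arr Dom_Zer Cod_Zer
        Dom_closed Cod_closed)
qed (use assms in \<open>simp_all add: Add_Arr Dom_Add Cod_Add neg_Arr Dom_neg Cod_neg\<close>)

lemma Zob_Obj: "Zob C \<in> Obj C"
  using zero_object_Zob by (simp add: is_zero_object_def)

lemmas add_simps = cat_simps Zob_Obj Zer_Arr Dom_Zer Cod_Zer Add_Arr Dom_Add Cod_Add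
  neg_Arr Dom_neg Cod_neg Zer_Add Add_Zer neg_Add Add_neg Comp_Zer Zer_Comp Comp_neg neg_Comp
  neg_neg neg_Zer neg_of_Add Comp_Add_distrib_left Comp_Add_distrib_right Add_associative
  neg_Add_cancel Add_neg_cancel

lemmas Add_ac = Add_associative Add_commute Add_left_commute

lemma difference_zero:
  assumes "f \<boxplus> neg C g = Zer C (Dom C g) (Cod C g)" "f \<in> Arr C" "g \<in> Arr C"
    "Dom C f = Dom C g" "Cod C f = Cod C g"
  shows "f = g"
proof -
  have "f = neg C (neg C g)" by (rule neg_unique) (use assms in \<open>simp_all add: neg_Arr Dom_neg Cod_neg\<close>)
  thus ?thesis using assms by (simp add: neg_neg)
qed

text \<open>By bilinearity, a test against two parallel morphisms is a test against their
  difference.\<close>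

lemma mono_iff:
  "is_mono C f \<longleftrightarrow> f \<in> Arr C \<and>
    (\<forall>X\<in>Obj C. \<forall>g\<in>Hom C X (Dom C f). g \<cdot> f = Zer C X (Cod C f) \<longrightarrow> g = Zer C X (Dom C f))"
    (is "_ \<longleftrightarrow> ?R")
proof
  assume m: "is_mono C f"
  hence f: "f \<in> Arr C" by (simp add: is_mono_def)
  show ?R
  proof (intro conjI ballI impI f)
    fix X g assume "X \<in> Obj C" "g \<in> Hom C X (Dom C f)" "g \<cdot> f = Zer C X (Cod C f)"
    thus "g = Zer C X (Dom C f)"
      by - (rule mono_cancel[OF m], simp_all add: add_simps f Hom_iff)
  qed
next
  assume r: ?R
  show "is_mono C f"
    unfolding is_mono_def
  proof (intro conjI ballI impI)
    show f: "f \<in> Arr C" using r by simp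
    fix X g h assume a: "X \<in> Obj C" "g \<in> Hom C X (Dom C f)" "h \<in> Hom C X (Dom C f)"
      "g \<cdot> f = h \<cdot> f"
    have gh: "g \<boxplus> neg C h \<in> Hom C X (Dom C f)" using a by (simp add: add_simps Hom_iff)
    have "(g \<boxplus> neg C h) \<cdot> f = Zer C X (Cod C f)" using a f by (simp add: add_simps Hom_iff)
    hence "g \<boxplus> neg C h = Zer C X (Dom C f)" using r a(1) gh by blast
    thus "g = h" by - (rule difference_zero, use a in \<open>simp_all add: Hom_iff\<close>)
  qed
qed

end

section \<open>The opposite category\<close>

text \<open>Objects and arrows stay the same elements; only source, target, composition and the
  indexing of zero morphisms change. Hence a functor record from \<open>C\<close> to
  \<open>D\<close> serves unchanged as a functor between the opposites, and dual notions are
  exchanged by plain rewriting.\<close>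

definition opp :: "('o, 'm, 'z) add_category_scheme \<Rightarrow> ('o, 'm, 'z) add_category_scheme" where
  "opp C = C\<lparr>Dom := Cod C, Cod := Dom C, Comp := \<lambda>f g. Comp C g f, Zer := \<lambda>X Y. Zer C Y X\<rparr>"

lemma opp_sel [simp]:
  "Obj (opp C) = Obj C" "Arr (opp C) = Arr C" "Dom (opp C) = Cod C" "Cod (opp C) = Dom C"
  "Ide (opp C) = Ide C" "Comp (opp C) f g = Comp C g f" "Add (opp C) = Add C"
  "Zer (opp C) X Y = Zer C Y X" "Zob (opp C) = Zob C"
  by (simp_all add: opp_def)

lemma Hom_opp [simp]: "Hom (opp C) X Y = Hom C Y X"
  by (auto simp: Hom_iff)

lemma hom_group_opp: "hom_group (opp C) X Y = hom_group C Y X"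
  by (simp add: hom_group_def)

lemma neg_opp [simp]: "neg (opp C) f = neg C f"
  by (simp add: neg_def hom_group_opp)

lemma is_mono_opp [simp]: "is_mono (opp C) f \<longleftrightarrow> is_epi C f"
  by (simp add: is_mono_def is_epi_def)

lemma is_epi_opp [simp]: "is_epi (opp C) f \<longleftrightarrow> is_mono C f"
  by (simp add: is_mono_def is_epi_def)

lemma is_kernel_opp [simp]: "is_kernel (opp C) f k \<longleftrightarrow> is_cokernel C f k"
  by (auto simp add: is_kernel_def is_cokernel_def)

lemma is_cokernel_opp [simp]: "is_cokernel (opp C) f k \<longleftrightarrow> is_kernel C f k"
  by (auto simp add: is_kernel_def is_cokernel_def)

lemma is_zero_object_opp [simp]: "is_zero_object (opp C) Z \<longleftrightarrow> is_zero_object C Z"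
  by (auto simp add: is_zero_object_def)

lemma is_biproduct_opp [simp]: "is_biproduct (opp C) X Y S i j p q \<longleftrightarrow> is_biproduct C X Y S p q i j"
  unfolding is_biproduct_def opp_sel Hom_opp by (rule iffI; elim conjE; intro conjI; assumption)

lemma (in additive_category) additive_category_opp: "additive_category (opp C)"
  by (intro additive_category.intro additive_category_axioms.intro category.intro)
    (simp_all add: add_simps Hom_iff hom_group_opp comm_group_Hom zero_object_Zob biproduct_exists,
     use biproduct_exists in blast)

lemma (in additive_category) epi_Comp:
  "\<lbrakk>is_epi C f; is_epi C g; Cod C f = Dom C g\<rbrakk> \<Longrightarrow> is_epi C (f \<cdot> g)"
  using category.mono_Comp[OF additive_category.axioms(1)[OF additive_category_opp], of g f] by simp

lemma (in abelian_category) abelian_category_opp: "abelian_category (opp C)"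
  by (intro abelian_category.intro abelian_category_axioms.intro additive_category_opp)
    (simp_all add: kernel_exists cokernel_exists mono_is_kernel epi_is_cokernel)

lemma (in additive_functor) additive_functor_opp: "additive_functor (opp C) (opp D) F"
  by (intro additive_functor.intro additive_functor_axioms.intro category_functor.intro
      category_functor_axioms.intro C.additive_category_opp D.additive_category_opp
      additive_category.axioms(1)[OF C.additive_category_opp]
      additive_category.axioms(1)[OF D.additive_category_opp])
    (simp_all add: omap_closed amap_closed amap_Ide amap_Comp amap_Add)

section \<open>Quotients by ideals\<close>

locale additive_ideal = additive_category C
  for C :: "('o, 'm, 'z) add_category_scheme" (structure) +
  fixes J :: "'m set"
  assumes ideal_Arr: "f \<in> J \<Longrightarrow> f \<in> Arr C"
    and ideal_Zer: "\<lbrakk>X \<in> Obj C; Y \<in> Obj C\<rbrakk> \<Longrightarrow> Zer C X Y \<in> J"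
    and ideal_Add: "\<lbrakk>f \<in> J; g \<in> J; Dom C f = Dom C g; Cod C f = Cod C g\<rbrakk> \<Longrightarrow> f \<boxplus> g \<in> J"
    and ideal_Comp_left: "\<lbrakk>f \<in> J; g \<in> Arr C; Cod C g = Dom C f\<rbrakk> \<Longrightarrow> g \<cdot> f \<in> J"
    and ideal_Comp_right: "\<lbrakk>f \<in> J; g \<in> Arr C; Cod C f = Dom C g\<rbrakk> \<Longrightarrow> f \<cdot> g \<in> J"
begin

abbreviation "cl \<equiv> residue_class C J"
abbreviation "Q \<equiv> quotient_category C J"

definition congruent :: "'m \<Rightarrow> 'm \<Rightarrow> bool" where
  "congruent f g \<longleftrightarrow> f \<in> Arr C \<and> g \<in> Arr C \<and> Dom C f = Dom C g \<and> Cod C f = Cod C g \<and>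
     f \<boxplus> neg C g \<in> J"

lemma ideal_neg:
  assumes "f \<in> J" shows "neg C f \<in> J"
proof -
  have f: "f \<in> Arr C" using assms by (rule ideal_Arr)
  have "neg C f = f \<cdot> neg C (Ide C (Cod C f))" using f by (simp add: add_simps)
  moreover have "f \<cdot> neg C (Ide C (Cod C f)) \<in> J"
    by (rule ideal_Comp_right) (simp_all add: assms f cat_simps neg_Arr Dom_neg)
  ultimately show ?thesis by simp
qed

lemma congruent_refl: "f \<in> Arr C \<Longrightarrow> congruent f f"
  by (simp add: congruent_def add_simps ideal_Zer)

lemma congruent_sym:
  assumes "congruent f g" shows "congruent g f"
proof -
  have fg: "f \<in> Arr C" "g \<in> Arr C" "Dom C f = Dom C g" "Cod C f = Cod C g" "f \<boxplus> neg C g \<in> J"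
    using assms by (simp_all add: congruent_def)
  have "g \<boxplus> neg C f = neg C (f \<boxplus> neg C g)" using fg by (simp add: add_simps Add_commute)
  thus ?thesis using fg ideal_neg[OF fg(5)] by (simp add: congruent_def)
qed

lemma congruent_trans:
  assumes "congruent f g" "congruent g h" shows "congruent f h"
proof -
  have fg: "f \<in> Arr C" "g \<in> Arr C" "Dom C f = Dom C g" "Cod C f = Cod C g" "f \<boxplus> neg C g \<in> J"
    "h \<in> Arr C" "Dom C g = Dom C h" "Cod C g = Cod C h" "g \<boxplus> neg C h \<in> J"
    using assms by (simp_all add: congruent_def)
  have "(f \<boxplus> neg C g) \<boxplus> (g \<boxplus> neg C h) = f \<boxplus> neg C h" using fg by (simp add: add_simps)
  thus ?thesis using fg ideal_Add[OF fg(5,9)] by (simp add: congruent_def add_simps)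
qed

text \<open>A member of the coset is \<open>j \<boxplus> f\<close> with \<open>j\<close> in the
  ideal, and adding \<open>neg C f\<close> recovers \<open>j\<close>. This replaces cosets by the
  classes of an equivalence relation on arrows.\<close>

lemma residue_class_eq:
  assumes "f \<in> Arr C" shows "cl f = {g. congruent g f}"
proof (rule Set.set_eqI)
  fix g
  have "g \<in> cl f \<longleftrightarrow> (\<exists>j\<in>J. j \<in> Hom C (Dom C f) (Cod C f) \<and> g = j \<boxplus> f)"
    by (auto simp add: residue_class_def r_coset_def hom_group_def)
  also have "\<dots> \<longleftrightarrow> congruent g f"
  proof
    assume "\<exists>j\<in>J. j \<in> Hom C (Dom C f) (Cod C f) \<and> g = j \<boxplus> f"
    then obtain j where j: "j \<in> J" "j \<in> Arr C" "Dom C j = Dom C f" "Cod C j = Cod C f" "g = j \<boxplus> f"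
      by (auto simp: Hom_iff)
    thus "congruent g f" using assms by (simp add: congruent_def add_simps)
  next
    assume "congruent g f"
    thus "\<exists>j\<in>J. j \<in> Hom C (Dom C f) (Cod C f) \<and> g = j \<boxplus> f"
      by (intro bexI[of _ "g \<boxplus> neg C f"]) (auto simp add: congruent_def Hom_iff add_simps)
  qed
  finally show "g \<in> cl f \<longleftrightarrow> g \<in> {g. congruent g f}" by simp
qed

lemma residue_class_eq_iff:
  "\<lbrakk>f \<in> Arr C; g \<in> Arr C\<rbrakk> \<Longrightarrow> cl f = cl g \<longleftrightarrow> congruent f g"
  unfolding residue_class_eq using congruent_refl congruent_sym congruent_trans by blast

lemma residue_class_eq_Zer_iff:
  "\<lbrakk>f \<in> Arr C; Dom C f = X; Cod C f = Y\<rbrakk> \<Longrightarrow> cl f = cl (Zer C X Y) \<longleftrightarrow> f \<in> J"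
  using Dom_closed[of f] Cod_closed[of f] by (simp add: residue_class_eq_iff congruent_def add_simps)

lemma congruent_Comp:
  assumes "congruent f f'" "congruent g g'" "Cod C f = Dom C g"
  shows "congruent (f \<cdot> g) (f' \<cdot> g')"
proof -
  have a: "f \<in> Arr C" "f' \<in> Arr C" "Dom C f = Dom C f'" "Cod C f = Cod C f'" "f \<boxplus> neg C f' \<in> J"
    "g \<in> Arr C" "g' \<in> Arr C" "Dom C g = Dom C g'" "Cod C g = Cod C g'" "g \<boxplus> neg C g' \<in> J"
    using assms by (simp_all add: congruent_def)
  \<comment> \<open>The difference of the composites telescopes as
    \<open>(f - f') g + f' (g - g')\<close>; the ideal absorbs \<open>g\<close> from the right in
    the first summand and \<open>f'\<close> from the left in the second.\<close>
  have "((f \<boxplus> neg C f') \<cdot> g) \<boxplus> (f' \<cdot> (g \<boxplus> neg C g')) \<in> J"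
    by (rule ideal_Add[OF ideal_Comp_right[OF a(5)] ideal_Comp_left[OF a(10)]]) (use a assms(3) in \<open>simp_all add: add_simps\<close>)
  moreover have "((f \<boxplus> neg C f') \<cdot> g) \<boxplus> (f' \<cdot> (g \<boxplus> neg C g')) = (f \<cdot> g) \<boxplus> neg C (f' \<cdot> g')"
    using a assms(3) by (simp add: add_simps)
  ultimately show ?thesis using a assms(3) by (simp add: congruent_def add_simps)
qed

lemma congruent_Add:
  assumes "congruent f f'" "congruent g g'" "Dom C f = Dom C g" "Cod C f = Cod C g"
  shows "congruent (f \<boxplus> g) (f' \<boxplus> g')"
proof -
  have a: "f \<in> Arr C" "f' \<in> Arr C" "Dom C f = Dom C f'" "Cod C f = Cod C f'" "f \<boxplus> neg C f' \<in> J"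
    "g \<in> Arr C" "g' \<in> Arr C" "Dom C g = Dom C g'" "Cod C g = Cod C g'" "g \<boxplus> neg C g' \<in> J"
    using assms by (simp_all add: congruent_def)
  have d: "Dom C f' = Dom C g'" "Cod C f' = Cod C g'" using a assms by simp_all
  have "(f \<boxplus> neg C f') \<boxplus> (g \<boxplus> neg C g') \<in> J"
    by (rule ideal_Add[OF a(5,10)]) (use a d in \<open>simp_all add: add_simps\<close>)
  moreover have "(f \<boxplus> neg C f') \<boxplus> (g \<boxplus> neg C g') = (f \<boxplus> g) \<boxplus> neg C (f' \<boxplus> g')"
    using a d by (simp add: add_simps Add_left_commute[of "neg C f'" g])
  ultimately show ?thesis using a d by (simp add: congruent_def add_simps)
qed

lemma congruent_in_class: "\<lbrakk>f \<in> Arr C; g \<in> cl f\<rbrakk> \<Longrightarrow> congruent g f"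
  by (simp add: residue_class_eq)

lemma in_class_self: "f \<in> Arr C \<Longrightarrow> f \<in> cl f"
  by (simp add: residue_class_eq congruent_refl)

lemma Arr_quotient: "f \<in> Arr C \<Longrightarrow> cl f \<in> Arr Q"
  by (simp add: quotient_category_def)

lemma Arr_quotientE:
  assumes "x \<in> Arr Q" obtains f where "f \<in> Arr C" "x = cl f"
  using assms by (auto simp add: quotient_category_def)

text \<open>The source of a class is read off as the only element of the set of sources of its
  members; there is only one because congruent arrows are parallel.\<close>

lemma Dom_quotient: "f \<in> Arr C \<Longrightarrow> Dom Q (cl f) = Dom C f"
proof -
  assume f: "f \<in> Arr C"
  have "Dom C g = Dom C f" if "g \<in> cl f" for g
    using congruent_in_class[OF f that] by (simp add: congruent_def)
  hence "Dom C ` cl f = {Dom C f}" using in_class_self[OF f] by blast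
  thus ?thesis by (simp add: quotient_category_def)
qed

lemma Cod_quotient: "f \<in> Arr C \<Longrightarrow> Cod Q (cl f) = Cod C f"
proof -
  assume f: "f \<in> Arr C"
  have "Cod C g = Cod C f" if "g \<in> cl f" for g
    using congruent_in_class[OF f that] by (simp add: congruent_def)
  hence "Cod C ` cl f = {Cod C f}" using in_class_self[OF f] by blast
  thus ?thesis by (simp add: quotient_category_def)
qed

text \<open>Composition in the quotient is a union over all pairs of representatives. Congruence is
  compatible with composition, so every member of the union is the same class and the union
  collapses.\<close>

lemma Comp_quotient:
  assumes "f \<in> Arr C" "g \<in> Arr C" "Cod C f = Dom C g"
  shows "cl f \<cdot>\<^bsub>Q\<^esub> cl g = cl (f \<cdot> g)"
proof -
  have "cl (f' \<cdot> g') = cl (f \<cdot> g)" if "f' \<in> cl f" "g' \<in> cl g" for f' g'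
  proof -
    have c: "congruent f' f" "congruent g' g" using that assms congruent_in_class by blast+
    hence "congruent (f' \<cdot> g') (f \<cdot> g)" using assms(3) by (intro congruent_Comp) (simp_all add: congruent_def)
    thus ?thesis using residue_class_eq_iff congruent_def by blast
  qed
  hence "(\<Union>f'\<in>cl f. \<Union>g'\<in>cl g. cl (f' \<cdot> g')) = cl (f \<cdot> g)"
    using in_class_self[OF assms(1)] in_class_self[OF assms(2)] by blast
  thus ?thesis by (simp add: quotient_category_def)
qed

lemma Add_quotient:
  assumes "f \<in> Arr C" "g \<in> Arr C" "Dom C f = Dom C g" "Cod C f = Cod C g"
  shows "cl f \<boxplus>\<^bsub>Q\<^esub> cl g = cl (f \<boxplus> g)"
proof -
  have "cl (f' \<boxplus> g') = cl (f \<boxplus> g)" if "f' \<in> cl f" "g' \<in> cl g" for f' g'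
  proof -
    have c: "congruent f' f" "congruent g' g" using that assms congruent_in_class by blast+
    hence "congruent (f' \<boxplus> g') (f \<boxplus> g)" using assms(3,4) by (intro congruent_Add) (simp_all add: congruent_def)
    thus ?thesis using residue_class_eq_iff congruent_def by blast
  qed
  hence "(\<Union>f'\<in>cl f. \<Union>g'\<in>cl g. cl (f' \<boxplus> g')) = cl (f \<boxplus> g)"
    using in_class_self[OF assms(1)] in_class_self[OF assms(2)] by blast
  thus ?thesis by (simp add: quotient_category_def)
qed

lemma quotient_sel: "Obj Q = Obj C" "Ide Q X = cl (Ide C X)" "Zer Q X Y = cl (Zer C X Y)"
  "Zob Q = Zob C"
  by (simp_all add: quotient_category_def)

lemmas quotient_simps = Arr_quotient Dom_quotient Cod_quotient Comp_quotient Add_quotient quotient_sel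

lemma Hom_quotientE:
  assumes "x \<in> Hom Q X Y"
  obtains f where "f \<in> Arr C" "Dom C f = X" "Cod C f = Y" "x = cl f"
  using assms by (auto simp: Hom_iff quotient_simps elim!: Arr_quotientE)

lemma Hom_quotient: "\<lbrakk>f \<in> Arr C; Dom C f = X; Cod C f = Y\<rbrakk> \<Longrightarrow> cl f \<in> Hom Q X Y"
  by (simp add: Hom_iff quotient_simps)

lemma comm_group_quotient:
  assumes XY: "X \<in> Obj C" "Y \<in> Obj C"
  shows "comm_group (hom_group Q X Y)"
proof (rule comm_groupI; simp add: hom_group_def)
  show "Zer Q X Y \<in> Hom Q X Y"
    using XY by (simp add: quotient_simps add_simps Hom_iff)
next
  fix x y assume "x \<in> Hom Q X Y" "y \<in> Hom Q X Y"
  then obtain f g where *: "f \<in> Arr C" "Dom C f = X" "Cod C f = Y" "x = cl f"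
    "g \<in> Arr C" "Dom C g = X" "Cod C g = Y" "y = cl g"
    by (elim Hom_quotientE)
  thus "x \<boxplus>\<^bsub>Q\<^esub> y \<in> Hom Q X Y" by (simp add: Add_quotient Hom_quotient add_simps)
  show "x \<boxplus>\<^bsub>Q\<^esub> y = y \<boxplus>\<^bsub>Q\<^esub> x" using * by (simp add: Add_quotient Add_commute)
next
  fix x y z assume "x \<in> Hom Q X Y" "y \<in> Hom Q X Y" "z \<in> Hom Q X Y"
  then obtain f g h where *: "f \<in> Arr C" "Dom C f = X" "Cod C f = Y" "x = cl f"
    "g \<in> Arr C" "Dom C g = X" "Cod C g = Y" "y = cl g" "h \<in> Arr C" "Dom C h = X" "Cod C h = Y" "z = cl h"
    by (elim Hom_quotientE)
  thus "x \<boxplus>\<^bsub>Q\<^esub> y \<boxplus>\<^bsub>Q\<^esub> z = x \<boxplus>\<^bsub>Q\<^esub> (y \<boxplus>\<^bsub>Q\<^esub> z)" by (simp add: Add_quotient add_simps)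
next
  fix x assume "x \<in> Hom Q X Y"
  then obtain f where *: "f \<in> Arr C" "Dom C f = X" "Cod C f = Y" "x = cl f" by (elim Hom_quotientE)
  thus "Zer Q X Y \<boxplus>\<^bsub>Q\<^esub> x = x" using XY by (simp add: quotient_simps add_simps)
  have "cl (neg C f) \<boxplus>\<^bsub>Q\<^esub> x = Zer Q X Y" using * XY by (simp add: quotient_simps add_simps)
  moreover have "cl (neg C f) \<in> Hom Q X Y" using * by (simp add: Hom_quotient add_simps)
  ultimately show "\<exists>y\<in>Hom Q X Y. y \<boxplus>\<^bsub>Q\<^esub> x = Zer Q X Y" by blast
qed

lemma is_biproduct_quotient:
  assumes "is_biproduct C X Y S i j p q" "X \<in> Obj C" "Y \<in> Obj C"
  shows "is_biproduct Q X Y S (cl i) (cl j) (cl p) (cl q)"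
  using assms unfolding is_biproduct_def
  by (simp add: Hom_iff quotient_simps add_simps del: Comp_Add_distrib_left Comp_Add_distrib_right)

lemma is_zero_object_quotient:
  assumes "is_zero_object C Z" shows "is_zero_object Q Z"
proof (rule is_zero_objectI[where z = "Zer Q Z" and z' = "\<lambda>X. Zer Q X Z"])
  have Z: "Z \<in> Obj C" using assms by (simp add: is_zero_object_def)
  thus "Z \<in> Obj Q" by (simp add: quotient_sel)
  show "Zer Q Z X \<in> Hom Q Z X" "Zer Q X Z \<in> Hom Q X Z" if "X \<in> Obj Q" for X
    using that Z by (simp_all add: quotient_sel Hom_quotient add_simps)
  show "f = Zer Q Z X" if "f \<in> Hom Q Z X" for f X
    using that Z zero_object_unique[OF assms]
    by (auto simp: quotient_sel add_simps elim!: Hom_quotientE intro!: arg_cong[of _ _ cl])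
  show "f = Zer Q X Z" if "f \<in> Hom Q X Z" for f X
    using that Z zero_object_unique[OF assms]
    by (auto simp: quotient_sel add_simps elim!: Hom_quotientE intro!: arg_cong[of _ _ cl])
qed

lemma additive_category_quotient: "additive_category Q"
proof (intro additive_category.intro additive_category_axioms.intro category.intro)
  show "comm_group (hom_group Q X Y)" if "X \<in> Obj Q" "Y \<in> Obj Q" for X Y
    using that by (intro comm_group_quotient) (simp_all add: quotient_simps)
  show "is_zero_object Q (Zob Q)"
    by (simp add: quotient_simps is_zero_object_quotient zero_object_Zob)
  show "\<exists>S i j p q. is_biproduct Q X Y S i j p q" if "X \<in> Obj Q" "Y \<in> Obj Q" for X Y
    using that biproduct_exists[of X Y] is_biproduct_quotient[of X Y] by (simp add: quotient_simps) blast
qed (auto simp add: quotient_simps add_simps Hom_iff elim!: Arr_quotientE)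

end

section \<open>The Adelman category\<close>

lemma diagrams_iff: "(a0, a1) \<in> diagrams C \<longleftrightarrow> a0 \<in> Arr C \<and> a1 \<in> Arr C \<and> Cod C a0 = Dom C a1"
  by (simp add: diagrams_def)

lemma diagram_arrows_iff:
  "((a0, a1), (f0, f1, f2), (b0, b1)) \<in> diagram_arrows C \<longleftrightarrow>
     a0 \<in> Arr C \<and> a1 \<in> Arr C \<and> Cod C a0 = Dom C a1 \<and>
     b0 \<in> Arr C \<and> b1 \<in> Arr C \<and> Cod C b0 = Dom C b1 \<and>
     f0 \<in> Arr C \<and> Dom C f0 = Dom C a0 \<and> Cod C f0 = Dom C b0 \<and>
     f1 \<in> Arr C \<and> Dom C f1 = Dom C a1 \<and> Cod C f1 = Dom C b1 \<and>
     f2 \<in> Arr C \<and> Dom C f2 = Cod C a1 \<and> Cod C f2 = Cod C b1 \<and>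
     a0 \<cdot>\<^bsub>C\<^esub> f1 = f0 \<cdot>\<^bsub>C\<^esub> b0 \<and> a1 \<cdot>\<^bsub>C\<^esub> f2 = f1 \<cdot>\<^bsub>C\<^esub> b1"
  by (auto simp add: diagram_arrows_def diagrams_def Hom_iff ob0_def ob1_def ob2_def)

lemma null_homotopic_iff:
  "((a0, a1), (f0, f1, f2), (b0, b1)) \<in> null_homotopic C \<longleftrightarrow>
     ((a0, a1), (f0, f1, f2), (b0, b1)) \<in> diagram_arrows C \<and>
     (\<exists>s t. s \<in> Arr C \<and> Dom C s = Dom C a1 \<and> Cod C s = Dom C b0 \<and>
            t \<in> Arr C \<and> Dom C t = Cod C a1 \<and> Cod C t = Dom C b1 \<and>
            (s \<cdot>\<^bsub>C\<^esub> b0) \<boxplus>\<^bsub>C\<^esub> (a1 \<cdot>\<^bsub>C\<^esub> t) = f1)" (is "?l \<longleftrightarrow> ?r")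
proof -
  have "?l \<longleftrightarrow> ((a0, a1), (f0, f1, f2), (b0, b1)) \<in> diagram_arrows C \<and>
    (\<exists>s \<in> Hom C (Cod C a0) (Dom C b0). \<exists>t \<in> Hom C (Cod C a1) (Cod C b0).
          (s \<cdot>\<^bsub>C\<^esub> b0) \<boxplus>\<^bsub>C\<^esub> (a1 \<cdot>\<^bsub>C\<^esub> t) = f1)"
    by (simp add: null_homotopic_def ob0_def ob1_def ob2_def)
  also have "\<dots> \<longleftrightarrow> ?r"
    unfolding Bex_def Hom_iff diagram_arrows_iff by (intro conj_cong refl) auto
  finally show ?thesis .
qed

lemma null_homotopicI:
  assumes "((a0, a1), (f0, f1, f2), (b0, b1)) \<in> diagram_arrows C"
    "s \<in> Arr C" "Dom C s = Dom C a1" "Cod C s = Dom C b0"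
    "t \<in> Arr C" "Dom C t = Cod C a1" "Cod C t = Dom C b1"
    "(s \<cdot>\<^bsub>C\<^esub> b0) \<boxplus>\<^bsub>C\<^esub> (a1 \<cdot>\<^bsub>C\<^esub> t) = f1"
  shows "((a0, a1), (f0, f1, f2), (b0, b1)) \<in> null_homotopic C"
  using assms unfolding null_homotopic_iff by blast

lemma diagram_sel:
  "Obj (diagram_category C) = diagrams C" "Arr (diagram_category C) = diagram_arrows C"
  "Dom (diagram_category C) (A, f, B) = A" "Cod (diagram_category C) (A, f, B) = B"
  "Ide (diagram_category C) (a0, a1) =
    ((a0, a1), (Ide C (Dom C a0), Ide C (Cod C a0), Ide C (Cod C a1)), (a0, a1))"
  "(A, (f0, f1, f2), A') \<cdot>\<^bsub>diagram_category C\<^esub> (B', (g0, g1, g2), B) =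
    (A, (f0 \<cdot>\<^bsub>C\<^esub> g0, f1 \<cdot>\<^bsub>C\<^esub> g1, f2 \<cdot>\<^bsub>C\<^esub> g2), B)"
  "(A, (f0, f1, f2), B) \<boxplus>\<^bsub>diagram_category C\<^esub> (A', (g0, g1, g2), B') =
    (A, (f0 \<boxplus>\<^bsub>C\<^esub> g0, f1 \<boxplus>\<^bsub>C\<^esub> g1, f2 \<boxplus>\<^bsub>C\<^esub> g2), B)"
  "Zer (diagram_category C) (a0, a1) (b0, b1) =
    ((a0, a1), (Zer C (Dom C a0) (Dom C b0), Zer C (Cod C a0) (Cod C b0), Zer C (Cod C a1) (Cod C b1)),
      (b0, b1))"
  "Zob (diagram_category C) = (Zer C (Zob C) (Zob C), Zer C (Zob C) (Zob C))"
  by (simp_all add: diagram_category_def ob0_def ob1_def ob2_def)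

lemma diagram_arrowE:
  assumes "f \<in> diagram_arrows C"
  obtains a0 a1 f0 f1 f2 b0 b1 where "f = ((a0, a1), (f0, f1, f2), (b0, b1))"
  using assms by (cases f) auto

lemma Hom_diagramE:
  assumes "f \<in> Hom (diagram_category C) (a0, a1) (b0, b1)"
  obtains f0 f1 f2 where "f = ((a0, a1), (f0, f1, f2), (b0, b1))"
    "((a0, a1), (f0, f1, f2), (b0, b1)) \<in> diagram_arrows C"
  using assms by (cases f) (auto simp: Hom_iff diagram_sel)

lemma Hom_diagram_iff:
  "(A, f, B) \<in> Hom (diagram_category C) A' B' \<longleftrightarrow> A' = A \<and> B' = B \<and> (A, f, B) \<in> diagram_arrows C"
  by (auto simp: Hom_iff diagram_sel)

section \<open>Diagrams form an additive category, in which the null-homotopic morphisms are an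
  ideal\<close>

context additive_category
begin

lemma biproductD:
  assumes "is_biproduct C X Y S i j p q"
  shows "S \<in> Obj C" "i \<in> Arr C" "Dom C i = X" "Cod C i = S" "j \<in> Arr C" "Dom C j = Y" "Cod C j = S"
    "p \<in> Arr C" "Dom C p = S" "Cod C p = X" "q \<in> Arr C" "Dom C q = S" "Cod C q = Y"
    "i \<cdot> p = Ide C X" "i \<cdot> q = Zer C X Y" "j \<cdot> p = Zer C Y X" "j \<cdot> q = Ide C Y"
    "X \<in> Obj C" "Y \<in> Obj C"
    "\<lbrakk>x \<in> Arr C; Dom C x = X\<rbrakk> \<Longrightarrow> i \<cdot> (p \<cdot> x) = x"
    "\<lbrakk>x \<in> Arr C; Dom C x = Y\<rbrakk> \<Longrightarrow> i \<cdot> (q \<cdot> x) = Zer C X (Cod C x)"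
    "\<lbrakk>x \<in> Arr C; Dom C x = X\<rbrakk> \<Longrightarrow> j \<cdot> (p \<cdot> x) = Zer C Y (Cod C x)"
    "\<lbrakk>x \<in> Arr C; Dom C x = Y\<rbrakk> \<Longrightarrow> j \<cdot> (q \<cdot> x) = x"
proof -
  note * = assms[unfolded is_biproduct_def Hom_iff]
  show s: "S \<in> Obj C" "i \<in> Arr C" "Dom C i = X" "Cod C i = S" "j \<in> Arr C" "Dom C j = Y" "Cod C j = S"
    "p \<in> Arr C" "Dom C p = S" "Cod C p = X" "q \<in> Arr C" "Dom C q = S" "Cod C q = Y"
    "i \<cdot> p = Ide C X" "i \<cdot> q = Zer C X Y" "j \<cdot> p = Zer C Y X" "j \<cdot> q = Ide C Y"
    using * by simp_all
  show XY: "X \<in> Obj C" "Y \<in> Obj C" using s Dom_closed by blast+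
  show "\<lbrakk>x \<in> Arr C; Dom C x = X\<rbrakk> \<Longrightarrow> i \<cdot> (p \<cdot> x) = x"
    using Comp_reassoc[OF s(14)] s XY by (simp add: cat_simps)
  show "\<lbrakk>x \<in> Arr C; Dom C x = Y\<rbrakk> \<Longrightarrow> i \<cdot> (q \<cdot> x) = Zer C X (Cod C x)"
    using Comp_reassoc[OF s(15)] s XY by (simp add: Zer_Comp)
  show "\<lbrakk>x \<in> Arr C; Dom C x = X\<rbrakk> \<Longrightarrow> j \<cdot> (p \<cdot> x) = Zer C Y (Cod C x)"
    using Comp_reassoc[OF s(16)] s XY by (simp add: Zer_Comp)
  show "\<lbrakk>x \<in> Arr C; Dom C x = Y\<rbrakk> \<Longrightarrow> j \<cdot> (q \<cdot> x) = x"
    using Comp_reassoc[OF s(17)] s XY by (simp add: cat_simps)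
qed

lemma biproduct_sum:
  assumes "is_biproduct C X Y S i j p q"
  shows "p \<cdot> i \<boxplus> q \<cdot> j = Ide C S"
  using assms by (simp add: is_biproduct_def)

lemma biproduct_decompose:
  assumes "is_biproduct C X Y S i j p q" "u \<in> Arr C" "Cod C u = S"
  shows "u = (u \<cdot> p) \<cdot> i \<boxplus> (u \<cdot> q) \<cdot> j"
proof -
  have "u = u \<cdot> (p \<cdot> i \<boxplus> q \<cdot> j)"
    using assms(2,3) biproduct_sum[OF assms(1)] by (simp add: cat_simps)
  thus ?thesis using assms(2,3) biproductD[OF assms(1)] by (simp add: add_simps)
qed

lemma diagram_Comp:
  assumes "((a0, a1), (f0, f1, f2), (b0, b1)) \<in> diagram_arrows C"
    "((b0, b1), (g0, g1, g2), (c0, c1)) \<in> diagram_arrows C"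
  shows "((a0, a1), (f0 \<cdot> g0, f1 \<cdot> g1, f2 \<cdot> g2), (c0, c1)) \<in> diagram_arrows C"
proof -
  note * = assms[unfolded diagram_arrows_iff]
  have "a0 \<cdot> (f1 \<cdot> g1) = (f0 \<cdot> b0) \<cdot> g1" using * by (intro Comp_reassoc) simp_all
  moreover have "a1 \<cdot> (f2 \<cdot> g2) = (f1 \<cdot> b1) \<cdot> g2" using * by (intro Comp_reassoc) simp_all
  ultimately show ?thesis using * by (simp add: diagram_arrows_iff cat_simps)
qed

lemma diagram_Ide: "(a0, a1) \<in> diagrams C \<Longrightarrow>
    ((a0, a1), (Ide C (Dom C a0), Ide C (Cod C a0), Ide C (Cod C a1)), (a0, a1)) \<in> diagram_arrows C"
  by (simp add: diagram_arrows_iff diagrams_iff cat_simps)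

lemma diagram_Add:
  assumes "((a0, a1), (f0, f1, f2), (b0, b1)) \<in> diagram_arrows C"
    "((a0, a1), (g0, g1, g2), (b0, b1)) \<in> diagram_arrows C"
  shows "((a0, a1), (f0 \<boxplus> g0, f1 \<boxplus> g1, f2 \<boxplus> g2), (b0, b1)) \<in> diagram_arrows C"
  using assms by (simp add: diagram_arrows_iff add_simps)

lemma diagram_neg:
  assumes "((a0, a1), (f0, f1, f2), (b0, b1)) \<in> diagram_arrows C"
  shows "((a0, a1), (neg C f0, neg C f1, neg C f2), (b0, b1)) \<in> diagram_arrows C"
  using assms by (simp add: diagram_arrows_iff add_simps)

lemma diagram_Zer:
  assumes "(a0, a1) \<in> diagrams C" "(b0, b1) \<in> diagrams C"
  shows "((a0, a1), (Zer C (Dom C a0) (Dom C b0), Zer C (Cod C a0) (Cod C b0),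
    Zer C (Cod C a1) (Cod C b1)), (b0, b1)) \<in> diagram_arrows C"
  using assms by (simp add: diagram_arrows_iff diagrams_iff add_simps)

lemma comm_group_diagram:
  assumes "A \<in> diagrams C" "B \<in> diagrams C"
  shows "comm_group (hom_group (diagram_category C) A B)"
proof -
  obtain a0 a1 b0 b1 where AB: "A = (a0, a1)" "B = (b0, b1)" by (cases A, cases B)
  note ab = assms[unfolded AB]
  let ?D = "diagram_category C" and ?H = "Hom (diagram_category C) (a0, a1) (b0, b1)"
  show ?thesis
    unfolding AB
  proof (rule comm_groupI; simp add: hom_group_def)
    show "Zer ?D (a0, a1) (b0, b1) \<in> ?H"
      using diagram_Zer[OF ab] by (simp add: diagram_sel Hom_diagram_iff)
  next
    fix x y assume "x \<in> ?H" "y \<in> ?H"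
    thus "x \<boxplus>\<^bsub>?D\<^esub> y \<in> ?H" "x \<boxplus>\<^bsub>?D\<^esub> y = y \<boxplus>\<^bsub>?D\<^esub> x"
      by (auto elim!: Hom_diagramE simp: diagram_sel Hom_diagram_iff diagram_Add)
        (simp_all add: diagram_arrows_iff Add_commute)
  next
    fix x y z assume "x \<in> ?H" "y \<in> ?H" "z \<in> ?H"
    thus "x \<boxplus>\<^bsub>?D\<^esub> y \<boxplus>\<^bsub>?D\<^esub> z = x \<boxplus>\<^bsub>?D\<^esub> (y \<boxplus>\<^bsub>?D\<^esub> z)"
      by (auto elim!: Hom_diagramE simp: diagram_sel diagram_arrows_iff Add_associative)
  next
    fix x assume "x \<in> ?H"
    then obtain f0 f1 f2 where
      x: "x = ((a0, a1), (f0, f1, f2), (b0, b1))" "((a0, a1), (f0, f1, f2), (b0, b1)) \<in> diagram_arrows C"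
      by (elim Hom_diagramE)
    thus "Zer ?D (a0, a1) (b0, b1) \<boxplus>\<^bsub>?D\<^esub> x = x"
      by (simp add: diagram_sel diagram_arrows_iff Zer_Add)
    have "((a0, a1), (neg C f0, neg C f1, neg C f2), (b0, b1)) \<boxplus>\<^bsub>?D\<^esub> x = Zer ?D (a0, a1) (b0, b1)"
      using x by (simp add: diagram_sel diagram_arrows_iff neg_Add)
    thus "\<exists>y\<in>?H. y \<boxplus>\<^bsub>?D\<^esub> x = Zer ?D (a0, a1) (b0, b1)"
      using Hom_diagram_iff[THEN iffD2, OF conjI[OF refl conjI[OF refl diagram_neg[OF x(2)]]]] by blast
  qed
qed

lemma biproduct_diagram:
  assumes "A \<in> diagrams C" "B \<in> diagrams C"
  shows "\<exists>S i j p q. is_biproduct (diagram_category C) A B S i j p q"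
proof -
  obtain a0 a1 b0 b1 where AB: "A = (a0, a1)" "B = (b0, b1)" by (cases A, cases B)
  note ab = assms[unfolded AB diagrams_iff]
  obtain S0 i0 j0 p0 q0 where 0: "is_biproduct C (Dom C a0) (Dom C b0) S0 i0 j0 p0 q0"
    using biproduct_exists[of "Dom C a0" "Dom C b0"] ab by (auto simp: cat_simps)
  obtain S1 i1 j1 p1 q1 where 1: "is_biproduct C (Dom C a1) (Dom C b1) S1 i1 j1 p1 q1"
    using biproduct_exists[of "Dom C a1" "Dom C b1"] ab by (auto simp: cat_simps)
  obtain S2 i2 j2 p2 q2 where 2: "is_biproduct C (Cod C a1) (Cod C b1) S2 i2 j2 p2 q2"
    using biproduct_exists[of "Cod C a1" "Cod C b1"] ab by (auto simp: cat_simps)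
  \<comment> \<open>The direct sum of the two diagrams: \<open>a0\<close> and \<open>b0\<close>, and
    likewise \<open>a1\<close> and \<open>b1\<close>, act diagonally on the biproducts taken at the
    three places.\<close>
  let ?s = "(p0 \<cdot> a0 \<cdot> i1 \<boxplus> q0 \<cdot> b0 \<cdot> j1, p1 \<cdot> a1 \<cdot> i2 \<boxplus> q1 \<cdot> b1 \<cdot> j2)"
  note D = biproductD[OF 0] biproductD[OF 1] biproductD[OF 2]
  note S = biproduct_sum[OF 0] biproduct_sum[OF 1] biproduct_sum[OF 2]
  have "is_biproduct (diagram_category C) A B ?s (A, (i0, i1, i2), ?s) (B, (j0, j1, j2), ?s)
      (?s, (p0, p1, p2), A) (?s, (q0, q1, q2), B)"
    using ab D by (simp add: is_biproduct_def AB Hom_diagram_iff diagram_sel diagram_arrows_iff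
        diagrams_iff add_simps S)
  thus ?thesis by blast
qed

lemma is_zero_object_diagram:
  "is_zero_object (diagram_category C) (Zob (diagram_category C))"
proof (rule is_zero_objectI)
  let ?D = "diagram_category C" and ?n = "Zer C (Zob C) (Zob C)"
  have zd: "(?n, ?n) \<in> diagrams C" by (simp add: diagrams_iff add_simps)
  thus "Zob ?D \<in> Obj ?D" by (simp add: diagram_sel)
  show "Zer ?D (Zob ?D) A \<in> Hom ?D (Zob ?D) A" "Zer ?D A (Zob ?D) \<in> Hom ?D A (Zob ?D)" if "A \<in> Obj ?D" for A
    using that diagram_Zer[OF zd, of "fst A" "snd A"] diagram_Zer[OF _ zd, of "fst A" "snd A"]
    by (cases A; simp add: diagram_sel Hom_diagram_iff)+
  note zero = zero_object_unique[OF zero_object_Zob]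
  show "f = Zer ?D (Zob ?D) A" if "f \<in> Hom ?D (Zob ?D) A" for f A
    using that by (cases A)
      (auto simp: diagram_sel diagram_arrows_iff add_simps elim!: Hom_diagramE intro!: zero)
  show "f = Zer ?D A (Zob ?D)" if "f \<in> Hom ?D A (Zob ?D)" for f A
    using that by (cases A)
      (auto simp: diagram_sel diagram_arrows_iff add_simps elim!: Hom_diagramE intro!: zero)
qed

lemma additive_category_diagram: "additive_category (diagram_category C)"
proof (intro additive_category.intro additive_category_axioms.intro category.intro)
  let ?D = "diagram_category C"
  fix f assume "f \<in> Arr ?D"
  thus "Dom ?D f \<in> Obj ?D" "Cod ?D f \<in> Obj ?D"
    by (auto simp: diagram_sel diagram_arrows_def)
next
  let ?D = "diagram_category C"
  fix A assume "A \<in> Obj ?D"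
  thus "Ide ?D A \<in> Hom ?D A A"
    by (cases A) (simp add: diagram_sel Hom_diagram_iff diagram_Ide)
next
  let ?D = "diagram_category C"
  fix A B E f g assume *: "f \<in> Hom ?D A B" "g \<in> Hom ?D B E"
  thus "f \<cdot>\<^bsub>?D\<^esub> g \<in> Hom ?D A E"
    by (cases A, cases B, cases E) (auto simp: diagram_sel Hom_diagram_iff diagram_Comp elim!: Hom_diagramE)
  fix F h assume "h \<in> Hom ?D E F"
  thus "f \<cdot>\<^bsub>?D\<^esub> g \<cdot>\<^bsub>?D\<^esub> h = f \<cdot>\<^bsub>?D\<^esub> (g \<cdot>\<^bsub>?D\<^esub> h)" using *
    by (cases A, cases B, cases E, cases F)
      (auto simp: diagram_sel diagram_arrows_iff Comp_associative elim!: Hom_diagramE)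
next
  let ?D = "diagram_category C"
  fix A B f assume *: "f \<in> Hom ?D A B"
  thus "Ide ?D A \<cdot>\<^bsub>?D\<^esub> f = f" "f \<cdot>\<^bsub>?D\<^esub> Ide ?D B = f"
    by (cases A, cases B, auto simp: diagram_sel diagram_arrows_iff cat_simps elim!: Hom_diagramE)+
next
  let ?D = "diagram_category C"
  fix A B assume "A \<in> Obj ?D" "B \<in> Obj ?D"
  thus "comm_group (hom_group ?D A B)" "\<exists>S i j p q. is_biproduct ?D A B S i j p q"
    using comm_group_diagram biproduct_diagram by (simp_all add: diagram_sel)
next
  let ?D = "diagram_category C"
  fix A B E f g h assume "f \<in> Hom ?D A B" "g \<in> Hom ?D A B" "h \<in> Hom ?D B E"
  thus "(f \<boxplus>\<^bsub>?D\<^esub> g) \<cdot>\<^bsub>?D\<^esub> h = (f \<cdot>\<^bsub>?D\<^esub> h) \<boxplus>\<^bsub>?D\<^esub> (g \<cdot>\<^bsub>?D\<^esub> h)"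
    by (cases A, cases B, cases E)
      (auto simp: diagram_sel diagram_arrows_iff Comp_Add_distrib_left elim!: Hom_diagramE)
next
  let ?D = "diagram_category C"
  fix A B E f g h assume "f \<in> Hom ?D A B" "g \<in> Hom ?D B E" "h \<in> Hom ?D B E"
  thus "f \<cdot>\<^bsub>?D\<^esub> (g \<boxplus>\<^bsub>?D\<^esub> h) = (f \<cdot>\<^bsub>?D\<^esub> g) \<boxplus>\<^bsub>?D\<^esub> (f \<cdot>\<^bsub>?D\<^esub> h)"
    by (cases A, cases B, cases E)
      (auto simp: diagram_sel diagram_arrows_iff Comp_Add_distrib_right elim!: Hom_diagramE)
next
  show "is_zero_object (diagram_category C) (Zob (diagram_category C))"
    by (rule is_zero_object_diagram)
qed

lemma neg_diagram:
  assumes "((a0, a1), (f0, f1, f2), (b0, b1)) \<in> diagram_arrows C"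
  shows "neg (diagram_category C) ((a0, a1), (f0, f1, f2), (b0, b1)) =
    ((a0, a1), (neg C f0, neg C f1, neg C f2), (b0, b1))"
  by (rule additive_category.neg_unique[OF additive_category_diagram, symmetric])
    (use assms diagram_neg[OF assms] in \<open>simp_all add: diagram_sel, simp add: diagram_arrows_iff neg_Add\<close>)

text \<open>Homotopies add componentwise. A homotopy \<open>(s, t)\<close> of \<open>f\<close> gives
  \<open>(g1 s, g2 t)\<close> for \<open>g f\<close> and \<open>(s g0, t g1)\<close> for
  \<open>f g\<close>; the first case uses the second commuting square of \<open>g\<close>, the other
  case the first one.\<close>

lemma additive_ideal_null_homotopic: "additive_ideal (diagram_category C) (null_homotopic C)"
proof (intro additive_ideal.intro additive_category_diagram additive_ideal_axioms.intro)
  let ?D = "diagram_category C"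
  show "f \<in> Arr ?D" if "f \<in> null_homotopic C" for f
    using that by (auto simp: null_homotopic_def diagram_sel)
  note arr = this
  show "Zer ?D A B \<in> null_homotopic C" if AB: "A \<in> Obj ?D" "B \<in> Obj ?D" for A B
  proof -
    obtain a0 a1 b0 b1 where *: "A = (a0, a1)" "B = (b0, b1)" by (cases A, cases B)
    show ?thesis using AB unfolding * diagram_sel
      by (intro null_homotopicI[of _ _ _ _ _ _ _ _ "Zer C (Dom C a1) (Dom C b0)" "Zer C (Cod C a1) (Dom C b1)"]
          diagram_Zer) (simp_all add: diagrams_iff add_simps)
  qed
  fix f assume f: "f \<in> null_homotopic C"
  then obtain a0 a1 f0 f1 f2 b0 b1 where fe: "f = ((a0, a1), (f0, f1, f2), (b0, b1))"
    by (cases f) auto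
  obtain s t where st: "s \<in> Arr C" "Dom C s = Dom C a1" "Cod C s = Dom C b0" "t \<in> Arr C"
    "Dom C t = Cod C a1" "Cod C t = Dom C b1" "(s \<cdot> b0) \<boxplus> (a1 \<cdot> t) = f1"
    using f by (auto simp: fe null_homotopic_iff)
  have fa: "((a0, a1), (f0, f1, f2), (b0, b1)) \<in> diagram_arrows C" using arr[OF f] by (simp add: fe diagram_sel)
  note fi = fa[unfolded diagram_arrows_iff]
  fix g
  {
    assume g: "g \<in> null_homotopic C" "Dom ?D f = Dom ?D g" "Cod ?D f = Cod ?D g"
    then obtain g0 g1 g2 where ge: "g = ((a0, a1), (g0, g1, g2), (b0, b1))"
      by (cases g) (auto simp: fe diagram_sel)
    obtain s' t' where st': "s' \<in> Arr C" "Dom C s' = Dom C a1" "Cod C s' = Dom C b0" "t' \<in> Arr C"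
      "Dom C t' = Cod C a1" "Cod C t' = Dom C b1" "(s' \<cdot> b0) \<boxplus> (a1 \<cdot> t') = g1"
      using g by (auto simp: ge null_homotopic_iff)
    have ga: "((a0, a1), (g0, g1, g2), (b0, b1)) \<in> diagram_arrows C" using arr[OF g(1)] by (simp add: ge diagram_sel)
    have "((s \<boxplus> s') \<cdot> b0) \<boxplus> (a1 \<cdot> (t \<boxplus> t')) = f1 \<boxplus> g1"
      unfolding st(7)[symmetric] st'(7)[symmetric]
      using st(1-6) st'(1-6) fi by (simp add: add_simps Add_left_commute[of "s' \<cdot> b0" "a1 \<cdot> t"])
    thus "f \<boxplus>\<^bsub>?D\<^esub> g \<in> null_homotopic C"
      using diagram_Add[OF fa ga] st(1-6) st'(1-6) unfolding fe ge diagram_sel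
      by (intro null_homotopicI[of _ _ _ _ _ _ _ _ "s \<boxplus> s'" "t \<boxplus> t'"]) (simp_all add: Add_Arr Dom_Add Cod_Add)
  }
  assume g: "g \<in> Arr ?D"
  then obtain x0 x1 g0 g1 g2 y0 y1 where ge: "g = ((x0, x1), (g0, g1, g2), (y0, y1))"
    by (cases g) auto
  have ga: "((x0, x1), (g0, g1, g2), (y0, y1)) \<in> diagram_arrows C" using g by (simp add: ge diagram_sel)
  note gi = ga[unfolded diagram_arrows_iff]
  {
    assume c: "Cod ?D g = Dom ?D f"
    hence c: "y0 = a0" "y1 = a1" by (simp_all add: fe ge diagram_sel)
    have "g1 \<cdot> (a1 \<cdot> t) = x1 \<cdot> (g2 \<cdot> t)"
      using Comp_reassoc[of x1 g2 "g1 \<cdot> a1" t] gi st(1-6) c by (simp add: cat_simps)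
    hence "((g1 \<cdot> s) \<cdot> b0) \<boxplus> (x1 \<cdot> (g2 \<cdot> t)) = g1 \<cdot> f1"
      unfolding st(7)[symmetric] using st(1-6) fi gi c by (simp add: add_simps)
    thus "g \<cdot>\<^bsub>?D\<^esub> f \<in> null_homotopic C"
      using diagram_Comp[OF ga[unfolded c] fa] st(1-6) fi gi c unfolding fe ge diagram_sel
      by (intro null_homotopicI[of _ _ _ _ _ _ _ _ "g1 \<cdot> s" "g2 \<cdot> t"]) (simp_all add: cat_simps)
  }
  {
    assume c: "Cod ?D f = Dom ?D g"
    hence c: "x0 = b0" "x1 = b1" by (simp_all add: fe ge diagram_sel)
    have "s \<cdot> (b0 \<cdot> g1) = s \<cdot> (g0 \<cdot> y0)"
      using gi st(1-6) c by simp
    hence "((s \<cdot> g0) \<cdot> y0) \<boxplus> (a1 \<cdot> (t \<cdot> g1)) = f1 \<cdot> g1"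
      unfolding st(7)[symmetric] using st(1-6) fi gi c by (simp add: add_simps)
    thus "f \<cdot>\<^bsub>?D\<^esub> g \<in> null_homotopic C"
      using diagram_Comp[OF fa ga[unfolded c]] st(1-6) fi gi c unfolding fe ge diagram_sel
      by (intro null_homotopicI[of _ _ _ _ _ _ _ _ "s \<cdot> g0" "t \<cdot> g1"]) (simp_all add: cat_simps)
  }
qed

text \<open>The form in which a construction on representatives is shown to be independent of their
  choice.\<close>

lemma Adel_class_memberE:
  assumes f: "((a0, a1), (f0, f1, f2), (b0, b1)) \<in> diagram_arrows C"
    and g: "g \<in> Adel_class C ((a0, a1), (f0, f1, f2), (b0, b1))"
  obtains g0 g1 g2 where "g = ((a0, a1), (g0, g1, g2), (b0, b1))"
    "((a0, a1), (g0, g1, g2), (b0, b1)) \<in> diagram_arrows C"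
    "((a0, a1), (g0 \<boxplus> neg C f0, g1 \<boxplus> neg C f1, g2 \<boxplus> neg C f2), (b0, b1)) \<in> null_homotopic C"
proof -
  interpret N: additive_ideal "diagram_category C" "null_homotopic C"
    by (rule additive_ideal_null_homotopic)
  have "N.congruent g ((a0, a1), (f0, f1, f2), (b0, b1))"
    using f g N.congruent_in_class by (simp add: Adel_class_def diagram_sel)
  thus ?thesis using that
    by (cases g) (auto simp: N.congruent_def neg_diagram[OF f] diagram_sel)
qed

lemma Adel_class_self: "f \<in> diagram_arrows C \<Longrightarrow> f \<in> Adel_class C f"
  using additive_ideal.in_class_self[OF additive_ideal_null_homotopic]
  by (simp add: Adel_class_def diagram_sel)

lemma additive_category_Adel: "additive_category (Adel C)"
  unfolding Adel_def by (rule additive_ideal.additive_category_quotient[OF additive_ideal_null_homotopic])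

end

section \<open>Kernels and cokernels in the Adelman category\<close>

text \<open>On representatives, this expresses that the class of \<open>k\<close> is a kernel of the
  class of \<open>f\<close> in the quotient by \<open>J\<close>. Equations hold modulo
  \<open>J\<close>; the last clause is monomorphy of the class of \<open>k\<close>, stated for
  differences.\<close>

definition kernel_mod :: "('o, 'm, 'z) add_category_scheme \<Rightarrow> 'm set \<Rightarrow> 'm \<Rightarrow> 'm \<Rightarrow> bool" where
  "kernel_mod C J f k \<longleftrightarrow> f \<in> Arr C \<and> k \<in> Arr C \<and> Cod C k = Dom C f \<and> k \<cdot>\<^bsub>C\<^esub> f \<in> J \<and>
     (\<forall>t\<in>Arr C. Cod C t = Dom C f \<and> t \<cdot>\<^bsub>C\<^esub> f \<in> J \<longrightarrow>
       (\<exists>u\<in>Arr C. Dom C u = Dom C t \<and> Cod C u = Dom C k \<and> (u \<cdot>\<^bsub>C\<^esub> k) \<boxplus>\<^bsub>C\<^esub> neg C t \<in> J)) \<and>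
     (\<forall>u\<in>Arr C. Cod C u = Dom C k \<and> u \<cdot>\<^bsub>C\<^esub> k \<in> J \<longrightarrow> u \<in> J)"

context additive_ideal
begin

interpretation Q: additive_category Q by (rule additive_category_quotient)

lemma Comp_quotient_eq_Zer:
  assumes "f \<in> Arr C" "g \<in> Arr C" "Cod C f = Dom C g"
  shows "cl f \<cdot>\<^bsub>Q\<^esub> cl g = Zer Q (Dom C f) (Cod C g) \<longleftrightarrow> f \<cdot> g \<in> J"
  using assms by (simp add: Comp_quotient quotient_sel residue_class_eq_Zer_iff cat_simps)

lemma mono_quotientI:
  assumes "f \<in> Arr C" "\<And>u. \<lbrakk>u \<in> Arr C; Cod C u = Dom C f; u \<cdot> f \<in> J\<rbrakk> \<Longrightarrow> u \<in> J"
  shows "is_mono Q (cl f)"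
  unfolding Q.mono_iff
proof (intro conjI ballI impI)
  show "cl f \<in> Arr Q" using assms(1) by (rule Arr_quotient)
  fix X g
  assume a: "X \<in> Obj Q" "g \<in> Hom Q X (Dom Q (cl f))" "g \<cdot>\<^bsub>Q\<^esub> cl f = Zer Q X (Cod Q (cl f))"
  then obtain u where u: "u \<in> Arr C" "Dom C u = X" "Cod C u = Dom C f" "g = cl u"
    using assms(1) by (auto simp: quotient_simps elim: Hom_quotientE)
  have "u \<cdot> f \<in> J"
    using a(3) u(1,2,3) assms(1) Comp_quotient_eq_Zer[of u f] by (simp add: u(4) Cod_quotient)
  hence "u \<in> J" using assms(2) u by blast
  thus "g = Zer Q X (Dom Q (cl f))"
    using u(1,2,3) assms(1) by (simp add: u(4) quotient_sel Dom_quotient residue_class_eq_Zer_iff)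
qed

lemma is_kernel_quotientI:
  assumes "kernel_mod C J f k"
  shows "is_kernel Q (cl f) (cl k)"
proof -
  have fk: "f \<in> Arr C" "k \<in> Arr C" "Cod C k = Dom C f" "k \<cdot> f \<in> J" using assms by (auto simp: kernel_mod_def)
  have ex: "\<exists>u\<in>Arr C. Dom C u = Dom C t \<and> Cod C u = Dom C k \<and> (u \<cdot> k) \<boxplus> neg C t \<in> J"
    if "t \<in> Arr C" "Cod C t = Dom C f" "t \<cdot> f \<in> J" for t
    using assms that unfolding kernel_mod_def by blast
  have mono: "is_mono Q (cl k)"
    using assms fk by (intro mono_quotientI) (simp_all add: kernel_mod_def)
  show ?thesis
    unfolding is_kernel_def
  proof (intro conjI ballI impI)
    show "cl k \<cdot>\<^bsub>Q\<^esub> cl f = Zer Q (Dom Q (cl k)) (Cod Q (cl f))"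
      using fk Comp_quotient_eq_Zer[of k f] by (simp add: Dom_quotient Cod_quotient)
    fix X x assume X: "X \<in> Obj Q" "x \<in> Hom Q X (Dom Q (cl f))" "x \<cdot>\<^bsub>Q\<^esub> cl f = Zer Q X (Cod Q (cl f))"
    then obtain t where t: "t \<in> Arr C" "Dom C t = X" "Cod C t = Dom C f" "x = cl t"
      using fk(1) by (auto simp: Dom_quotient elim: Hom_quotientE)
    have "t \<cdot> f \<in> J"
      using X(3) t(1,2,3) fk Comp_quotient_eq_Zer[of t f] by (simp add: t(4) Cod_quotient)
    then obtain u where u: "u \<in> Arr C" "Dom C u = X" "Cod C u = Dom C k" "(u \<cdot> k) \<boxplus> neg C t \<in> J"
      using ex[of t] t by auto
    have "cl u \<cdot>\<^bsub>Q\<^esub> cl k = x"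
      using u t(1-3) fk by (simp add: t(4) Comp_quotient residue_class_eq_iff congruent_def cat_simps)
    moreover have "v = cl u" if "v \<in> Hom Q X (Dom Q (cl k))" "v \<cdot>\<^bsub>Q\<^esub> cl k = x" for v
      using that calculation u(1-3) fk
      by - (rule Q.mono_cancel[OF mono], simp_all add: Hom_iff quotient_simps)
    ultimately show "\<exists>!v. v \<in> Hom Q X (Dom Q (cl k)) \<and> v \<cdot>\<^bsub>Q\<^esub> cl k = x"
      using u(1-3) fk by (intro ex1I[of _ "cl u"]) (simp_all add: Hom_iff quotient_simps)
  qed (use fk in \<open>simp_all add: quotient_simps\<close>)
qed

lemma additive_ideal_opp: "additive_ideal (opp C) J"
  by (intro additive_ideal.intro additive_ideal_axioms.intro additive_category_opp)
    (simp_all add: ideal_Arr ideal_Zer ideal_Add ideal_Comp_left ideal_Comp_right)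

end

section \<open>Duality for quotients and for diagrams\<close>

lemma residue_class_opp: "residue_class (opp C) J = residue_class C J"
  by (rule ext) (simp add: residue_class_def hom_group_opp)

text \<open>The two records are equal, not just isomorphic: the classes are the same sets, and in
  the definition of composition only the order of the two unions changes.\<close>

lemma quotient_category_opp: "quotient_category (opp C) J = opp (quotient_category C J)"
proof -
  have "(\<lambda>x y. \<Union>f\<in>x. \<Union>g\<in>y. residue_class C J (g \<cdot>\<^bsub>C\<^esub> f)) =
      (\<lambda>x y. \<Union>g\<in>y. \<Union>f\<in>x. residue_class C J (g \<cdot>\<^bsub>C\<^esub> f))"
    by (intro ext) blast
  thus ?thesis by (simp add: quotient_category_def opp_def residue_class_opp[unfolded opp_def])
qed

text \<open>A diagram read backwards is a diagram over the opposite category, with its two arrows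
  exchanged. So diagrams over \<open>opp C\<close> and the opposite of diagrams over
  \<open>C\<close> are isomorphic but not equal, and \<open>dual\<close> is the translation on
  arrows.\<close>

definition dual :: "'m dia_arr \<Rightarrow> 'm dia_arr" where
  "dual = (\<lambda>((a0, a1), (f0, f1, f2), (b0, b1)). ((b1, b0), (f2, f1, f0), (a1, a0)))"

lemma dual_simp [simp]:
  "dual ((a0, a1), (f0, f1, f2), (b0, b1)) = ((b1, b0), (f2, f1, f0), (a1, a0))"
  by (simp add: dual_def)

lemma dual_dual [simp]: "dual (dual f) = f"
  by (auto simp: dual_def split: prod.splits)

lemma dual_in_diagram_arrows [simp]: "dual f \<in> diagram_arrows (opp C) \<longleftrightarrow> f \<in> diagram_arrows C"
proof -
  obtain a0 a1 f0 f1 f2 b0 b1 where "f = ((a0, a1), (f0, f1, f2), (b0, b1))" by (cases f) auto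
  thus ?thesis by (auto simp: diagram_arrows_iff)
qed

context additive_category
begin

interpretation D: additive_category "diagram_category C" by (rule additive_category_diagram)
interpretation N: additive_ideal "diagram_category C" "null_homotopic C"
  by (rule additive_ideal_null_homotopic)

lemma dual_in_null_homotopic [simp]: "dual f \<in> null_homotopic (opp C) \<longleftrightarrow> f \<in> null_homotopic C"
proof -
  obtain a0 a1 f0 f1 f2 b0 b1 where f: "f = ((a0, a1), (f0, f1, f2), (b0, b1))" by (cases f) auto
  show ?thesis
  proof (cases "f \<in> diagram_arrows C")
    case True
    note * = True[unfolded f diagram_arrows_iff]
    \<comment> \<open>Over the opposite category the two parts of a homotopy exchange their roles,
      so the summands appear in the other order; commutativity of addition identifies the
      conditions.\<close>
    have "(\<exists>s t. s \<in> Arr C \<and> Cod C s = Dom C b1 \<and> Dom C s = Cod C a1 \<and>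
            t \<in> Arr C \<and> Cod C t = Dom C b0 \<and> Dom C t = Dom C a1 \<and> (a1 \<cdot> s) \<boxplus> (t \<cdot> b0) = f1) \<longleftrightarrow>
          (\<exists>s t. s \<in> Arr C \<and> Dom C s = Dom C a1 \<and> Cod C s = Dom C b0 \<and>
            t \<in> Arr C \<and> Dom C t = Cod C a1 \<and> Cod C t = Dom C b1 \<and> (s \<cdot> b0) \<boxplus> (a1 \<cdot> t) = f1)"
    proof -
      have "(a1 \<cdot> t) \<boxplus> (s \<cdot> b0) = (s \<cdot> b0) \<boxplus> (a1 \<cdot> t)"
        if "s \<in> Arr C" "Dom C s = Dom C a1" "Cod C s = Dom C b0" "t \<in> Arr C" "Dom C t = Cod C a1"
          "Cod C t = Dom C b1" for s t
        using that * by (intro Add_commute) (simp_all add: cat_simps)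
      thus ?thesis by metis
    qed
    thus ?thesis using * by (simp add: f null_homotopic_iff diagram_arrows_iff)
  next
    case False
    thus ?thesis using dual_in_diagram_arrows[of f C]
      by (auto simp: f null_homotopic_iff simp del: dual_in_diagram_arrows)
  qed
qed

lemma dual_Comp:
  assumes "f \<in> diagram_arrows C" "g \<in> diagram_arrows C"
  shows "dual (f \<cdot>\<^bsub>diagram_category C\<^esub> g) = dual g \<cdot>\<^bsub>diagram_category (opp C)\<^esub> dual f"
  by (rule diagram_arrowE[OF assms(1)], rule diagram_arrowE[OF assms(2)]) (simp add: diagram_sel)

lemma dual_Add:
  assumes "f \<in> diagram_arrows C" "g \<in> diagram_arrows C"
  shows "dual (f \<boxplus>\<^bsub>diagram_category C\<^esub> g) = dual f \<boxplus>\<^bsub>diagram_category (opp C)\<^esub> dual g"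
  by (rule diagram_arrowE[OF assms(1)], rule diagram_arrowE[OF assms(2)]) (simp add: diagram_sel)

lemma dual_neg:
  assumes "f \<in> diagram_arrows C"
  shows "dual (neg (diagram_category C) f) = neg (diagram_category (opp C)) (dual f)"
proof -
  obtain a0 a1 f0 f1 f2 b0 b1 where f: "f = ((a0, a1), (f0, f1, f2), (b0, b1))"
    using assms by (rule diagram_arrowE)
  have "((b1, b0), (f2, f1, f0), (a1, a0)) \<in> diagram_arrows (opp C)"
    using assms dual_in_diagram_arrows[of f C] by (simp add: f del: dual_in_diagram_arrows)
  from additive_category.neg_diagram[OF additive_category_opp this] neg_diagram[OF assms[unfolded f]]
  show ?thesis by (simp add: f)
qed

lemma Dom_dual:
  "f \<in> diagram_arrows C \<Longrightarrow> Dom (diagram_category (opp C)) (dual f) = prod.swap (Cod (diagram_category C) f)"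
  by (erule diagram_arrowE) (simp add: diagram_sel)

lemma Cod_dual:
  "f \<in> diagram_arrows C \<Longrightarrow> Cod (diagram_category (opp C)) (dual f) = prod.swap (Dom (diagram_category C) f)"
  by (erule diagram_arrowE) (simp add: diagram_sel)

lemma swap_eq_iff: "prod.swap x = prod.swap y \<longleftrightarrow> x = y"
  by (auto simp: prod.swap_def prod_eq_iff)

text \<open>\<open>dual\<close> is an involution that reverses composition and respects sums,
  negatives and null-homotopies, so each clause can be carried across and the lift obtained there
  can be carried back.\<close>

lemma kernel_mod_dual:
  assumes "kernel_mod (diagram_category (opp C)) (null_homotopic (opp C)) (dual f) (dual k)"
  shows "kernel_mod (opp (diagram_category C)) (null_homotopic C) f k"
proof -
  let ?D = "diagram_category C" and ?D' = "diagram_category (opp C)"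
  have fk: "f \<in> diagram_arrows C" "k \<in> diagram_arrows C"
    using assms by (simp_all add: kernel_mod_def diagram_sel)
  have c: "Dom ?D k = Cod ?D f"
    using assms fk by (simp add: kernel_mod_def Dom_dual Cod_dual swap_eq_iff)
  have z: "f \<cdot>\<^bsub>?D\<^esub> k \<in> null_homotopic C"
    using assms fk by (simp add: kernel_mod_def dual_Comp[symmetric])
  show ?thesis
    unfolding kernel_mod_def
  proof (intro conjI ballI impI; (elim conjE)?; simp?)
    show "f \<in> Arr ?D" "k \<in> Arr ?D" using fk by (simp_all add: diagram_sel)
    show "Dom ?D k = Cod ?D f" by (rule c)
    show "f \<cdot>\<^bsub>?D\<^esub> k \<in> null_homotopic C" by (rule z)
  next
    fix t assume t: "t \<in> Arr ?D" "Dom ?D t = Cod ?D f" "f \<cdot>\<^bsub>?D\<^esub> t \<in> null_homotopic C"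
    have ta: "t \<in> diagram_arrows C" using t(1) by (simp add: diagram_sel)
    have "dual t \<cdot>\<^bsub>?D'\<^esub> dual f \<in> null_homotopic (opp C)" using t(3) fk ta by (simp add: dual_Comp[symmetric])
    moreover have "Cod ?D' (dual t) = Dom ?D' (dual f)" using t(2) fk ta by (simp add: Dom_dual Cod_dual)
    moreover have "dual t \<in> Arr ?D'" using ta by (simp add: diagram_sel)
    ultimately obtain u where u: "u \<in> Arr ?D'" "Dom ?D' u = Dom ?D' (dual t)" "Cod ?D' u = Dom ?D' (dual k)"
      "(u \<cdot>\<^bsub>?D'\<^esub> dual k) \<boxplus>\<^bsub>?D'\<^esub> neg ?D' (dual t) \<in> null_homotopic (opp C)"
      using assms unfolding kernel_mod_def by blast
    define v where "v = dual u"
    have uv: "u = dual v" by (simp add: v_def)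
    have va: "v \<in> diagram_arrows C" using u(1) by (simp add: uv diagram_sel)
    have dc: "Cod ?D v = Cod ?D t" "Dom ?D v = Cod ?D k"
      using u(2,3) fk ta va by (simp_all add: uv Dom_dual Cod_dual swap_eq_iff)
    have kv: "k \<cdot>\<^bsub>?D\<^esub> v \<in> diagram_arrows C"
      using D.Comp_Arr[of k v] fk va dc by (simp add: diagram_sel)
    have nt: "neg ?D t \<in> diagram_arrows C" using D.neg_Arr[of t] ta by (simp add: diagram_sel)
    have "(k \<cdot>\<^bsub>?D\<^esub> v) \<boxplus>\<^bsub>?D\<^esub> neg ?D t \<in> null_homotopic C"
      using u(4) fk ta va kv nt by (simp add: uv dual_Comp[symmetric] dual_Add[symmetric] dual_neg[symmetric])
    thus "\<exists>u\<in>Arr ?D. Cod ?D u = Cod ?D t \<and> Dom ?D u = Cod ?D k \<and> (k \<cdot>\<^bsub>?D\<^esub> u) \<boxplus>\<^bsub>?D\<^esub> neg ?D t \<in> null_homotopic C"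
      using va dc by (intro bexI[of _ v]) (simp_all add: diagram_sel)
  next
    fix u assume u: "u \<in> Arr ?D" "Dom ?D u = Cod ?D k" "k \<cdot>\<^bsub>?D\<^esub> u \<in> null_homotopic C"
    have ua: "u \<in> diagram_arrows C" using u(1) by (simp add: diagram_sel)
    have "dual u \<cdot>\<^bsub>?D'\<^esub> dual k \<in> null_homotopic (opp C)" using u(3) fk ua by (simp add: dual_Comp[symmetric])
    moreover have "Cod ?D' (dual u) = Dom ?D' (dual k)" using u(2) fk ua by (simp add: Dom_dual Cod_dual)
    moreover have "dual u \<in> Arr ?D'" using ua by (simp add: diagram_sel)
    ultimately have "dual u \<in> null_homotopic (opp C)" using assms unfolding kernel_mod_def by blast
    thus "u \<in> null_homotopic C" by simp
  qed
qed

lemma is_kernel_AdelI: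
  "kernel_mod (diagram_category C) (null_homotopic C) f k \<Longrightarrow> is_kernel (Adel C) (Adel_class C f) (Adel_class C k)"
  unfolding Adel_def Adel_class_def by (rule N.is_kernel_quotientI)

text \<open>Joins the two dualities, reversal of diagrams and the equality for quotients. A cokernel
  in the Adelman category is thereby certified by a kernel computation over
  \<open>opp C\<close>.\<close>

lemma is_cokernel_AdelI:
  assumes "kernel_mod (diagram_category (opp C)) (null_homotopic (opp C)) (dual f) (dual k)"
  shows "is_cokernel (Adel C) (Adel_class C f) (Adel_class C k)"
  using additive_ideal.is_kernel_quotientI[OF N.additive_ideal_opp kernel_mod_dual[OF assms]]
  by (simp add: Adel_def Adel_class_def quotient_category_opp residue_class_opp)

lemma mono_AdelI:
  assumes "f \<in> diagram_arrows C" "\<And>u. \<lbrakk>u \<in> diagram_arrows C;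
    Cod (diagram_category C) u = Dom (diagram_category C) f;
    u \<cdot>\<^bsub>diagram_category C\<^esub> f \<in> null_homotopic C\<rbrakk> \<Longrightarrow> u \<in> null_homotopic C"
  shows "is_mono (Adel C) (Adel_class C f)"
  unfolding Adel_def Adel_class_def
  by (rule N.mono_quotientI) (use assms in \<open>simp_all add: diagram_sel\<close>)

lemma epi_AdelI:
  assumes "f \<in> diagram_arrows C" "\<And>u. \<lbrakk>u \<in> diagram_arrows C;
    Dom (diagram_category C) u = Cod (diagram_category C) f;
    f \<cdot>\<^bsub>diagram_category C\<^esub> u \<in> null_homotopic C\<rbrakk> \<Longrightarrow> u \<in> null_homotopic C"
  shows "is_epi (Adel C) (Adel_class C f)"
  using additive_ideal.mono_quotientI[OF N.additive_ideal_opp, of f] assms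
  by (simp add: Adel_def Adel_class_def quotient_category_opp residue_class_opp diagram_sel)

text \<open>The homotopy condition constrains the middle component only, so zero morphisms
  \<open>s\<close> and \<open>t\<close> work for any outer components.\<close>

lemma null_homotopic_Zer_middle:
  assumes "((a0, a1), (f0, Zer C (Dom C a1) (Dom C b1), f2), (b0, b1)) \<in> diagram_arrows C"
  shows "((a0, a1), (f0, Zer C (Dom C a1) (Dom C b1), f2), (b0, b1)) \<in> null_homotopic C"
  by (rule null_homotopicI[OF assms, of "Zer C (Dom C a1) (Dom C b0)" "Zer C (Cod C a1) (Dom C b1)"])
    (use assms in \<open>simp_all add: diagram_arrows_iff add_simps\<close>)

end

text \<open>
  On elements, the kernel of \<open>f: A \<rightarrow> B\<close> consists of pairs \<open>(x, y)\<close> in \<open>A\<^sub>1 \<oplus> B\<^sub>0\<close> with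
  \<open>a\<^sub>1 x = 0\<close> and \<open>f\<^sub>1 x + b\<^sub>0 y = 0\<close>, modulo all pairs whose first entry lies in the image of \<open>a\<^sub>0\<close>.
\<close>

inductive kernel_diagram :: "('o, 'm, 'z) add_category_scheme \<Rightarrow> 'm dia_arr \<Rightarrow> 'm dia_arr \<Rightarrow> bool"
  for C (structure) where
  "\<lbrakk>((a0, a1), (f0, f1, f2), (b0, b1)) \<in> diagram_arrows C;
    is_biproduct C (Dom C a0) (Dom C b0) S0 i0 j0 p0 q0;
    is_biproduct C (Dom C a1) (Dom C b0) S1 i1 j1 p1 q1;
    is_biproduct C (Cod C a1) (Dom C b1) S2 i2 j2 p2 q2\<rbrakk> \<Longrightarrow>
    kernel_diagram C ((a0, a1), (f0, f1, f2), (b0, b1))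
      (((p0 \<cdot> (a0 \<cdot> i1)) \<boxplus> (q0 \<cdot> j1), (p1 \<cdot> (a1 \<cdot> i2)) \<boxplus> ((p1 \<cdot> (f1 \<cdot> j2)) \<boxplus> (q1 \<cdot> (b0 \<cdot> j2)))),
       (p0, p1, p2), (a0, a1))"

context additive_category
begin

lemma kernel_diagram_exists:
  assumes "f \<in> diagram_arrows C"
  shows "\<exists>k. kernel_diagram C f k"
proof -
  obtain a0 a1 f0 f1 f2 b0 b1 where f: "f = ((a0, a1), (f0, f1, f2), (b0, b1))"
    using assms by (rule diagram_arrowE)
  note * = assms[unfolded f diagram_arrows_iff]
  obtain S0 i0 j0 p0 q0 where 0: "is_biproduct C (Dom C a0) (Dom C b0) S0 i0 j0 p0 q0"
    using biproduct_exists[of "Dom C a0" "Dom C b0"] * by (auto simp: cat_simps)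
  obtain S1 i1 j1 p1 q1 where 1: "is_biproduct C (Dom C a1) (Dom C b0) S1 i1 j1 p1 q1"
    using biproduct_exists[of "Dom C a1" "Dom C b0"] * by (auto simp: cat_simps)
  obtain S2 i2 j2 p2 q2 where 2: "is_biproduct C (Cod C a1) (Dom C b1) S2 i2 j2 p2 q2"
    using biproduct_exists[of "Cod C a1" "Dom C b1"] * by (auto simp: cat_simps)
  show ?thesis unfolding f using kernel_diagram.intros[OF assms[unfolded f] 0 1 2] by blast
qed

lemma kernel_diagram_arrow:
  assumes "kernel_diagram C f k" shows "k \<in> diagram_arrows C"
  using assms
proof cases
  case (1 a0 a1 f0 f1 f2 b0 b1 S0 i0 j0 p0 q0 S1 i1 j1 p1 q1 S2 i2 j2 p2 q2)
  note D = biproductD[OF 1(4)] biproductD[OF 1(5)] biproductD[OF 1(6)] 1(3)[unfolded diagram_arrows_iff]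
  show ?thesis unfolding 1(2) using D by (simp add: diagram_arrows_iff add_simps)
qed

text \<open>The extra summands are room for a homotopy: up to a sign, a morphism into the kernel
  diagram is a morphism \<open>t\<close> into the source of \<open>f\<close> together with a
  null-homotopy of \<open>t f\<close>.\<close>

lemma kernel_mod_kernel_diagram:
  assumes "kernel_diagram C f k"
  shows "kernel_mod (diagram_category C) (null_homotopic C) f k"
  using assms
proof cases
  case (1 a0 a1 f0 f1 f2 b0 b1 S0 i0 j0 p0 q0 S1 i1 j1 p1 q1 S2 i2 j2 p2 q2)
  let ?D = "diagram_category C"
  note D = biproductD[OF 1(4)] biproductD[OF 1(5)] biproductD[OF 1(6)] 1(3)[unfolded diagram_arrows_iff]
  let ?k0 = "p0 \<cdot> (a0 \<cdot> i1) \<boxplus> q0 \<cdot> j1" and ?k1 = "p1 \<cdot> (a1 \<cdot> i2) \<boxplus> (p1 \<cdot> (f1 \<cdot> j2) \<boxplus> q1 \<cdot> (b0 \<cdot> j2))"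
  have k: "k = ((?k0, ?k1), (p0, p1, p2), (a0, a1))" by (rule 1(2))
  have ka: "((?k0, ?k1), (p0, p1, p2), (a0, a1)) \<in> diagram_arrows C"
    using kernel_diagram_arrow[OF assms] by (simp add: k)
  show ?thesis
    unfolding kernel_mod_def
  proof (intro conjI ballI impI; (elim conjE)?)
    show "f \<in> Arr ?D" "k \<in> Arr ?D" "Cod ?D k = Dom ?D f" using ka 1(3) by (simp_all add: k 1(1) diagram_sel)
    \<comment> \<open>On a pair \<open>(x, y)\<close>, the second arrow followed by
      \<open>q2\<close> gives \<open>f1 x + b0 y\<close>; the part \<open>-q1\<close> followed by
      \<open>b0\<close> removes \<open>b0 y\<close> and leaves the middle component of the
      composite.\<close>
    show "k \<cdot>\<^bsub>?D\<^esub> f \<in> null_homotopic C"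
      unfolding k 1(1) diagram_sel
      by (rule null_homotopicI[OF diagram_Comp[OF ka 1(3)], of "neg C q1" q2]) (use D in \<open>simp_all add: add_simps Add_ac\<close>)
  next
    fix t assume t: "t \<in> Arr ?D" "Cod ?D t = Dom ?D f" "t \<cdot>\<^bsub>?D\<^esub> f \<in> null_homotopic C"
    then obtain x0 x1 t0 t1 t2 where te: "t = ((x0, x1), (t0, t1, t2), (a0, a1))"
      by (cases t) (auto simp: 1(1) diagram_sel)
    have ta: "((x0, x1), (t0, t1, t2), (a0, a1)) \<in> diagram_arrows C" using t(1) by (simp add: te diagram_sel)
    note T = ta[unfolded diagram_arrows_iff]
    obtain s r where s: "s \<in> Arr C" "Dom C s = Dom C x1" "Cod C s = Dom C b0" and
      r: "r \<in> Arr C" "Dom C r = Cod C x1" "Cod C r = Dom C b1" and sr: "s \<cdot> b0 \<boxplus> x1 \<cdot> r = t1 \<cdot> f1"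
      using t(3) by (auto simp: te 1(1) diagram_sel null_homotopic_iff)
    \<comment> \<open>The homotopy \<open>(s, r)\<close> supplies the new coordinates,
      \<open>-s\<close> in the middle and \<open>r\<close> at the end. The entry
      \<open>-x0 s\<close> is then forced, because the first arrow of the kernel diagram is the
      identity on the added summand.\<close>
    define u0 where "u0 = t0 \<cdot> i0 \<boxplus> neg C (x0 \<cdot> (s \<cdot> j0))"
    define u1 where "u1 = t1 \<cdot> i1 \<boxplus> neg C (s \<cdot> j1)"
    define u2 where "u2 = t2 \<cdot> i2 \<boxplus> r \<cdot> j2"
    have U: "u0 \<in> Arr C" "Dom C u0 = Dom C x0" "Cod C u0 = S0" "u1 \<in> Arr C" "Dom C u1 = Dom C x1" "Cod C u1 = S1"
      "u2 \<in> Arr C" "Dom C u2 = Cod C x1" "Cod C u2 = S2"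
      using D T s r by (simp_all add: u0_def u1_def u2_def add_simps)
    have K: "?k0 \<in> Arr C" "Dom C ?k0 = S0" "Cod C ?k0 = S1" "?k1 \<in> Arr C" "Dom C ?k1 = S1" "Cod C ?k1 = S2"
      using D by (simp_all add: add_simps)
    have e0: "x0 \<cdot> u1 = u0 \<cdot> ?k0"
    proof -
      have "x0 \<cdot> (t1 \<cdot> i1) = t0 \<cdot> (a0 \<cdot> i1)"
        using Comp_reassoc[of x0 t1 "t0 \<cdot> a0" i1] T D by (simp add: cat_simps)
      thus ?thesis using D T s r by (simp add: u0_def u1_def add_simps)
    qed
    have e1: "x1 \<cdot> u2 = u1 \<cdot> ?k1"
    proof -
      have a: "x1 \<cdot> (t2 \<cdot> i2) = t1 \<cdot> (a1 \<cdot> i2)"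
        using Comp_reassoc[of x1 t2 "t1 \<cdot> a1" i2] T D by (simp add: cat_simps)
      have "t1 \<cdot> (f1 \<cdot> j2) = (s \<cdot> b0 \<boxplus> x1 \<cdot> r) \<cdot> j2" unfolding sr using T D by (simp add: cat_simps)
      also have "\<dots> = s \<cdot> (b0 \<cdot> j2) \<boxplus> x1 \<cdot> (r \<cdot> j2)" using T D s r by (simp add: add_simps)
      finally have b: "t1 \<cdot> (f1 \<cdot> j2) = s \<cdot> (b0 \<cdot> j2) \<boxplus> x1 \<cdot> (r \<cdot> j2)" .
      have c: "s \<cdot> (b0 \<cdot> j2) \<boxplus> x1 \<cdot> (r \<cdot> j2) \<boxplus> neg C (s \<cdot> (b0 \<cdot> j2)) = x1 \<cdot> (r \<cdot> j2)"
        using T D s r by (simp add: add_simps Add_commute[of "x1 \<cdot> (r \<cdot> j2)"])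
      have "u1 \<cdot> ?k1 = t1 \<cdot> (a1 \<cdot> i2) \<boxplus> (t1 \<cdot> (f1 \<cdot> j2) \<boxplus> neg C (s \<cdot> (b0 \<cdot> j2)))"
        using D T s r by (simp add: u1_def add_simps)
      also have "\<dots> = x1 \<cdot> u2" unfolding b c using a D T s r by (simp add: u2_def add_simps)
      finally show ?thesis by simp
    qed
    let ?u = "((x0, x1), (u0, u1, u2), (?k0, ?k1))"
    have ua: "?u \<in> diagram_arrows C"
      using U K e0 e1 T unfolding diagram_arrows_iff by (intro conjI) (simp_all del: K)
    \<comment> \<open>The factorisation is strict already for representatives, so the difference
      that has to be null-homotopic is zero.\<close>
    have uk: "?u \<cdot>\<^bsub>?D\<^esub> k = t"
      using D T s r by (simp add: k te diagram_sel u0_def u1_def u2_def add_simps)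
    show "\<exists>u\<in>Arr ?D. Dom ?D u = Dom ?D t \<and> Cod ?D u = Dom ?D k \<and> (u \<cdot>\<^bsub>?D\<^esub> k) \<boxplus>\<^bsub>?D\<^esub> neg ?D t \<in> null_homotopic C"
    proof (intro bexI[of _ ?u] conjI)
      show "(?u \<cdot>\<^bsub>?D\<^esub> k) \<boxplus>\<^bsub>?D\<^esub> neg ?D t \<in> null_homotopic C"
        unfolding uk using additive_category.Add_neg[OF additive_category_diagram t(1)]
          additive_ideal.ideal_Zer[OF additive_ideal_null_homotopic] t(1)
          category.Dom_closed[OF additive_category.axioms(1)[OF additive_category_diagram]]
          category.Cod_closed[OF additive_category.axioms(1)[OF additive_category_diagram]] by simp
    qed (use ua in \<open>simp_all add: te k diagram_sel\<close>)
  next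
    fix u assume u: "u \<in> Arr ?D" "Cod ?D u = Dom ?D k" "u \<cdot>\<^bsub>?D\<^esub> k \<in> null_homotopic C"
    then obtain x0 x1 u0 u1 u2 where ue: "u = ((x0, x1), (u0, u1, u2), (?k0, ?k1))"
      by (cases u) (auto simp: k diagram_sel)
    have ua: "((x0, x1), (u0, u1, u2), (?k0, ?k1)) \<in> diagram_arrows C" using u(1) by (simp add: ue diagram_sel)
    have K: "?k0 \<in> Arr C" "Dom C ?k0 = S0" "Cod C ?k0 = S1" "?k1 \<in> Arr C" "Dom C ?k1 = S1" "Cod C ?k1 = S2"
      using D by (simp_all add: add_simps)
    have U: "x0 \<in> Arr C" "x1 \<in> Arr C" "Cod C x0 = Dom C x1" "u1 \<in> Arr C" "Dom C u1 = Dom C x1" "Cod C u1 = S1"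
      using ua[unfolded diagram_arrows_iff K] by simp_all
    obtain s r where s: "s \<in> Arr C" "Dom C s = Dom C x1" "Cod C s = Dom C a0" and
      r: "r \<in> Arr C" "Dom C r = Cod C x1" "Cod C r = Dom C a1" and sr: "s \<cdot> a0 \<boxplus> x1 \<cdot> r = u1 \<cdot> p1"
      using u(3) by (auto simp: ue k diagram_sel null_homotopic_iff)
    \<comment> \<open>The homotopy describes only the first coordinate of \<open>u1\<close>. The
      second coordinate lies in the image of \<open>?k0\<close> by itself, since \<open>?k0\<close>
      is the identity on that summand; both together give a homotopy for \<open>u\<close>.\<close>
    have "u1 = (s \<cdot> a0 \<boxplus> x1 \<cdot> r) \<cdot> i1 \<boxplus> (u1 \<cdot> q1) \<cdot> j1"
      unfolding sr using biproduct_decompose[OF 1(5), of u1] U by simp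
    hence e: "(s \<cdot> i0 \<boxplus> (u1 \<cdot> q1) \<cdot> j0) \<cdot> ?k0 \<boxplus> x1 \<cdot> (r \<cdot> i1) = u1"
      using D U s r by (simp add: add_simps Add_ac)
    show "u \<in> null_homotopic C"
      unfolding ue
      by (rule null_homotopicI[OF ua _ _ _ _ _ _ e]) (use D U s r in \<open>simp_all add: add_simps\<close>)
  qed
qed

end

section \<open>Homology in abelian categories\<close>

context additive_category
begin

lemma kernelD:
  assumes "is_kernel C f k"
  shows "f \<in> Arr C" "k \<in> Arr C" "Cod C k = Dom C f" "k \<cdot> f = Zer C (Dom C k) (Cod C f)"
  using assms by (simp_all add: is_kernel_def)

lemma kernel_factor:
  assumes "is_kernel C f k" "t \<in> Arr C" "Cod C t = Dom C f" "t \<cdot> f = Zer C (Dom C t) (Cod C f)"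
  obtains u where "u \<in> Arr C" "Dom C u = Dom C t" "Cod C u = Dom C k" "u \<cdot> k = t"
proof -
  have "t \<in> Hom C (Dom C t) (Dom C f)" "Dom C t \<in> Obj C" using assms by (simp_all add: Hom_iff cat_simps)
  hence "\<exists>!u. u \<in> Hom C (Dom C t) (Dom C k) \<and> u \<cdot> k = t"
    using assms(1,4) unfolding is_kernel_def by blast
  thus ?thesis using that unfolding Hom_iff by blast
qed

lemma kernel_mono:
  assumes "is_kernel C f k" shows "is_mono C k"
  unfolding is_mono_def
proof (intro conjI ballI impI)
  note k = kernelD[OF assms]
  show "k \<in> Arr C" by (rule k)
  fix X g h assume a: "X \<in> Obj C" "g \<in> Hom C X (Dom C k)" "h \<in> Hom C X (Dom C k)" "g \<cdot> k = h \<cdot> k"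
  have "g \<cdot> k \<in> Hom C X (Dom C f)" "(g \<cdot> k) \<cdot> f = Zer C X (Cod C f)"
    using a k by (simp_all add: Hom_iff add_simps)
  hence "\<exists>!u. u \<in> Hom C X (Dom C k) \<and> u \<cdot> k = g \<cdot> k"
    using assms a(1) unfolding is_kernel_def by blast
  thus "g = h" using a by metis
qed

lemma is_kernelI:
  assumes "f \<in> Arr C" "is_mono C k" "Cod C k = Dom C f" "k \<cdot> f = Zer C (Dom C k) (Cod C f)"
    "\<And>t. \<lbrakk>t \<in> Arr C; Cod C t = Dom C f; t \<cdot> f = Zer C (Dom C t) (Cod C f)\<rbrakk>
      \<Longrightarrow> \<exists>u\<in>Arr C. Dom C u = Dom C t \<and> Cod C u = Dom C k \<and> u \<cdot> k = t"
  shows "is_kernel C f k"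
  unfolding is_kernel_def
proof (intro conjI ballI impI)
  show "k \<in> Arr C" using assms(2) by (simp add: is_mono_def)
  fix X t assume t: "X \<in> Obj C" "t \<in> Hom C X (Dom C f)" "t \<cdot> f = Zer C X (Cod C f)"
  then obtain u where u: "u \<in> Arr C" "Dom C u = X" "Cod C u = Dom C k" "u \<cdot> k = t"
    using assms(5)[of t] by (auto simp: Hom_iff)
  show "\<exists>!u. u \<in> Hom C X (Dom C k) \<and> u \<cdot> k = t"
  proof (rule ex1I[of _ u])
    show "u \<in> Hom C X (Dom C k) \<and> u \<cdot> k = t" using u by (simp add: Hom_iff)
    fix v assume "v \<in> Hom C X (Dom C k) \<and> v \<cdot> k = t"
    thus "v = u" using u by - (rule mono_cancel[OF assms(2)], simp_all add: Hom_iff)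
  qed
qed (use assms in simp_all)

lemma cokernelD:
  assumes "is_cokernel C f c"
  shows "f \<in> Arr C" "c \<in> Arr C" "Dom C c = Cod C f" "f \<cdot> c = Zer C (Dom C f) (Cod C c)"
  using assms by (simp_all add: is_cokernel_def)

lemma cokernel_factor:
  assumes "is_cokernel C f c" "t \<in> Arr C" "Dom C t = Cod C f" "f \<cdot> t = Zer C (Dom C f) (Cod C t)"
  obtains u where "u \<in> Arr C" "Cod C u = Cod C t" "Dom C u = Cod C c" "c \<cdot> u = t"
  using additive_category.kernel_factor[OF additive_category_opp, of f c t] assms by auto

lemma cokernel_epi: "is_cokernel C f c \<Longrightarrow> is_epi C c"
  using additive_category.kernel_mono[OF additive_category_opp, of f c] by simp

lemma is_cokernelI:
  assumes "f \<in> Arr C" "is_epi C c" "Dom C c = Cod C f" "f \<cdot> c = Zer C (Dom C f) (Cod C c)"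
    "\<And>t. \<lbrakk>t \<in> Arr C; Dom C t = Cod C f; f \<cdot> t = Zer C (Dom C f) (Cod C t)\<rbrakk>
      \<Longrightarrow> \<exists>u\<in>Arr C. Cod C u = Cod C t \<and> Dom C u = Cod C c \<and> c \<cdot> u = t"
  shows "is_cokernel C f c"
  using additive_category.is_kernelI[OF additive_category_opp, of f c] assms by simp

lemma epiI:
  assumes "f \<in> Arr C"
    "\<And>g. \<lbrakk>g \<in> Arr C; Dom C g = Cod C f; f \<cdot> g = Zer C (Dom C f) (Cod C g)\<rbrakk>
      \<Longrightarrow> g = Zer C (Cod C f) (Cod C g)"
  shows "is_epi C f"
  using additive_category.mono_iff[OF additive_category_opp, of f] assms by (auto simp: Hom_iff)

lemma monoI:
  assumes "f \<in> Arr C"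
    "\<And>g. \<lbrakk>g \<in> Arr C; Cod C g = Dom C f; g \<cdot> f = Zer C (Dom C g) (Cod C f)\<rbrakk>
      \<Longrightarrow> g = Zer C (Dom C g) (Dom C f)"
  shows "is_mono C f"
  unfolding mono_iff using assms by (auto simp: Hom_iff)

lemma mono_cancel_Zer:
  "\<lbrakk>is_mono C f; g \<in> Arr C; Cod C g = Dom C f; g \<cdot> f = Zer C (Dom C g) (Cod C f)\<rbrakk>
    \<Longrightarrow> g = Zer C (Dom C g) (Dom C f)"
  unfolding mono_iff Hom_iff Ball_def by (metis Dom_closed)

lemma epi_cancel_Zer:
  "\<lbrakk>is_epi C f; g \<in> Arr C; Dom C g = Cod C f; f \<cdot> g = Zer C (Dom C f) (Cod C g)\<rbrakk>
    \<Longrightarrow> g = Zer C (Cod C f) (Cod C g)"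
  using additive_category.mono_cancel_Zer[OF additive_category_opp, of f g] by simp

end

lemma mono_Arr: "is_mono C f \<Longrightarrow> f \<in> Arr C"
  and epi_Arr: "is_epi C f \<Longrightarrow> f \<in> Arr C"
  by (simp_all add: is_mono_def is_epi_def)

section \<open>Epimorphic covers as a substitute for elements\<close>

context abelian_category
begin

text \<open>\<open>e\<close> is a cokernel of some \<open>g\<close>, and \<open>g\<close> factors
  through the kernel \<open>k\<close> of \<open>e\<close>. So whatever \<open>k\<close> annihilates
  is annihilated by \<open>g\<close> and factors through \<open>e\<close>.\<close>

lemma epi_is_cokernel_of_kernel:
  assumes "is_epi C e" "is_kernel C e k"
  shows "is_cokernel C k e"
proof (rule is_cokernelI)
  note k = kernelD[OF assms(2)]
  obtain g where g: "is_cokernel C g e" using epi_is_cokernel[OF assms(1)] by blast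
  note g' = cokernelD[OF g]
  obtain g1 where g1: "g1 \<in> Arr C" "Dom C g1 = Dom C g" "Cod C g1 = Dom C k" "g1 \<cdot> k = g"
    by (rule kernel_factor[OF assms(2), of g]) (use g' in simp_all)
  fix t assume t: "t \<in> Arr C" "Dom C t = Cod C k" "k \<cdot> t = Zer C (Dom C k) (Cod C t)"
  have "(g1 \<cdot> k) \<cdot> t = Zer C (Dom C g) (Cod C t)"
    using t g1(1-3) k by (simp add: add_simps)
  hence "g \<cdot> t = Zer C (Dom C g) (Cod C t)" by (simp add: g1(4))
  then obtain u where "u \<in> Arr C" "Cod C u = Cod C t" "Dom C u = Cod C e" "e \<cdot> u = t"
    by (rule cokernel_factor[OF g t(1), rotated]) (use t k g' in simp_all)
  thus "\<exists>u\<in>Arr C. Cod C u = Cod C t \<and> Dom C u = Cod C e \<and> e \<cdot> u = t" by blast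
qed (use assms kernelD[OF assms(2)] in simp_all)

text \<open>This makes chases with generalised elements possible: an element \<open>t\<close> of the
  target of an epimorphism lifts to its source after passing to a cover \<open>e'\<close>. Cover and
  lift are the two legs of the pullback of \<open>t\<close> and \<open>e\<close>.\<close>

lemma epi_pullback:
  assumes e: "is_epi C e" and t: "t \<in> Arr C" "Cod C t = Cod C e"
  obtains e' x where "is_epi C e'" "Cod C e' = Dom C t" "x \<in> Arr C" "Dom C x = Dom C e'"
    "Cod C x = Dom C e" "e' \<cdot> t = x \<cdot> e"
proof -
  have ea: "e \<in> Arr C" using e by (rule epi_Arr)
  obtain S i j p q where S: "is_biproduct C (Dom C t) (Dom C e) S i j p q"
    using biproduct_exists[of "Dom C t" "Dom C e"] ea t by (auto simp: cat_simps)
  note D = biproductD[OF S]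
  \<comment> \<open>The pullback is realised as the kernel of the map sending \<open>(x, y)\<close>
    to \<open>t x + e y\<close>; the missing sign is put into the lift
    \<open>neg C (\<kappa> \<cdot> q)\<close>.\<close>
  define \<phi> where "\<phi> = p \<cdot> t \<boxplus> q \<cdot> e"
  have \<phi>: "\<phi> \<in> Arr C" "Dom C \<phi> = S" "Cod C \<phi> = Cod C e" "i \<cdot> \<phi> = t" "j \<cdot> \<phi> = e"
    using D ea t by (simp_all add: \<phi>_def add_simps)
  have j: "e \<cdot> h = j \<cdot> (\<phi> \<cdot> h)" if "h \<in> Arr C" "Dom C h = Cod C e" for h
    using Comp_reassoc[OF \<phi>(5)] that \<phi>(1-3) D by simp
  have epi: "is_epi C \<phi>"
  proof (rule epiI[OF \<phi>(1)])
    fix g assume g: "g \<in> Arr C" "Dom C g = Cod C \<phi>" "\<phi> \<cdot> g = Zer C (Dom C \<phi>) (Cod C g)"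
    have "e \<cdot> g = Zer C (Dom C e) (Cod C g)" using j[of g] g \<phi>(1-3) D by (simp add: add_simps)
    thus "g = Zer C (Cod C \<phi>) (Cod C g)" using epi_cancel_Zer[OF e g(1)] g(2) \<phi>(3) by simp
  qed
  obtain \<kappa> where \<kappa>: "is_kernel C \<phi> \<kappa>" using kernel_exists[OF \<phi>(1)] by blast
  note k = kernelD[OF \<kappa>]
  have cok: "is_cokernel C \<kappa> \<phi>" by (rule epi_is_cokernel_of_kernel[OF epi \<kappa>])
  show ?thesis
  proof (rule that[of "\<kappa> \<cdot> p" "neg C (\<kappa> \<cdot> q)"])
    show "is_epi C (\<kappa> \<cdot> p)"
    proof (rule epiI)
      show "\<kappa> \<cdot> p \<in> Arr C" using k \<phi> D by (simp add: cat_simps)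
      fix g assume g: "g \<in> Arr C" "Dom C g = Cod C (\<kappa> \<cdot> p)"
        "(\<kappa> \<cdot> p) \<cdot> g = Zer C (Dom C (\<kappa> \<cdot> p)) (Cod C g)"
      have dg: "Dom C g = Dom C t" using g(2) k \<phi> D by (simp add: cat_simps)
      have "\<kappa> \<cdot> (p \<cdot> g) = Zer C (Dom C \<kappa>) (Cod C (p \<cdot> g))" using g dg k \<phi> D by (simp add: cat_simps)
      \<comment> \<open>\<open>p \<cdot> g\<close> factors through \<phi>, a cokernel of \<kappa>.
        On the second summand this gives \<open>e \<cdot> h = 0\<close>, hence \<open>h = 0\<close>;
        on the first summand it then gives \<open>g = 0\<close>.\<close>
      then obtain h where h: "h \<in> Arr C" "Cod C h = Cod C (p \<cdot> g)" "Dom C h = Cod C \<phi>" "\<phi> \<cdot> h = p \<cdot> g"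
        by (rule cokernel_factor[OF cok, rotated 2]) (use g dg k \<phi> D in \<open>simp_all add: cat_simps\<close>)
      have ch: "Cod C h = Cod C g" using h(2) g dg D by (simp add: cat_simps)
      have "e \<cdot> h = Zer C (Dom C e) (Cod C g)" using j[of h] h g(1) dg \<phi>(3) D by simp
      hence h0: "h = Zer C (Cod C e) (Cod C g)"
        using epi_cancel_Zer[OF e h(1)] h(3) ch \<phi>(3) by simp
      have "g = i \<cdot> (\<phi> \<cdot> h)" using D g dg h(4) by simp
      also have "\<dots> = Zer C (Dom C t) (Cod C g)" unfolding h0 using \<phi> D g(1) ea by (simp add: add_simps)
      finally show "g = Zer C (Cod C (\<kappa> \<cdot> p)) (Cod C g)" using g(2) dg by simp
    qed
    have "\<kappa> \<cdot> (p \<cdot> t) \<boxplus> \<kappa> \<cdot> (q \<cdot> e) = Zer C (Dom C \<kappa>) (Cod C e)"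
      using k(4) k \<phi>(2,3) D ea t by (simp add: \<phi>_def add_simps)
    hence "\<kappa> \<cdot> (p \<cdot> t) = neg C (\<kappa> \<cdot> (q \<cdot> e))"
      by - (rule neg_unique, use k \<phi>(2) D ea t in \<open>simp_all add: cat_simps\<close>)
    thus "(\<kappa> \<cdot> p) \<cdot> t = neg C (\<kappa> \<cdot> q) \<cdot> e" using k \<phi>(2) D ea t by (simp add: cat_simps neg_Comp)
  qed (use k \<phi> D in \<open>simp_all add: cat_simps neg_Arr Dom_neg Cod_neg\<close>)
qed

text \<open>If \<open>q g = 0\<close>, then \<open>a\<close> factors through the kernel
  \<open>n\<close> of \<open>g\<close>, a subobject of the image. As a monomorphism,
  \<open>n m\<close> is a kernel of some \<open>d\<close>; this \<open>d\<close> annihilates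
  \<open>a\<close>, so it factors through \<open>c\<close> and annihilates \<open>m\<close>. Hence
  \<open>m\<close> factors through \<open>n m\<close>, the subobject is everything, and
  \<open>g = 0\<close>.\<close>

lemma image_factor:
  assumes "is_cokernel C a c" "is_kernel C c m"
  obtains q where "is_epi C q" "Dom C q = Dom C a" "Cod C q = Dom C m" "q \<cdot> m = a"
proof -
  note a = cokernelD[OF assms(1)] and m = kernelD[OF assms(2)]
  have mono: "is_mono C m" by (rule kernel_mono[OF assms(2)])
  obtain q where q: "q \<in> Arr C" "Dom C q = Dom C a" "Cod C q = Dom C m" "q \<cdot> m = a"
    by (rule kernel_factor[OF assms(2), of a]) (use a in simp_all)
  have "is_epi C q"
  proof (rule epiI[OF q(1)])
    fix g assume g: "g \<in> Arr C" "Dom C g = Cod C q" "q \<cdot> g = Zer C (Dom C q) (Cod C g)"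
    obtain n where n: "is_kernel C g n" using kernel_exists[OF g(1)] by blast
    note n' = kernelD[OF n]
    obtain q' where q': "q' \<in> Arr C" "Dom C q' = Dom C q" "Cod C q' = Dom C n" "q' \<cdot> n = q"
      by (rule kernel_factor[OF n, of q]) (use q g in simp_all)
    have "is_mono C (n \<cdot> m)"
      by (rule mono_Comp[OF kernel_mono[OF n] mono]) (use n' g q in simp)
    then obtain d where d: "is_kernel C d (n \<cdot> m)" using mono_is_kernel by blast
    note d' = kernelD[OF d]
    have dd: "Dom C d = Cod C m" using d'(3) n' m g q by (simp add: cat_simps)
    have "a \<cdot> d = ((q' \<cdot> n) \<cdot> m) \<cdot> d" by (simp add: q(4) q'(4))
    also have "\<dots> = q' \<cdot> ((n \<cdot> m) \<cdot> d)"
      using q(1-3) q'(1-3) n'(1-3) m(1-3) dd d'(1) g(1,2) by (simp add: cat_simps)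
    finally have "a \<cdot> d = q' \<cdot> ((n \<cdot> m) \<cdot> d)" .
    hence "a \<cdot> d = Zer C (Dom C a) (Cod C d)"
      unfolding d'(4) using q'(1-3) q(1-3) n'(1-3) m(1-3) g(1,2) dd d'(1) by (simp add: add_simps)
    then obtain d2 where d2: "d2 \<in> Arr C" "Cod C d2 = Cod C d" "Dom C d2 = Cod C c" "c \<cdot> d2 = d"
      by (rule cokernel_factor[OF assms(1) d'(1), rotated]) (use dd m a in simp_all)
    have "m \<cdot> (c \<cdot> d2) = (m \<cdot> c) \<cdot> d2" using d2(1-3) m(1-3) by (simp add: cat_simps)
    also have "\<dots> = Zer C (Dom C m) (Cod C d)" unfolding m(4) using d2(1-3) m(1-3) by (simp add: add_simps)
    finally have "m \<cdot> d = Zer C (Dom C m) (Cod C d)" unfolding d2(4) .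
    then obtain m' where m': "m' \<in> Arr C" "Dom C m' = Dom C m" "Cod C m' = Dom C (n \<cdot> m)" "m' \<cdot> (n \<cdot> m) = m"
      by (rule kernel_factor[OF d m(2), rotated]) (use dd in simp_all)
    have cm': "Cod C m' = Dom C n" using m'(3) n' m g q by (simp add: cat_simps)
    have "m' \<cdot> n = Ide C (Dom C m)"
      by (rule mono_cancel[OF mono]) (use m' cm' n' m g q in \<open>simp_all add: cat_simps\<close>)
    hence "g = (m' \<cdot> n) \<cdot> g" using g q m by (simp add: cat_simps)
    also have "\<dots> = m' \<cdot> (n \<cdot> g)" using m' cm' n' g by (simp add: cat_simps)
    also have "\<dots> = Zer C (Cod C q) (Cod C g)" using n' m' cm' g q by (simp add: add_simps)
    finally show "g = Zer C (Cod C q) (Cod C g)" .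
  qed
  thus ?thesis using q that by blast
qed

text \<open>An element that vanishes in the cokernel of \<open>a\<close> comes from the source of
  \<open>a\<close> after a cover: it lies in the kernel of \<open>c\<close>, onto which
  \<open>a\<close> maps epimorphically.\<close>

lemma cokernel_exact:
  assumes c: "is_cokernel C a c" and x: "x \<in> Arr C" "Cod C x = Cod C a" "x \<cdot> c = Zer C (Dom C x) (Cod C c)"
  obtains e z where "is_epi C e" "Cod C e = Dom C x" "z \<in> Arr C" "Dom C z = Dom C e" "Cod C z = Dom C a"
    "e \<cdot> x = z \<cdot> a"
proof -
  note a = cokernelD[OF c]
  obtain m where m: "is_kernel C c m" using kernel_exists[OF a(2)] by blast
  note m' = kernelD[OF m]
  obtain q where q: "is_epi C q" "Dom C q = Dom C a" "Cod C q = Dom C m" "q \<cdot> m = a"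
    using image_factor[OF c m] by blast
  have qa: "q \<in> Arr C" using q(1) by (rule epi_Arr)
  obtain y where y: "y \<in> Arr C" "Dom C y = Dom C x" "Cod C y = Dom C m" "y \<cdot> m = x"
    by (rule kernel_factor[OF m x(1)]) (use x a in simp_all)
  obtain e z where e: "is_epi C e" "Cod C e = Dom C y" "z \<in> Arr C" "Dom C z = Dom C e" "Cod C z = Dom C q"
    "e \<cdot> y = z \<cdot> q"
    by (rule epi_pullback[OF q(1) y(1)]) (use y q in simp_all)
  have ea: "e \<in> Arr C" using e(1) by (rule epi_Arr)
  have "e \<cdot> (y \<cdot> m) = (e \<cdot> y) \<cdot> m" using y(1-3) e(2) ea m' by (simp add: cat_simps)
  also have "\<dots> = z \<cdot> a" unfolding e(6) q(4)[symmetric] using e(2-5) qa q(2,3) m' by (simp add: cat_simps)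
  finally have "e \<cdot> x = z \<cdot> a" unfolding y(4) .
  thus ?thesis using that[of e z] e y q by simp
qed

end

text \<open>The data are not tied to a choice function. Besides the chosen data they have to cover
  the images of explicit data under an exact functor, and the same data read in the opposite
  category.\<close>

definition is_homology ::
  "('o, 'm, 'z) add_category_scheme \<Rightarrow> 'm dia \<Rightarrow> 'm \<Rightarrow> 'm \<Rightarrow> 'm \<Rightarrow> 'm \<Rightarrow> bool" where
  "is_homology C A k c p i \<longleftrightarrow> A \<in> diagrams C \<and> is_kernel C (snd A) k \<and> is_cokernel C (fst A) c \<and>
     is_epi C p \<and> is_mono C i \<and> Dom C p = Dom C k \<and> Cod C p = Dom C i \<and> Cod C i = Cod C c \<and>
     k \<cdot>\<^bsub>C\<^esub> c = p \<cdot>\<^bsub>C\<^esub> i"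

text \<open>
  This description of the map induced on homology by \<open>f\<^sub>1\<close> is invariant under passage to the
  opposite category.
\<close>

definition induced ::
  "('o, 'm, 'z) add_category_scheme \<Rightarrow> 'm \<Rightarrow> 'm \<Rightarrow> 'm \<Rightarrow> 'm \<Rightarrow> 'm \<Rightarrow> 'm \<Rightarrow> bool" where
  "induced C k p c i f u \<longleftrightarrow> u \<in> Hom C (Cod C p) (Dom C i) \<and> p \<cdot>\<^bsub>C\<^esub> (u \<cdot>\<^bsub>C\<^esub> i) = k \<cdot>\<^bsub>C\<^esub> (f \<cdot>\<^bsub>C\<^esub> c)"

lemma is_homology_opp:
  "is_homology (opp C) (prod.swap A) c k i p \<longleftrightarrow> is_homology C A k c p i"
  by (cases A) (auto simp: is_homology_def diagrams_iff)

section \<open>Uniqueness and algebra of the maps induced on homology\<close>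

context additive_category
begin

lemma homologyD:
  assumes "is_homology C (a0, a1) k c p i"
  shows "a0 \<in> Arr C" "a1 \<in> Arr C" "Cod C a0 = Dom C a1" "is_kernel C a1 k" "is_cokernel C a0 c"
    "is_epi C p" "is_mono C i" "k \<in> Arr C" "Cod C k = Dom C a1" "k \<cdot> a1 = Zer C (Dom C k) (Cod C a1)"
    "c \<in> Arr C" "Dom C c = Dom C a1" "a0 \<cdot> c = Zer C (Dom C a0) (Cod C c)"
    "p \<in> Arr C" "Dom C p = Dom C k" "Cod C p = Dom C i" "i \<in> Arr C" "Cod C i = Cod C c"
    "k \<cdot> c = p \<cdot> i"
  using assms by (auto simp: is_homology_def diagrams_iff dest: kernelD cokernelD mono_Arr epi_Arr)

text \<open>Cancel \<open>p\<close> on the left and \<open>i'\<close> on the right. Equations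
  between maps on homology are obtained from this by showing that both sides are induced by the same
  middle component.\<close>

lemma induced_unique:
  assumes "is_homology C (a0, a1) k c p i" "is_homology C (b0, b1) k' c' p' i'"
    "induced C k p c' i' f u" "induced C k p c' i' f v"
  shows "u = v"
proof -
  note a = homologyD[OF assms(1)] and b = homologyD[OF assms(2)]
  have uv: "u \<in> Arr C" "v \<in> Arr C" "Dom C u = Cod C p" "Dom C v = Cod C p" "Cod C u = Dom C i'"
    "Cod C v = Dom C i'" "p \<cdot> (u \<cdot> i') = p \<cdot> (v \<cdot> i')"
    using assms(3,4) by (simp_all add: induced_def Hom_iff)
  have "u \<cdot> i' = v \<cdot> i'" by (rule epi_cancel[OF a(6)]) (use a b uv in \<open>simp_all add: cat_simps\<close>)
  thus "u = v" by - (rule mono_cancel[OF b(7)], use a b uv in simp_all)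
qed

text \<open>Recovers the map on kernels used in the definition of the homology functor. It exists
  because \<open>k f1 b1 = k a1 f2 = 0\<close>, and its compatibility with \<open>u\<close> follows
  by cancelling \<open>i'\<close>.\<close>

lemma induced_kernel_part:
  assumes "is_homology C (a0, a1) k c p i" "is_homology C (b0, b1) k' c' p' i'"
    "((a0, a1), (f0, f1, f2), (b0, b1)) \<in> diagram_arrows C"
  obtains g where "g \<in> Arr C" "Dom C g = Dom C k" "Cod C g = Dom C k'" "g \<cdot> k' = k \<cdot> f1"
    "\<And>u. induced C k p c' i' f1 u \<Longrightarrow> p \<cdot> u = g \<cdot> p'"
proof -
  note a = homologyD[OF assms(1)] and b = homologyD[OF assms(2)] and f = assms(3)[unfolded diagram_arrows_iff]
  have "(k \<cdot> f1) \<cdot> b1 = k \<cdot> (a1 \<cdot> f2)" using a b f by (simp add: cat_simps)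
  also have "\<dots> = Zer C (Dom C k) (Cod C b1)"
    using Comp_reassoc[OF a(10), of f2] a b f by (simp add: Zer_Comp Dom_closed)
  finally obtain g where g: "g \<in> Arr C" "Dom C g = Dom C k" "Cod C g = Dom C k'" "g \<cdot> k' = k \<cdot> f1"
    by - (rule kernel_factor[OF b(4), of "k \<cdot> f1"], use a b f in \<open>simp_all add: cat_simps\<close>)
  have "p \<cdot> u = g \<cdot> p'" if u: "induced C k p c' i' f1 u" for u
  proof (rule mono_cancel[OF b(7)])
    have ua: "u \<in> Arr C" "Dom C u = Cod C p" "Cod C u = Dom C i'" "p \<cdot> (u \<cdot> i') = k \<cdot> (f1 \<cdot> c')"
      using u by (simp_all add: induced_def Hom_iff)
    have "(p \<cdot> u) \<cdot> i' = (k \<cdot> f1) \<cdot> c'" using ua a b f by (simp add: cat_simps)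
    also have "\<dots> = (g \<cdot> p') \<cdot> i'"
      unfolding g(4)[symmetric] using g(1-3) a b f by (simp add: cat_simps)
    finally show "(p \<cdot> u) \<cdot> i' = (g \<cdot> p') \<cdot> i'" .
    show "p \<cdot> u \<in> Arr C" "g \<cdot> p' \<in> Arr C" "Cod C (p \<cdot> u) = Dom C i'" "Cod C (g \<cdot> p') = Dom C i'"
      "Dom C (p \<cdot> u) = Dom C (g \<cdot> p')"
      using ua g(1-3) a b by (simp_all add: cat_simps)
  qed
  thus ?thesis using that g by blast
qed

lemma induced_opp:
  assumes "is_homology C (a0, a1) k c p i" "is_homology C (b0, b1) k' c' p' i'"
    "((a0, a1), (f0, f1, f2), (b0, b1)) \<in> diagram_arrows C" "induced C k p c' i' f1 u"
  shows "induced (opp C) c' i' k p f1 u"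
  using assms(3,4) homologyD[OF assms(1)] homologyD[OF assms(2)]
  by (simp add: induced_def Hom_iff diagram_arrows_iff cat_simps)

lemma induced_cokernel_part:
  assumes "is_homology C (a0, a1) k c p i" "is_homology C (b0, b1) k' c' p' i'"
    "((a0, a1), (f0, f1, f2), (b0, b1)) \<in> diagram_arrows C"
  obtains g where "g \<in> Arr C" "Dom C g = Cod C c" "Cod C g = Cod C c'" "c \<cdot> g = f1 \<cdot> c'"
    "\<And>u. induced C k p c' i' f1 u \<Longrightarrow> u \<cdot> i' = i \<cdot> g"
proof -
  have "((b1, b0), (f2, f1, f0), (a1, a0)) \<in> diagram_arrows (opp C)"
    using dual_in_diagram_arrows[of "((a0, a1), (f0, f1, f2), (b0, b1))" C] assms(3)
    by (simp del: dual_in_diagram_arrows)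
  moreover have "is_homology (opp C) (b1, b0) c' k' i' p'" "is_homology (opp C) (a1, a0) c k i p"
    using assms(1,2) is_homology_opp[of C "(b0, b1)"] is_homology_opp[of C "(a0, a1)"] by simp_all
  ultimately obtain g where g: "g \<in> Arr C" "Cod C g = Cod C c'" "Dom C g = Cod C c" "c \<cdot> g = f1 \<cdot> c'"
    "\<And>u. induced (opp C) c' i' k p f1 u \<Longrightarrow> u \<cdot> i' = i \<cdot> g"
    using additive_category.induced_kernel_part[OF additive_category_opp, of b1 b0 c' k' i' p' a1 a0 c k i p f2 f1 f0]
    by auto
  show ?thesis by (rule that[of g]) (use g induced_opp[OF assms] in simp_all)
qed

text \<open>The defining equation of \<open>v\<close> begins with \<open>p'\<close>, which does not
  occur in \<open>p u v i''\<close>. Replacing \<open>p u\<close> by \<open>x p'\<close>, with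
  \<open>x\<close> the map on kernels, brings it into place.\<close>

lemma induced_Comp:
  assumes "is_homology C (a0, a1) k c p i" "is_homology C (b0, b1) k' c' p' i'"
    "is_homology C (d0, d1) k'' c'' p'' i''"
    "((a0, a1), (f0, f1, f2), (b0, b1)) \<in> diagram_arrows C" "induced C k p c' i' f1 u"
    "((b0, b1), (g0, g1, g2), (d0, d1)) \<in> diagram_arrows C" "induced C k' p' c'' i'' g1 v"
  shows "induced C k p c'' i'' (f1 \<cdot> g1) (u \<cdot> v)"
proof -
  note a = homologyD[OF assms(1)] and b = homologyD[OF assms(2)] and d = homologyD[OF assms(3)]
    and f = assms(4)[unfolded diagram_arrows_iff] and g = assms(6)[unfolded diagram_arrows_iff]
  obtain x where x: "x \<in> Arr C" "Dom C x = Dom C k" "Cod C x = Dom C k'" "x \<cdot> k' = k \<cdot> f1" "p \<cdot> u = x \<cdot> p'"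
    using induced_kernel_part[OF assms(1,2,4)] assms(5) by metis
  have uv: "u \<in> Arr C" "Dom C u = Cod C p" "Cod C u = Dom C i'" "v \<in> Arr C" "Dom C v = Cod C p'"
    "Cod C v = Dom C i''" "p' \<cdot> (v \<cdot> i'') = k' \<cdot> (g1 \<cdot> c'')"
    using assms(5,7) by (simp_all add: induced_def Hom_iff)
  have "p \<cdot> ((u \<cdot> v) \<cdot> i'') = (p \<cdot> u) \<cdot> (v \<cdot> i'')" using uv a b d by (simp add: cat_simps)
  also have "\<dots> = x \<cdot> (p' \<cdot> (v \<cdot> i''))" unfolding x(5) using x(1-3) uv a b d by (simp add: cat_simps)
  also have "\<dots> = (x \<cdot> k') \<cdot> (g1 \<cdot> c'')" unfolding uv(7) using x(1-3) b d g by (simp add: cat_simps)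
  also have "\<dots> = k \<cdot> ((f1 \<cdot> g1) \<cdot> c'')" unfolding x(4) using a b d f g by (simp add: cat_simps)
  finally show ?thesis using uv a b d by (simp add: induced_def Hom_iff cat_simps)
qed

lemma induced_Ide:
  assumes "is_homology C (a0, a1) k c p i"
  shows "induced C k p c i (Ide C (Dom C a1)) (Ide C (Cod C p))"
  using homologyD[OF assms] by (simp add: induced_def Hom_iff cat_simps)

lemma induced_Add:
  assumes "is_homology C (a0, a1) k c p i" "is_homology C (b0, b1) k' c' p' i'"
    "((a0, a1), (f0, f1, f2), (b0, b1)) \<in> diagram_arrows C" "induced C k p c' i' f1 u"
    "((a0, a1), (g0, g1, g2), (b0, b1)) \<in> diagram_arrows C" "induced C k p c' i' g1 v"
  shows "induced C k p c' i' (f1 \<boxplus> g1) (u \<boxplus> v)"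
  using assms(3-6) homologyD[OF assms(1)] homologyD[OF assms(2)]
  by (simp add: induced_def Hom_iff diagram_arrows_iff add_simps)

text \<open>The summand through \<open>b0\<close> is annihilated by \<open>c'\<close>, and the
  summand through \<open>a1\<close> is annihilated by \<open>k\<close>.\<close>

lemma induced_null_homotopic:
  assumes "is_homology C (a0, a1) k c p i" "is_homology C (b0, b1) k' c' p' i'"
    "((a0, a1), (f0, f1, f2), (b0, b1)) \<in> null_homotopic C"
  shows "induced C k p c' i' f1 (Zer C (Cod C p) (Dom C i'))"
proof -
  note a = homologyD[OF assms(1)] and b = homologyD[OF assms(2)]
  obtain s t where st: "s \<in> Arr C" "Dom C s = Dom C a1" "Cod C s = Dom C b0" "t \<in> Arr C"
    "Dom C t = Cod C a1" "Cod C t = Dom C b1" "s \<cdot> b0 \<boxplus> a1 \<cdot> t = f1"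
    using assms(3) by (auto simp: null_homotopic_iff)
  have "k \<cdot> (a1 \<cdot> (t \<cdot> c')) = Zer C (Dom C k) (Cod C c')"
    using Comp_reassoc[OF a(10), of "t \<cdot> c'"] a b st(1-6) by (simp add: add_simps)
  hence "k \<cdot> (f1 \<cdot> c') = Zer C (Dom C k) (Cod C c')"
    unfolding st(7)[symmetric] using a b st(1-6) by (simp add: add_simps)
  thus ?thesis using a b by (simp add: induced_def Hom_iff add_simps)
qed

end

section \<open>Existence of induced maps, and kernels on homology\<close>

context abelian_category
begin

text \<open>\<open>p\<close> is a cokernel of its kernel \<open>n\<close>, so it suffices that
  \<open>n\<close> annihilates \<open>g p'\<close>. This is tested after the monomorphism
  \<open>i'\<close>, where the map \<open>h\<close> on cokernels turns the composite into
  \<open>n p i h\<close>.\<close>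

lemma induced_exists:
  assumes "is_homology C (a0, a1) k c p i" "is_homology C (b0, b1) k' c' p' i'"
    "((a0, a1), (f0, f1, f2), (b0, b1)) \<in> diagram_arrows C"
  shows "\<exists>u. induced C k p c' i' f1 u"
proof -
  note a = homologyD[OF assms(1)] and b = homologyD[OF assms(2)] and f = assms(3)[unfolded diagram_arrows_iff]
  obtain g where g: "g \<in> Arr C" "Dom C g = Dom C k" "Cod C g = Dom C k'" "g \<cdot> k' = k \<cdot> f1"
    using induced_kernel_part[OF assms] by metis
  obtain h where h: "h \<in> Arr C" "Dom C h = Cod C c" "Cod C h = Cod C c'" "c \<cdot> h = f1 \<cdot> c'"
    using induced_cokernel_part[OF assms] by metis
  obtain n where n: "is_kernel C p n" using kernel_exists[OF a(14)] by blast
  note n' = kernelD[OF n]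
  have gp: "(g \<cdot> p') \<cdot> i' = k \<cdot> (f1 \<cdot> c')"
  proof -
    have "(g \<cdot> p') \<cdot> i' = (g \<cdot> k') \<cdot> c'" using g(1-3) a b by (simp add: cat_simps)
    thus ?thesis unfolding g(4) using a b f by (simp add: cat_simps)
  qed
  have "n \<cdot> (g \<cdot> p') = Zer C (Dom C n) (Dom C i')"
  proof -
    have "(n \<cdot> (g \<cdot> p')) \<cdot> i' = n \<cdot> ((g \<cdot> p') \<cdot> i')" using g(1-3) a b n' by (simp add: cat_simps)
    also have "\<dots> = n \<cdot> (k \<cdot> (c \<cdot> h))" unfolding gp h(4) ..
    also have "\<dots> = n \<cdot> ((k \<cdot> c) \<cdot> h)" using h(1-3) a(1-18) n' by (simp add: cat_simps)
    also have "\<dots> = (n \<cdot> p) \<cdot> (i \<cdot> h)" unfolding a(19) using h(1-3) a n'(1-3) by (simp add: cat_simps)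
    also have "\<dots> = Zer C (Dom C n) (Cod C i')" unfolding n'(4) using h(1-3) a b n'(1-3) by (simp add: add_simps)
    finally show ?thesis
      using mono_cancel_Zer[OF b(7), of "n \<cdot> (g \<cdot> p')"] g(1-3) a b n' by (simp add: cat_simps)
  qed
  then obtain u where u: "u \<in> Arr C" "Cod C u = Cod C (g \<cdot> p')" "Dom C u = Cod C p" "p \<cdot> u = g \<cdot> p'"
    by - (rule cokernel_factor[OF epi_is_cokernel_of_kernel[OF a(6) n], of "g \<cdot> p'"],
        use g a b n' in \<open>simp_all add: cat_simps\<close>)
  have cu: "Cod C u = Dom C i'" using u(2) g b by (simp add: cat_simps)
  have "p \<cdot> (u \<cdot> i') = (p \<cdot> u) \<cdot> i'" using u(1,3) cu a b by (simp add: cat_simps)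
  hence "induced C k p c' i' f1 u" unfolding u(4) gp using u cu by (simp add: induced_def Hom_iff)
  thus ?thesis by blast
qed

text \<open>A diagram chase: after a cover, an element of homology is represented by a cycle in the
  middle object. For a pair \<open>(x, y)\<close> in the middle object of the kernel diagram,
  \<open>d1\<close> gives \<open>(a1 x, f1 x + b0 y)\<close> and \<open>m1\<close> gives
  \<open>x\<close>; its boundaries come from \<open>d0\<close>, which sends \<open>(x, y)\<close> to
  \<open>(a0 x, y)\<close>.\<close>

lemma is_kernel_induced:
  assumes "kernel_diagram C ((a0, a1), (f0, f1, f2), (b0, b1)) ((d0, d1), (m0, m1, m2), (a0, a1))"
    "is_homology C (a0, a1) ka ca pa ia" "is_homology C (b0, b1) kb cb pb ib"
    "is_homology C (d0, d1) kd cd pd jd"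
    "induced C kd pd ca ia m1 u" "induced C ka pa cb ib f1 v"
  shows "is_kernel C v u"
  using assms(1)
proof cases
  case (1 S0 i0 j0 q0 S1 i1 j1 q1 S2 i2 j2 q2)
  note D = biproductD[OF 1(4)] biproductD[OF 1(5)] biproductD[OF 1(6)] 1(3)[unfolded diagram_arrows_iff]
  note d0 = 1(1) and d1 = 1(2)
  have km: "kernel_mod (diagram_category C) (null_homotopic C) ((a0, a1), (f0, f1, f2), (b0, b1))
      ((d0, d1), (m0, m1, m2), (a0, a1))"
    by (rule kernel_mod_kernel_diagram[OF assms(1)])
  have md: "((d0, d1), (m0, m1, m2), (a0, a1)) \<in> diagram_arrows C" by (rule kernel_diagram_arrow[OF assms(1)])
  note a = homologyD[OF assms(2)] and b = homologyD[OF assms(3)] and d = homologyD[OF assms(4)]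
  note m = md[unfolded diagram_arrows_iff]
  have u: "u \<in> Arr C" "Dom C u = Cod C pd" "Cod C u = Dom C ia" "pd \<cdot> (u \<cdot> ia) = kd \<cdot> (m1 \<cdot> ca)"
    using assms(5) by (simp_all add: induced_def Hom_iff)
  have v: "v \<in> Arr C" "Dom C v = Cod C pa" "Cod C v = Dom C ib" "pa \<cdot> (v \<cdot> ib) = ka \<cdot> (f1 \<cdot> cb)"
    using assms(6) by (simp_all add: induced_def Hom_iff)
  have S1: "Dom C d1 = S1" "Cod C d0 = S1" "Dom C d0 = S0" "Cod C d1 = S2" using D by (simp_all add: d0 d1 add_simps)
  have mono: "is_mono C u"
  proof (rule monoI[OF u(1)])
    fix t assume t: "t \<in> Arr C" "Cod C t = Dom C u" "t \<cdot> u = Zer C (Dom C t) (Cod C u)"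
    obtain e x where e: "is_epi C e" "Cod C e = Dom C t" "x \<in> Arr C" "Dom C x = Dom C e" "Cod C x = Dom C pd"
      "e \<cdot> t = x \<cdot> pd"
      by (rule epi_pullback[OF d(6) t(1)]) (use t u in simp_all)
    have ea: "e \<in> Arr C" using e(1) by (rule epi_Arr)
    define y where "y = x \<cdot> kd"
    have y: "y \<in> Arr C" "Dom C y = Dom C e" "Cod C y = S1" using e d S1 by (simp_all add: y_def cat_simps)
    have "(y \<cdot> m1) \<cdot> ca = x \<cdot> (kd \<cdot> (m1 \<cdot> ca))" using e d S1 D a by (simp add: y_def cat_simps)
    also have "\<dots> = (x \<cdot> pd) \<cdot> (u \<cdot> ia)" unfolding u(4)[symmetric] using e(3-5) d u(1-3) a by (simp add: cat_simps)
    also have "\<dots> = e \<cdot> ((t \<cdot> u) \<cdot> ia)" unfolding e(6)[symmetric] using ea e(2) t(1,2) u(1-3) a by (simp add: cat_simps)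
    also have "\<dots> = Zer C (Dom C e) (Cod C ca)" unfolding t(3) using ea e(2) t(1,2) u(1-3) a by (simp add: add_simps)
    finally have "(y \<cdot> m1) \<cdot> ca = Zer C (Dom C (y \<cdot> m1)) (Cod C ca)" using y D by (simp add: cat_simps)
    then obtain e' z where e': "is_epi C e'" "Cod C e' = Dom C (y \<cdot> m1)" "z \<in> Arr C" "Dom C z = Dom C e'"
      "Cod C z = Dom C a0" "e' \<cdot> (y \<cdot> m1) = z \<cdot> a0"
      by - (rule cokernel_exact[OF a(5), of "y \<cdot> m1"], use y D a in \<open>simp_all add: cat_simps\<close>)
    have e'a: "e' \<in> Arr C" using e'(1) by (rule epi_Arr)
    have ce': "Cod C e' = Dom C e" using e'(2) y D by (simp add: cat_simps)
    \<comment> \<open>The first coordinate of the cycle \<open>y\<close> is a boundary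
      \<open>z a0\<close> over the cover, and the second is reached by the identity part of
      \<open>d0\<close>. So \<open>y\<close> is itself a boundary there and represents zero.\<close>
    define w where "w = z \<cdot> i0 \<boxplus> (e' \<cdot> (y \<cdot> q1)) \<cdot> j0"
    have w: "w \<in> Arr C" "Dom C w = Dom C e'" "Cod C w = S0"
      using e' e'a ce' y D by (simp_all add: w_def add_simps)
    have "w \<cdot> d0 = (z \<cdot> a0) \<cdot> i1 \<boxplus> (e' \<cdot> (y \<cdot> q1)) \<cdot> j1"
      using e'(3-5) e'a ce' y D by (simp add: w_def d0 add_simps)
    also have "\<dots> = e' \<cdot> y"
      unfolding e'(6)[symmetric] using biproduct_decompose[OF 1(5), of "e' \<cdot> y"] e'a ce' y D by (simp add: cat_simps)
    finally have wd: "w \<cdot> d0 = e' \<cdot> y" .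
    have "e' \<cdot> ((e \<cdot> t) \<cdot> jd) = e' \<cdot> (x \<cdot> (pd \<cdot> jd))" unfolding e(6) using e(3-5) d by (simp add: cat_simps)
    also have "\<dots> = (e' \<cdot> y) \<cdot> cd" unfolding d(19)[symmetric] y_def using e'a ce' e(3-5) d by (simp add: cat_simps)
    also have "\<dots> = Zer C (Dom C e') (Cod C cd)" unfolding wd[symmetric] using w d S1 by (simp add: add_simps)
    finally have "e' \<cdot> (e \<cdot> (t \<cdot> jd)) = Zer C (Dom C e') (Cod C jd)"
      using ea e(2) t(1,2) u(2) d by (simp add: cat_simps)
    hence "e \<cdot> (t \<cdot> jd) = Zer C (Cod C e') (Cod C jd)"
      using epi_cancel_Zer[OF e'(1), of "e \<cdot> (t \<cdot> jd)"] ea e(2) t(1,2) u(2) d ce' by (simp add: cat_simps)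
    hence "t \<cdot> jd = Zer C (Dom C t) (Cod C jd)"
      using epi_cancel_Zer[OF e(1), of "t \<cdot> jd"] ea e(2) t(1,2) u(2) d ce' by (simp add: cat_simps)
    hence "t = Zer C (Dom C t) (Dom C jd)"
      using mono_cancel_Zer[OF d(7), of t] t(1,2) u(2) d by simp
    thus "t = Zer C (Dom C t) (Dom C u)" using u(2) d by simp
  qed
  have zero: "u \<cdot> v = Zer C (Dom C u) (Cod C v)"
  proof (rule induced_unique[OF assms(4,3)])
    show "induced C kd pd cb ib (m1 \<cdot> f1) (u \<cdot> v)"
      by (rule induced_Comp[OF assms(4,2,3) md assms(5) 1(3) assms(6)])
    have "((d0, d1), (m0 \<cdot> f0, m1 \<cdot> f1, m2 \<cdot> f2), (b0, b1)) \<in> null_homotopic C"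
      using km by (simp add: kernel_mod_def diagram_sel)
    from induced_null_homotopic[OF assms(4,3) this]
    show "induced C kd pd cb ib (m1 \<cdot> f1) (Zer C (Dom C u) (Cod C v))" using u v by simp
  qed
  show ?thesis
  proof (rule is_kernelI[OF v(1) mono _ zero])
    show "Cod C u = Dom C v" using u v a by simp
    fix t assume t: "t \<in> Arr C" "Cod C t = Dom C v" "t \<cdot> v = Zer C (Dom C t) (Cod C v)"
    obtain e x' where e: "is_epi C e" "Cod C e = Dom C t" "x' \<in> Arr C" "Dom C x' = Dom C e" "Cod C x' = Dom C pa"
      "e \<cdot> t = x' \<cdot> pa"
      by (rule epi_pullback[OF a(6) t(1)]) (use t v in simp_all)
    have ea: "e \<in> Arr C" using e(1) by (rule epi_Arr)
    define x where "x = x' \<cdot> ka"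
    have x: "x \<in> Arr C" "Dom C x = Dom C e" "Cod C x = Dom C a1" using e a by (simp_all add: x_def cat_simps)
    have xa: "x \<cdot> a1 = Zer C (Dom C e) (Cod C a1)" using e a by (simp add: x_def add_simps)
    have "(x \<cdot> f1) \<cdot> cb = x' \<cdot> (ka \<cdot> (f1 \<cdot> cb))" using e(3-5) a b D by (simp add: x_def cat_simps)
    also have "\<dots> = (x' \<cdot> pa) \<cdot> (v \<cdot> ib)" unfolding v(4)[symmetric] using e(3-5) a v(1-3) b by (simp add: cat_simps)
    also have "\<dots> = e \<cdot> ((t \<cdot> v) \<cdot> ib)" unfolding e(6)[symmetric] using ea e(2) t(1,2) v(1-3) b by (simp add: cat_simps)
    also have "\<dots> = Zer C (Dom C e) (Cod C cb)" unfolding t(3) using ea e(2) t(1,2) v(1-3) b by (simp add: add_simps)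
    finally have "(x \<cdot> f1) \<cdot> cb = Zer C (Dom C (x \<cdot> f1)) (Cod C cb)" using x D by (simp add: cat_simps)
    then obtain e' z where e': "is_epi C e'" "Cod C e' = Dom C (x \<cdot> f1)" "z \<in> Arr C" "Dom C z = Dom C e'"
      "Cod C z = Dom C b0" "e' \<cdot> (x \<cdot> f1) = z \<cdot> b0"
      by - (rule cokernel_exact[OF b(5), of "x \<cdot> f1"], use x D b in \<open>simp_all add: cat_simps\<close>)
    have e'a: "e' \<in> Arr C" using e'(1) by (rule epi_Arr)
    have ce': "Cod C e' = Dom C e" using e'(2) x D by (simp add: cat_simps)
    \<comment> \<open>Over the cover \<open>f1\<close> sends the cycle \<open>x\<close> to
      \<open>z b0\<close>. Both coordinates of \<open>d1\<close> therefore vanish on the pair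
      \<open>(x, -z)\<close>, which is a cycle of the kernel diagram lying over
      \<open>x\<close>.\<close>
    define w where "w = (e' \<cdot> x) \<cdot> i1 \<boxplus> neg C z \<cdot> j1"
    have w: "w \<in> Arr C" "Dom C w = Dom C e'" "Cod C w = S1"
      using e' e'a ce' x D by (simp_all add: w_def add_simps)
    have wp: "w \<cdot> m1 = e' \<cdot> x" using e'(3-5) e'a ce' x D by (simp add: w_def add_simps)
    have "w \<cdot> d1 = e' \<cdot> ((x \<cdot> a1) \<cdot> i2) \<boxplus> ((e' \<cdot> (x \<cdot> f1)) \<cdot> j2 \<boxplus> neg C ((z \<cdot> b0) \<cdot> j2))"
      using e'(3-5) e'a ce' x D by (simp add: w_def d1 add_simps)
    also have "\<dots> = Zer C (Dom C e') S2"
      unfolding xa e'(6) using e'(3-5) e'a ce' ea D by (simp add: add_simps)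
    finally have "w \<cdot> d1 = Zer C (Dom C w) (Cod C d1)" using w S1 by simp
    then obtain w' where w': "w' \<in> Arr C" "Dom C w' = Dom C w" "Cod C w' = Dom C kd" "w' \<cdot> kd = w"
      by - (rule kernel_factor[OF d(4) w(1)], use w S1 in simp_all)
    have E: "is_epi C (e' \<cdot> e)" by (rule epi_Comp[OF e'(1) e(1) ce'])
    have E': "e' \<cdot> e \<in> Arr C" "Dom C (e' \<cdot> e) = Dom C e'" "Cod C (e' \<cdot> e) = Dom C t"
      using e'a ea ce' e(2) by (simp_all add: cat_simps)
    let ?W = "w' \<cdot> pd"
    have W: "?W \<in> Arr C" "Dom C ?W = Dom C e'" "Cod C ?W = Dom C u" using w' w d u by (simp_all add: cat_simps)
    have Wu: "?W \<cdot> u = (e' \<cdot> e) \<cdot> t"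
    proof (rule mono_cancel[OF a(7)])
      have "(?W \<cdot> u) \<cdot> ia = w' \<cdot> (pd \<cdot> (u \<cdot> ia))" using w' d u(1-3) a by (simp add: cat_simps)
      also have "\<dots> = (w' \<cdot> kd) \<cdot> (m1 \<cdot> ca)" unfolding u(4) using w'(1-3) d D a S1 by (simp add: cat_simps)
      also have "\<dots> = (w \<cdot> m1) \<cdot> ca" unfolding w'(4) using w D a by (simp add: cat_simps)
      also have "\<dots> = e' \<cdot> (x' \<cdot> (ka \<cdot> ca))" unfolding wp x_def using e'a ce' e(3-5) a by (simp add: cat_simps)
      also have "\<dots> = e' \<cdot> ((x' \<cdot> pa) \<cdot> ia)" unfolding a(19) using e(3-5) a by (simp add: cat_simps)
      also have "\<dots> = ((e' \<cdot> e) \<cdot> t) \<cdot> ia" unfolding e(6)[symmetric] using e'a ce' ea e(2) t(1,2) v(2) a by (simp add: cat_simps)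
      finally show "(?W \<cdot> u) \<cdot> ia = ((e' \<cdot> e) \<cdot> t) \<cdot> ia" .
    qed (use W E' t v u a in \<open>simp_all add: Comp_Arr Dom_Comp Cod_Comp\<close>)
    \<comment> \<open>So far the lift \<open>?W\<close> lives only on the cover. The cover is a
      cokernel of \<open>g\<close>, and \<open>g \<cdot> ?W\<close> is zero because it becomes zero
      after the monomorphism \<open>u\<close>; hence the lift descends.\<close>
    obtain g where g: "is_cokernel C g (e' \<cdot> e)" using epi_is_cokernel[OF E] by blast
    note g' = cokernelD[OF g]
    have "(g \<cdot> ?W) \<cdot> u = g \<cdot> (?W \<cdot> u)" using g' W u(1) E'(2) by (intro Comp_associative) simp_all
    also have "\<dots> = (g \<cdot> (e' \<cdot> e)) \<cdot> t" unfolding Wu using g' t(1) E' by (intro Comp_associative[symmetric]) simp_all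
    also have "\<dots> = Zer C (Dom C g) (Cod C u)" unfolding g'(4) using g'(1) t(1,2) E'(3) v a u by (simp add: add_simps)
    finally have "g \<cdot> ?W = Zer C (Dom C g) (Cod C ?W)"
      using mono_cancel_Zer[OF mono, of "g \<cdot> ?W"] g' W E'(2) by (simp add: Comp_Arr Dom_Comp Cod_Comp)
    then obtain r where r: "r \<in> Arr C" "Cod C r = Cod C ?W" "Dom C r = Cod C (e' \<cdot> e)" "(e' \<cdot> e) \<cdot> r = ?W"
      by - (rule cokernel_factor[OF g W(1)], use g' W E'(2) in simp_all)
    have "r \<cdot> u = t"
    proof (rule epi_cancel[OF E])
      have "(e' \<cdot> e) \<cdot> (r \<cdot> u) = ((e' \<cdot> e) \<cdot> r) \<cdot> u" using E' r(1-3) W u(1) by (intro Comp_associative[symmetric]) simp_all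
      thus "(e' \<cdot> e) \<cdot> (r \<cdot> u) = (e' \<cdot> e) \<cdot> t" unfolding r(4) Wu .
    qed (use r E' W t v u a in \<open>simp_all add: Comp_Arr Dom_Comp Cod_Comp\<close>)
    thus "\<exists>r\<in>Arr C. Dom C r = Dom C t \<and> Cod C r = Dom C u \<and> r \<cdot> u = t"
      using r E' W by (intro bexI[of _ r]) simp_all
  qed
qed

end

section \<open>Exact functors\<close>

context category_functor
begin

lemma amap_Arr: "f \<in> Arr C \<Longrightarrow> amap F f \<in> Arr D"
  and Dom_amap: "f \<in> Arr C \<Longrightarrow> Dom D (amap F f) = omap F (Dom C f)"
  and Cod_amap: "f \<in> Arr C \<Longrightarrow> Cod D (amap F f) = omap F (Cod C f)"
  using amap_closed[of f "Dom C f" "Cod C f"] by (simp_all add: Hom_iff)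

lemma amap_Comp_Arr:
  "\<lbrakk>f \<in> Arr C; g \<in> Arr C; Cod C f = Dom C g\<rbrakk> \<Longrightarrow> amap F (f \<cdot>\<^bsub>C\<^esub> g) = amap F f \<cdot>\<^bsub>D\<^esub> amap F g"
  using amap_Comp[of f "Dom C f" "Cod C f" g "Cod C g"] by (simp add: Hom_iff)

lemmas functor_simps = omap_closed amap_Arr Dom_amap Cod_amap amap_Ide amap_Comp_Arr

end

context additive_functor
begin

lemma amap_Add_Arr: "\<lbrakk>f \<in> Arr C; g \<in> Arr C; Dom C f = Dom C g; Cod C f = Cod C g\<rbrakk>
    \<Longrightarrow> amap F (f \<boxplus>\<^bsub>C\<^esub> g) = amap F f \<boxplus>\<^bsub>D\<^esub> amap F g"
  using amap_Add[of f "Dom C f" "Cod C f" g] by (simp add: Hom_iff)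

lemma amap_Zer:
  assumes "X \<in> Obj C" "Y \<in> Obj C"
  shows "amap F (Zer C X Y) = Zer D (omap F X) (omap F Y)"
proof -
  have "amap F (Zer C X Y) \<boxplus>\<^bsub>D\<^esub> amap F (Zer C X Y) = amap F (Zer C X Y)"
    using assms by (simp add: amap_Add_Arr[symmetric] C.add_simps)
  from D.idempotent_is_Zer[OF this] show ?thesis using assms by (simp add: functor_simps C.add_simps)
qed

lemma amap_neg:
  assumes "f \<in> Arr C"
  shows "amap F (neg C f) = neg D (amap F f)"
proof (rule D.neg_unique)
  show "amap F (neg C f) \<boxplus>\<^bsub>D\<^esub> amap F f = Zer D (Dom D (amap F f)) (Cod D (amap F f))"
    using assms by (simp add: amap_Add_Arr[symmetric] C.add_simps amap_Zer functor_simps)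
qed (use assms in \<open>simp_all add: functor_simps C.add_simps\<close>)

lemmas additive_functor_simps = functor_simps amap_Add_Arr amap_Zer amap_neg

text \<open>Biproducts are described by equations between morphisms, so additive functors preserve
  them together with everything built from them.\<close>

lemma is_biproduct_amap:
  assumes "is_biproduct C X Y S i j p q"
  shows "is_biproduct D (omap F X) (omap F Y) (omap F S) (amap F i) (amap F j) (amap F p) (amap F q)"
proof -
  note * = C.biproductD[OF assms] and s = C.biproduct_sum[OF assms]
  have "amap F (p \<cdot>\<^bsub>C\<^esub> i \<boxplus>\<^bsub>C\<^esub> q \<cdot>\<^bsub>C\<^esub> j) = Ide D (omap F S)" unfolding s using * by (simp add: functor_simps)
  hence "amap F p \<cdot>\<^bsub>D\<^esub> amap F i \<boxplus>\<^bsub>D\<^esub> amap F q \<cdot>\<^bsub>D\<^esub> amap F j = Ide D (omap F S)"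
    using *(1-13) by (simp add: additive_functor_simps C.cat_simps)
  thus ?thesis
    using * by (simp add: is_biproduct_def Hom_iff omap_closed amap_Arr Dom_amap Cod_amap amap_Ide[symmetric]
        amap_Zer[symmetric] amap_Comp_Arr[symmetric])
qed

text \<open>The identity of a zero object is a zero morphism. This equation survives an additive
  functor and in turn forces every morphism from or to the image to be zero.\<close>

lemma omap_zero_object:
  assumes "is_zero_object C Z"
  shows "is_zero_object D (omap F Z)"
proof (rule is_zero_objectI[where z = "Zer D (omap F Z)" and z' = "\<lambda>X. Zer D X (omap F Z)"])
  have Z: "Z \<in> Obj C" using assms by (simp add: is_zero_object_def)
  show Z': "omap F Z \<in> Obj D" using Z by (rule omap_closed)
  have "Ide C Z = Zer C Z Z" by (rule C.zero_object_unique[OF assms]) (use Z in \<open>simp_all add: C.add_simps\<close>)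
  hence e: "Ide D (omap F Z) = Zer D (omap F Z) (omap F Z)" using Z amap_Ide[of Z] amap_Zer[of Z Z] by simp
  show "Zer D (omap F Z) X \<in> Hom D (omap F Z) X" "Zer D X (omap F Z) \<in> Hom D X (omap F Z)"
    if "X \<in> Obj D" for X using that Z' by (simp_all add: Hom_iff D.add_simps)
  show "f = Zer D (omap F Z) X" if "f \<in> Hom D (omap F Z) X" for f X
    using D.Ide_left[OF that] that Z' by (simp add: e D.Zer_Comp Hom_iff)
  show "f = Zer D X (omap F Z)" if "f \<in> Hom D X (omap F Z)" for f X
    using D.Ide_right[OF that] that Z' by (simp add: e D.Comp_Zer Hom_iff)
qed

end

lemma (in additive_category) is_kernel_iso:
  assumes "is_kernel C f k" "v \<in> Arr C" "w \<in> Arr C" "Cod C v = Dom C k" "Dom C w = Cod C v"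
    "Cod C w = Dom C v" "v \<cdot> w = Ide C (Dom C v)" "w \<cdot> v = Ide C (Dom C w)"
  shows "is_kernel C f (v \<cdot> k)"
proof (rule is_kernelI)
  note k = kernelD[OF assms(1)] and m = kernel_mono[OF assms(1)]
  have "is_mono C v"
  proof (rule monoI[OF assms(2)])
    fix g assume g: "g \<in> Arr C" "Cod C g = Dom C v" "g \<cdot> v = Zer C (Dom C g) (Cod C v)"
    have "g = (g \<cdot> v) \<cdot> w" using g(1,2) assms by (simp add: cat_simps)
    thus "g = Zer C (Dom C g) (Dom C v)" unfolding g(3) using g(1,2) assms by (simp add: add_simps)
  qed
  thus "is_mono C (v \<cdot> k)" using m assms(4) by (rule mono_Comp)
  show "(v \<cdot> k) \<cdot> f = Zer C (Dom C (v \<cdot> k)) (Cod C f)" using k assms by (simp add: add_simps)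
  fix t assume t: "t \<in> Arr C" "Cod C t = Dom C f" "t \<cdot> f = Zer C (Dom C t) (Cod C f)"
  then obtain u where u: "u \<in> Arr C" "Dom C u = Dom C t" "Cod C u = Dom C k" "u \<cdot> k = t"
    by (rule kernel_factor[OF assms(1)])
  have "(u \<cdot> w) \<cdot> (v \<cdot> k) = u \<cdot> ((w \<cdot> v) \<cdot> k)" using u(1-3) assms(2-6) k by (simp add: cat_simps)
  also have "\<dots> = t" unfolding assms(8) using u assms(2-6) k by (simp add: cat_simps)
  finally show "\<exists>u\<in>Arr C. Dom C u = Dom C t \<and> Cod C u = Dom C (v \<cdot> k) \<and> u \<cdot> (v \<cdot> k) = t"
    using u(1-3) assms(2-6) k by (intro bexI[of _ "u \<cdot> w"]) (simp_all add: cat_simps)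
qed (use kernelD[OF assms(1)] assms in \<open>simp_all add: cat_simps\<close>)

context additive_functor
begin

text \<open>The comparison maps between two kernels of \<open>f\<close> are mutually inverse and
  stay so under \<open>F\<close>. Exactness can therefore be tested on one convenient kernel of each
  morphism.\<close>

lemma amap_kernel_transfer:
  assumes "is_kernel C f k" "is_kernel C f k'" "is_kernel D (amap F f) (amap F k)"
  shows "is_kernel D (amap F f) (amap F k')"
proof -
  note k = C.kernelD[OF assms(1)] and k' = C.kernelD[OF assms(2)]
  obtain v where v: "v \<in> Arr C" "Dom C v = Dom C k'" "Cod C v = Dom C k" "v \<cdot>\<^bsub>C\<^esub> k = k'"
    by (rule C.kernel_factor[OF assms(1), of k']) (use k' in simp_all)
  obtain w where w: "w \<in> Arr C" "Dom C w = Dom C k" "Cod C w = Dom C k'" "w \<cdot>\<^bsub>C\<^esub> k' = k"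
    by (rule C.kernel_factor[OF assms(2), of k]) (use k in simp_all)
  have vw: "v \<cdot>\<^bsub>C\<^esub> w = Ide C (Dom C k')"
    by (rule C.mono_cancel[OF C.kernel_mono[OF assms(2)]]) (use v w k k' in \<open>simp_all add: C.cat_simps\<close>)
  have wv: "w \<cdot>\<^bsub>C\<^esub> v = Ide C (Dom C k)"
    by (rule C.mono_cancel[OF C.kernel_mono[OF assms(1)]]) (use v w k k' in \<open>simp_all add: C.cat_simps\<close>)
  have "amap F v \<cdot>\<^bsub>D\<^esub> amap F w = Ide D (omap F (Dom C k'))"
    using arg_cong[OF vw, of "amap F"] v(1-3) w(1-3) k' by (simp add: functor_simps C.cat_simps)
  moreover have "amap F w \<cdot>\<^bsub>D\<^esub> amap F v = Ide D (omap F (Dom C k))"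
    using arg_cong[OF wv, of "amap F"] v(1-3) w(1-3) k by (simp add: functor_simps C.cat_simps)
  ultimately have "is_kernel D (amap F f) (amap F v \<cdot>\<^bsub>D\<^esub> amap F k)"
    using v(1-3) w(1-3) k k' by (intro D.is_kernel_iso[OF assms(3), of "amap F v" "amap F w"])
      (simp_all add: functor_simps)
  moreover have "amap F v \<cdot>\<^bsub>D\<^esub> amap F k = amap F k'"
    using v k by (simp add: amap_Comp_Arr[symmetric])
  ultimately show ?thesis by simp
qed

lemma exact_functorI:
  assumes "\<And>f. f \<in> Arr C \<Longrightarrow> \<exists>k. is_kernel C f k \<and> is_kernel D (amap F f) (amap F k)"
    "\<And>f. f \<in> Arr C \<Longrightarrow> \<exists>c. is_cokernel C f c \<and> is_cokernel D (amap F f) (amap F c)"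
  shows "exact_functor C D F"
proof (intro exact_functor.intro exact_functor_axioms.intro)
  show "additive_functor C D F" by (rule additive_functor_axioms)
  show "is_kernel D (amap F f) (amap F k)" if "is_kernel C f k" for f k
    using assms(1)[OF C.kernelD(1)[OF that]] amap_kernel_transfer that by blast
  show "is_cokernel D (amap F f) (amap F c)" if "is_cokernel C f c" for f c
    using assms(2)[OF C.cokernelD(1)[OF that]] that
      additive_functor.amap_kernel_transfer[OF additive_functor_opp, of f _ c] by auto
qed

end

text \<open>Expresses monomorphy through a kernel, so that preservation of kernels implies
  preservation of monomorphisms.\<close>

lemma (in additive_category) is_kernel_of_mono:
  assumes "is_mono C f"
  shows "is_kernel C f (Zer C (Zob C) (Dom C f))"
proof (rule is_kernelI)
  have f: "f \<in> Arr C" using assms by (rule mono_Arr)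
  thus "f \<in> Arr C" "Cod C (Zer C (Zob C) (Dom C f)) = Dom C f"
    "Zer C (Zob C) (Dom C f) \<cdot> f = Zer C (Dom C (Zer C (Zob C) (Dom C f))) (Cod C f)"
    by (simp_all add: add_simps)
  show "is_mono C (Zer C (Zob C) (Dom C f))"
    by (rule monoI) (use f in \<open>auto intro!: zero_object_unique[OF zero_object_Zob] simp: add_simps\<close>)
  fix t assume t: "t \<in> Arr C" "Cod C t = Dom C f" "t \<cdot> f = Zer C (Dom C t) (Cod C f)"
  hence "Zer C (Dom C t) (Zob C) \<cdot> Zer C (Zob C) (Dom C f) = t"
    using mono_cancel_Zer[OF assms t(1,2,3)] f by (simp add: add_simps)
  thus "\<exists>u\<in>Arr C. Dom C u = Dom C t \<and> Cod C u = Dom C (Zer C (Zob C) (Dom C f)) \<and>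
      u \<cdot> Zer C (Zob C) (Dom C f) = t"
    using t f by (intro bexI[of _ "Zer C (Dom C t) (Zob C)"]) (simp_all add: add_simps)
qed

context exact_functor
begin

lemma exact_functor_opp: "exact_functor (opp C) (opp D) F"
  by (intro exact_functor.intro exact_functor_axioms.intro additive_functor_opp)
    (simp_all add: preserves_kernel preserves_cokernel)

lemma amap_mono:
  assumes "is_mono C f" shows "is_mono D (amap F f)"
proof (rule D.monoI)
  have f: "f \<in> Arr C" using assms by (rule mono_Arr)
  thus f': "amap F f \<in> Arr D" by (rule amap_Arr)
  have k: "is_kernel D (amap F f) (Zer D (omap F (Zob C)) (omap F (Dom C f)))"
    using preserves_kernel[OF C.is_kernel_of_mono[OF assms]] f by (simp add: amap_Zer C.add_simps)
  fix g assume g: "g \<in> Arr D" "Cod D g = Dom D (amap F f)" "g \<cdot>\<^bsub>D\<^esub> amap F f = Zer D (Dom D g) (Cod D (amap F f))"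
  obtain u where "u \<in> Arr D" "Dom D u = Dom D g" "Cod D u = Dom D (Zer D (omap F (Zob C)) (omap F (Dom C f)))"
    "u \<cdot>\<^bsub>D\<^esub> Zer D (omap F (Zob C)) (omap F (Dom C f)) = g"
    by (rule D.kernel_factor[OF k g])
  thus "g = Zer D (Dom D g) (Dom D (amap F f))"
    using f by (simp add: functor_simps D.add_simps C.add_simps)
qed

lemma amap_epi: "is_epi C f \<Longrightarrow> is_epi D (amap F f)"
  using exact_functor.amap_mono[OF exact_functor_opp, of f] by simp

end

section \<open>The functor induced on homology\<close>

lemma dia_arr_map_simp:
  "dia_arr_map F ((a0, a1), (f0, f1, f2), (b0, b1)) =
    ((amap F a0, amap F a1), (amap F f0, amap F f1, amap F f2), (amap F b0, amap F b1))"
  by (simp add: dia_arr_map_def dia_map_def)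

lemma (in additive_category) homology_choiceD:
  assumes "is_homology_choice C h" "A \<in> diagrams C"
  shows "is_homology C A (hker h A) (hcok h A) (hepi h A) (hmono h A)"
  using assms kernelD[of "snd A" "hker h A"] by (simp add: is_homology_choice_def is_homology_def)

context abelian_category
begin

text \<open>Connects the definite descriptions with \<open>induced\<close>. The maps on kernels, on
  cokernels and on images are each determined by cancelling a monomorphism or an epimorphism, so
  every \<open>THE\<close> denotes the map at hand.\<close>

lemma homology_map_eq:
  assumes h: "is_homology_choice C h" and f: "((a0, a1), (f0, f1, f2), (b0, b1)) \<in> diagram_arrows C"
    and u: "induced C (hker h (a0, a1)) (hepi h (a0, a1)) (hcok h (b0, b1)) (hmono h (b0, b1)) f1 u"
  shows "homology_map C h ((a0, a1), (f0, f1, f2), (b0, b1)) = u"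
proof -
  let ?A = "(a0, a1)" and ?B = "(b0, b1)"
  have AB: "?A \<in> diagrams C" "?B \<in> diagrams C" using f by (simp_all add: diagram_arrows_iff diagrams_iff)
  note hA = homology_choiceD[OF h AB(1)] and hB = homology_choiceD[OF h AB(2)]
  note a = homologyD[OF hA] and b = homologyD[OF hB]
  obtain g where g: "g \<in> Arr C" "Dom C g = Dom C (hker h ?A)" "Cod C g = Dom C (hker h ?B)"
    "g \<cdot> hker h ?B = hker h ?A \<cdot> f1" "hepi h ?A \<cdot> u = g \<cdot> hepi h ?B"
    using induced_kernel_part[OF hA hB f] u by metis
  obtain c where c: "c \<in> Arr C" "Dom C c = Cod C (hcok h ?A)" "Cod C c = Cod C (hcok h ?B)"
    "hcok h ?A \<cdot> c = f1 \<cdot> hcok h ?B" "u \<cdot> hmono h ?B = hmono h ?A \<cdot> c"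
    using induced_cokernel_part[OF hA hB f] u by metis
  have km: "ker_map C h (?A, (f0, f1, f2), ?B) = g"
    unfolding ker_map_def prod.case
  proof (rule the_equality)
    show "g \<in> Hom C (Dom C (hker h ?A)) (Dom C (hker h ?B)) \<and> g \<cdot> hker h ?B = hker h ?A \<cdot> f1"
      using g by (simp add: Hom_iff)
    fix v assume "v \<in> Hom C (Dom C (hker h ?A)) (Dom C (hker h ?B)) \<and> v \<cdot> hker h ?B = hker h ?A \<cdot> f1"
    thus "v = g" using g by - (rule mono_cancel[OF kernel_mono[OF b(4)]], simp_all add: Hom_iff)
  qed
  have cm: "cok_map C h (?A, (f0, f1, f2), ?B) = c"
    unfolding cok_map_def prod.case
  proof (rule the_equality)
    show "c \<in> Hom C (Cod C (hcok h ?A)) (Cod C (hcok h ?B)) \<and> hcok h ?A \<cdot> c = f1 \<cdot> hcok h ?B"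
      using c by (simp add: Hom_iff)
    fix v assume "v \<in> Hom C (Cod C (hcok h ?A)) (Cod C (hcok h ?B)) \<and> hcok h ?A \<cdot> v = f1 \<cdot> hcok h ?B"
    thus "v = c" using c by - (rule epi_cancel[OF cokernel_epi[OF a(5)]], simp_all add: Hom_iff)
  qed
  have uH: "u \<in> Hom C (Cod C (hepi h ?A)) (Cod C (hepi h ?B))" using u b by (simp add: induced_def)
  show ?thesis
    unfolding homology_map_def prod.case km cm
  proof (rule the_equality)
    show "u \<in> Hom C (Cod C (hepi h ?A)) (Cod C (hepi h ?B)) \<and>
        hepi h ?A \<cdot> u = g \<cdot> hepi h ?B \<and> u \<cdot> hmono h ?B = hmono h ?A \<cdot> c"
      using uH g(5) c(5) by simp
    fix v assume "v \<in> Hom C (Cod C (hepi h ?A)) (Cod C (hepi h ?B)) \<and>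
        hepi h ?A \<cdot> v = g \<cdot> hepi h ?B \<and> v \<cdot> hmono h ?B = hmono h ?A \<cdot> c"
    thus "v = u" using uH g(5) by - (rule epi_cancel[OF a(6)], simp_all add: Hom_iff)
  qed
qed

lemma homology_map_induced:
  assumes h: "is_homology_choice C h" and f: "((a0, a1), (f0, f1, f2), (b0, b1)) \<in> diagram_arrows C"
  shows "induced C (hker h (a0, a1)) (hepi h (a0, a1)) (hcok h (b0, b1)) (hmono h (b0, b1)) f1
    (homology_map C h ((a0, a1), (f0, f1, f2), (b0, b1)))"
proof -
  have "(a0, a1) \<in> diagrams C" "(b0, b1) \<in> diagrams C" using f by (simp_all add: diagram_arrows_iff diagrams_iff)
  thus ?thesis
    using induced_exists[OF homology_choiceD[OF h] homology_choiceD[OF h] f] homology_map_eq[OF h f] by auto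
qed

text \<open>The functor extracts the only value of \<open>homology_map\<close> on a class. There is
  only one because induced maps add and a null-homotopic difference induces zero.\<close>

lemma amap_homology:
  assumes h: "is_homology_choice C h" and f: "f \<in> diagram_arrows C"
  shows "amap (homology C h) (Adel_class C f) = homology_map C h f"
proof -
  have "homology_map C h g = homology_map C h f" if g: "g \<in> Adel_class C f" for g
  proof -
    obtain a0 a1 f0 f1 f2 b0 b1 where fe: "f = ((a0, a1), (f0, f1, f2), (b0, b1))"
      using f by (rule diagram_arrowE)
    note fa = f[unfolded fe]
    obtain g0 g1 g2 where ge: "g = ((a0, a1), (g0, g1, g2), (b0, b1))"
      and ga: "((a0, a1), (g0, g1, g2), (b0, b1)) \<in> diagram_arrows C"
      and n: "((a0, a1), (g0 \<boxplus> neg C f0, g1 \<boxplus> neg C f1, g2 \<boxplus> neg C f2), (b0, b1)) \<in> null_homotopic C"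
      by (rule Adel_class_memberE[OF fa g[unfolded fe]])
    have na: "((a0, a1), (g0 \<boxplus> neg C f0, g1 \<boxplus> neg C f1, g2 \<boxplus> neg C f2), (b0, b1)) \<in> diagram_arrows C"
      using n by (simp add: null_homotopic_iff)
    have AB: "(a0, a1) \<in> diagrams C" "(b0, b1) \<in> diagrams C" using fa by (simp_all add: diagram_arrows_iff diagrams_iff)
    note hA = homology_choiceD[OF h AB(1)] and hB = homology_choiceD[OF h AB(2)]
    note i = homology_map_induced[OF h fa]
    have "induced C (hker h (a0, a1)) (hepi h (a0, a1)) (hcok h (b0, b1)) (hmono h (b0, b1)) g1 (homology_map C h f)"
      using induced_Add[OF hA hB na induced_null_homotopic[OF hA hB n] fa i] i fa ga homologyD[OF hA] homologyD[OF hB]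
      by (simp add: fe diagram_arrows_iff induced_def Hom_iff add_simps)
    thus ?thesis unfolding ge by (rule homology_map_eq[OF h ga])
  qed
  moreover note Adel_class_self[OF f]
  ultimately have "homology_map C h ` Adel_class C f = {homology_map C h f}" by blast
  thus ?thesis by (simp add: homology_def)
qed

end

context additive_functor
begin

lemma dia_map_diagrams: "A \<in> diagrams C \<Longrightarrow> dia_map F A \<in> diagrams D"
  by (cases A) (simp add: dia_map_def diagrams_iff functor_simps)

lemma dia_arr_map_arrow:
  assumes "f \<in> diagram_arrows C" shows "dia_arr_map F f \<in> diagram_arrows D"
proof (rule diagram_arrowE[OF assms])
  fix a0 a1 f0 f1 f2 b0 b1 assume f: "f = ((a0, a1), (f0, f1, f2), (b0, b1))"
  show ?thesis
    using assms unfolding f dia_arr_map_simp diagram_arrows_iff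
    by (simp add: amap_Arr Dom_amap Cod_amap amap_Comp_Arr[symmetric])
qed

lemma dia_arr_map_null_homotopic:
  assumes "f \<in> null_homotopic C" shows "dia_arr_map F f \<in> null_homotopic D"
proof -
  obtain a0 a1 f0 f1 f2 b0 b1 where f: "f = ((a0, a1), (f0, f1, f2), (b0, b1))" by (cases f) auto
  obtain s t where st: "s \<in> Arr C" "Dom C s = Dom C a1" "Cod C s = Dom C b0" "t \<in> Arr C"
    "Dom C t = Cod C a1" "Cod C t = Dom C b1" "(s \<cdot>\<^bsub>C\<^esub> b0) \<boxplus>\<^bsub>C\<^esub> (a1 \<cdot>\<^bsub>C\<^esub> t) = f1"
    using assms by (auto simp: f null_homotopic_iff)
  have fa: "((a0, a1), (f0, f1, f2), (b0, b1)) \<in> diagram_arrows C" using assms by (simp add: f null_homotopic_iff)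
  have "amap F ((s \<cdot>\<^bsub>C\<^esub> b0) \<boxplus>\<^bsub>C\<^esub> (a1 \<cdot>\<^bsub>C\<^esub> t)) = (amap F s \<cdot>\<^bsub>D\<^esub> amap F b0) \<boxplus>\<^bsub>D\<^esub> (amap F a1 \<cdot>\<^bsub>D\<^esub> amap F t)"
    using st(1-6) fa by (simp add: diagram_arrows_iff additive_functor_simps C.cat_simps)
  thus ?thesis
    unfolding f dia_arr_map_simp
    by (intro null_homotopicI[OF dia_arr_map_arrow[OF fa, unfolded dia_arr_map_simp], of "amap F s" "amap F t"])
      (use st fa in \<open>simp_all add: diagram_arrows_iff functor_simps\<close>)
qed

text \<open>An additive functor carries the two parts of a homotopy to a homotopy. All
  representatives thus have images in one class, and the union in the definition collapses.\<close>

lemma amap_Adel_functor: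
  assumes f: "f \<in> diagram_arrows C"
  shows "amap (Adel_functor D F) (Adel_class C f) = Adel_class D (dia_arr_map F f)"
proof -
  interpret ND: additive_ideal "diagram_category D" "null_homotopic D"
    by (rule D.additive_ideal_null_homotopic)
  have "Adel_class D (dia_arr_map F g) = Adel_class D (dia_arr_map F f)" if g: "g \<in> Adel_class C f" for g
  proof -
    obtain a0 a1 f0 f1 f2 b0 b1 where fe: "f = ((a0, a1), (f0, f1, f2), (b0, b1))"
      using f by (rule diagram_arrowE)
    note fa = f[unfolded fe]
    obtain g0 g1 g2 where ge: "g = ((a0, a1), (g0, g1, g2), (b0, b1))"
      and ga: "((a0, a1), (g0, g1, g2), (b0, b1)) \<in> diagram_arrows C"
      and n: "((a0, a1), (g0 \<boxplus>\<^bsub>C\<^esub> neg C f0, g1 \<boxplus>\<^bsub>C\<^esub> neg C f1, g2 \<boxplus>\<^bsub>C\<^esub> neg C f2), (b0, b1)) \<in> null_homotopic C"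
      by (rule C.Adel_class_memberE[OF fa g[unfolded fe]])
    note Fa = dia_arr_map_arrow[OF fa] dia_arr_map_arrow[OF ga]
    have "dia_arr_map F g \<boxplus>\<^bsub>diagram_category D\<^esub> neg (diagram_category D) (dia_arr_map F f) \<in> null_homotopic D"
      using dia_arr_map_null_homotopic[OF n] fa ga D.neg_diagram[OF Fa(1)[unfolded dia_arr_map_simp]]
      by (simp add: fe ge dia_arr_map_simp diagram_sel diagram_arrows_iff additive_functor_simps C.add_simps)
    hence "ND.congruent (dia_arr_map F g) (dia_arr_map F f)"
      using Fa by (simp add: ND.congruent_def fe ge dia_arr_map_simp diagram_sel)
    thus ?thesis
      using ND.residue_class_eq_iff ND.congruent_def unfolding Adel_class_def by blast
  qed
  moreover note C.Adel_class_self[OF f]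
  ultimately have "(\<Union>g\<in>Adel_class C f. Adel_class D (dia_arr_map F g)) = Adel_class D (dia_arr_map F f)"
    by blast
  thus ?thesis by (simp add: Adel_functor_def)
qed

text \<open>A kernel diagram consists of sums and composites of the given arrows with biproduct
  maps. Its shape is therefore available in \<open>D\<close>, although \<open>F\<close> is not
  assumed to preserve kernels.\<close>

lemma kernel_diagram_dia_arr_map:
  assumes "kernel_diagram C f k" shows "kernel_diagram D (dia_arr_map F f) (dia_arr_map F k)"
  using assms
proof cases
  case (1 a0 a1 f0 f1 f2 b0 b1 S0 i0 j0 p0 q0 S1 i1 j1 p1 q1 S2 i2 j2 p2 q2)
  note B = C.biproductD[OF 1(4)] C.biproductD[OF 1(5)] C.biproductD[OF 1(6)] 1(3)[unfolded diagram_arrows_iff]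
  have "is_biproduct D (Dom D (amap F a0)) (Dom D (amap F b0)) (omap F S0) (amap F i0) (amap F j0) (amap F p0) (amap F q0)"
    "is_biproduct D (Dom D (amap F a1)) (Dom D (amap F b0)) (omap F S1) (amap F i1) (amap F j1) (amap F p1) (amap F q1)"
    "is_biproduct D (Cod D (amap F a1)) (Dom D (amap F b1)) (omap F S2) (amap F i2) (amap F j2) (amap F p2) (amap F q2)"
    using is_biproduct_amap[OF 1(4)] is_biproduct_amap[OF 1(5)] is_biproduct_amap[OF 1(6)] B
    by (simp_all add: functor_simps)
  from kernel_diagram.intros[OF dia_arr_map_arrow[OF 1(3), unfolded dia_arr_map_simp] this]
  show ?thesis
    unfolding 1(1,2) dia_arr_map_simp using B by (simp add: additive_functor_simps C.add_simps)
qed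

end

section \<open>The Adelman category in terms of representatives\<close>

context additive_category
begin

interpretation N: additive_ideal "diagram_category C" "null_homotopic C"
  by (rule additive_ideal_null_homotopic)

lemma Arr_Adel: "f \<in> diagram_arrows C \<Longrightarrow> Adel_class C f \<in> Arr (Adel C)"
  and Dom_Adel: "f \<in> diagram_arrows C \<Longrightarrow> Dom (Adel C) (Adel_class C f) = Dom (diagram_category C) f"
  and Cod_Adel: "f \<in> diagram_arrows C \<Longrightarrow> Cod (Adel C) (Adel_class C f) = Cod (diagram_category C) f"
  unfolding Adel_def Adel_class_def by (simp_all add: N.quotient_simps diagram_sel)

lemma Comp_Adel: "\<lbrakk>f \<in> diagram_arrows C; g \<in> diagram_arrows C;
    Cod (diagram_category C) f = Dom (diagram_category C) g\<rbrakk> \<Longrightarrow>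
    Adel_class C f \<cdot>\<^bsub>Adel C\<^esub> Adel_class C g = Adel_class C (f \<cdot>\<^bsub>diagram_category C\<^esub> g)"
  unfolding Adel_def Adel_class_def by (simp add: N.quotient_simps diagram_sel)

lemma Add_Adel: "\<lbrakk>f \<in> diagram_arrows C; g \<in> diagram_arrows C;
    Dom (diagram_category C) f = Dom (diagram_category C) g;
    Cod (diagram_category C) f = Cod (diagram_category C) g\<rbrakk> \<Longrightarrow>
    Adel_class C f \<boxplus>\<^bsub>Adel C\<^esub> Adel_class C g = Adel_class C (f \<boxplus>\<^bsub>diagram_category C\<^esub> g)"
  unfolding Adel_def Adel_class_def by (simp add: N.quotient_simps diagram_sel)

lemma Obj_Adel: "Obj (Adel C) = diagrams C"
  and Ide_Adel: "Ide (Adel C) A = Adel_class C (Ide (diagram_category C) A)"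
  unfolding Adel_def Adel_class_def by (simp_all add: N.quotient_simps diagram_sel)

lemma Hom_AdelE:
  assumes "x \<in> Hom (Adel C) A B"
  obtains a0 a1 f0 f1 f2 b0 b1 where "A = (a0, a1)" "B = (b0, b1)"
    "x = Adel_class C ((a0, a1), (f0, f1, f2), (b0, b1))"
    "((a0, a1), (f0, f1, f2), (b0, b1)) \<in> diagram_arrows C"
proof -
  obtain f where f: "f \<in> diagram_arrows C" "Dom (diagram_category C) f = A"
    "Cod (diagram_category C) f = B" "x = Adel_class C f"
    using assms unfolding Adel_def Adel_class_def by (auto simp: diagram_sel elim: N.Hom_quotientE)
  obtain a0 a1 f0 f1 f2 b0 b1 where fe: "f = ((a0, a1), (f0, f1, f2), (b0, b1))"
    using f(1) by (rule diagram_arrowE)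
  show ?thesis by (rule that[of a0 a1 b0 b1 f0 f1 f2]) (use f in \<open>simp_all add: fe diagram_sel\<close>)
qed

lemma Arr_AdelE:
  assumes "x \<in> Arr (Adel C)"
  obtains f where "f \<in> diagram_arrows C" "x = Adel_class C f"
  using assms unfolding Adel_def Adel_class_def by (auto simp: diagram_sel elim: N.Arr_quotientE)

end

section \<open>Exactness of the induced functor\<close>

context additive_functor
begin

context
  fixes h
  assumes abelian: "abelian_category D" and choice: "is_homology_choice D h"
begin

interpretation D': abelian_category D by (rule abelian)
interpretation AC: additive_category "Adel C" by (rule C.additive_category_Adel)

lemma omap_hat: "omap (hat D h F) A = Cod D (hepi h (dia_map F A))"
  by (simp add: hat_def functor_comp_def homology_def Adel_functor_def)

lemma amap_hat: "f \<in> diagram_arrows C \<Longrightarrow>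
    amap (hat D h F) (Adel_class C f) = homology_map D h (dia_arr_map F f)"
  using D'.amap_homology[OF choice dia_arr_map_arrow[of f]]
  by (simp add: hat_def functor_comp_def amap_Adel_functor)

lemma homology_dia_map:
  assumes "(a0, a1) \<in> diagrams C"
  shows "is_homology D (amap F a0, amap F a1) (hker h (dia_map F (a0, a1))) (hcok h (dia_map F (a0, a1)))
    (hepi h (dia_map F (a0, a1))) (hmono h (dia_map F (a0, a1)))"
  using D.homology_choiceD[OF choice dia_map_diagrams[OF assms]] by (simp add: dia_map_def)

lemma hat_induced:
  assumes "((a0, a1), (f0, f1, f2), (b0, b1)) \<in> diagram_arrows C"
  shows "induced D (hker h (dia_map F (a0, a1))) (hepi h (dia_map F (a0, a1))) (hcok h (dia_map F (b0, b1)))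
    (hmono h (dia_map F (b0, b1))) (amap F f1)
    (amap (hat D h F) (Adel_class C ((a0, a1), (f0, f1, f2), (b0, b1))))"
  using D'.homology_map_induced[OF choice dia_arr_map_arrow[OF assms, unfolded dia_arr_map_simp]]
  by (simp add: amap_hat[OF assms] dia_arr_map_simp dia_map_def)

text \<open>Each functor law compares two maps induced by the same middle component, and induced
  maps are unique.\<close>

lemma additive_functor_hat: "additive_functor (Adel C) D (hat D h F)"
proof (intro additive_functor.intro category_functor.intro category_functor_axioms.intro
    additive_functor_axioms.intro C.additive_category_Adel D.additive_category_axioms
    D.category_axioms AC.category_axioms)
  let ?H = "hat D h F"
  fix A assume A: "A \<in> Obj (Adel C)"
  obtain a0 a1 where Ae: "A = (a0, a1)" by (cases A)
  have Ad: "(a0, a1) \<in> diagrams C" using A by (simp add: Ae C.Obj_Adel)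
  note a = D.homologyD[OF homology_dia_map[OF Ad]]
  show "omap ?H A \<in> Obj D" unfolding omap_hat using D.Cod_closed[OF a(14)] by (simp add: Ae)
  have i: "((a0, a1), (Ide C (Dom C a0), Ide C (Cod C a0), Ide C (Cod C a1)), (a0, a1)) \<in> diagram_arrows C"
    by (rule C.diagram_Ide[OF Ad])
  show "amap ?H (Ide (Adel C) A) = Ide D (omap ?H A)"
    using D.induced_unique[OF homology_dia_map[OF Ad] homology_dia_map[OF Ad] hat_induced[OF i]]
      D.induced_Ide[OF homology_dia_map[OF Ad]] Ad
    by (simp add: C.Ide_Adel Ae diagram_sel omap_hat diagrams_iff functor_simps C.cat_simps)
next
  let ?H = "hat D h F"
  fix x A B assume x: "x \<in> Hom (Adel C) A B"
  then obtain a0 a1 f0 f1 f2 b0 b1 where xe: "A = (a0, a1)" "B = (b0, b1)"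
    "x = Adel_class C ((a0, a1), (f0, f1, f2), (b0, b1))"
    and f: "((a0, a1), (f0, f1, f2), (b0, b1)) \<in> diagram_arrows C" by (rule C.Hom_AdelE)
  have A: "(a0, a1) \<in> diagrams C" and B: "(b0, b1) \<in> diagrams C"
    using f by (simp_all add: diagram_arrows_iff diagrams_iff)
  show "amap ?H x \<in> Hom D (omap ?H A) (omap ?H B)"
    using hat_induced[OF f] D.homologyD(16)[OF homology_dia_map[OF B]] by (simp add: induced_def omap_hat xe)
  {
    fix y E assume y: "y \<in> Hom (Adel C) B E"
    then obtain g0 g1 g2 d0 d1 where ye: "E = (d0, d1)" "y = Adel_class C ((b0, b1), (g0, g1, g2), (d0, d1))"
      and g: "((b0, b1), (g0, g1, g2), (d0, d1)) \<in> diagram_arrows C" by (rule C.Hom_AdelE) (simp add: xe(2))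
    have E: "(d0, d1) \<in> diagrams C" using g by (simp_all add: diagram_arrows_iff diagrams_iff)
    have fg: "((a0, a1), (f0 \<cdot>\<^bsub>C\<^esub> g0, f1 \<cdot>\<^bsub>C\<^esub> g1, f2 \<cdot>\<^bsub>C\<^esub> g2), (d0, d1)) \<in> diagram_arrows C"
      by (rule C.diagram_Comp[OF f g])
    have "x \<cdot>\<^bsub>Adel C\<^esub> y = Adel_class C ((a0, a1), (f0 \<cdot>\<^bsub>C\<^esub> g0, f1 \<cdot>\<^bsub>C\<^esub> g1, f2 \<cdot>\<^bsub>C\<^esub> g2), (d0, d1))"
      using f g by (simp add: xe ye C.Comp_Adel diagram_sel)
    moreover have "amap F (f1 \<cdot>\<^bsub>C\<^esub> g1) = amap F f1 \<cdot>\<^bsub>D\<^esub> amap F g1"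
      using f g by (simp add: diagram_arrows_iff amap_Comp_Arr)
    moreover note D.induced_Comp[OF homology_dia_map[OF A] homology_dia_map[OF B] homology_dia_map[OF E]
        dia_arr_map_arrow[OF f, unfolded dia_arr_map_simp] hat_induced[OF f]
        dia_arr_map_arrow[OF g, unfolded dia_arr_map_simp] hat_induced[OF g]]
    ultimately show "amap ?H (x \<cdot>\<^bsub>Adel C\<^esub> y) = amap ?H x \<cdot>\<^bsub>D\<^esub> amap ?H y"
      using hat_induced[OF fg] by (simp add: D.induced_unique[OF homology_dia_map[OF A] homology_dia_map[OF E]] xe ye)
  }
  {
    fix y assume y: "y \<in> Hom (Adel C) A B"
    then obtain g0 g1 g2 where ye: "y = Adel_class C ((a0, a1), (g0, g1, g2), (b0, b1))"
      and g: "((a0, a1), (g0, g1, g2), (b0, b1)) \<in> diagram_arrows C" by (rule C.Hom_AdelE) (simp add: xe(1,2))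
    have fg: "((a0, a1), (f0 \<boxplus>\<^bsub>C\<^esub> g0, f1 \<boxplus>\<^bsub>C\<^esub> g1, f2 \<boxplus>\<^bsub>C\<^esub> g2), (b0, b1)) \<in> diagram_arrows C"
      by (rule C.diagram_Add[OF f g])
    have "x \<boxplus>\<^bsub>Adel C\<^esub> y = Adel_class C ((a0, a1), (f0 \<boxplus>\<^bsub>C\<^esub> g0, f1 \<boxplus>\<^bsub>C\<^esub> g1, f2 \<boxplus>\<^bsub>C\<^esub> g2), (b0, b1))"
      using f g by (simp add: xe ye C.Add_Adel diagram_sel)
    moreover have "amap F (f1 \<boxplus>\<^bsub>C\<^esub> g1) = amap F f1 \<boxplus>\<^bsub>D\<^esub> amap F g1"
      using f g by (simp add: diagram_arrows_iff amap_Add_Arr)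
    moreover note D.induced_Add[OF homology_dia_map[OF A] homology_dia_map[OF B]
        dia_arr_map_arrow[OF f, unfolded dia_arr_map_simp] hat_induced[OF f]
        dia_arr_map_arrow[OF g, unfolded dia_arr_map_simp] hat_induced[OF g]]
    ultimately show "amap ?H (x \<boxplus>\<^bsub>Adel C\<^esub> y) = amap ?H x \<boxplus>\<^bsub>D\<^esub> amap ?H y"
      using hat_induced[OF fg] by (simp add: D.induced_unique[OF homology_dia_map[OF A] homology_dia_map[OF B]] xe ye)
  }
qed

text \<open>For cokernels the argument for kernels is repeated over \<open>opp C\<close> and
  \<open>opp D\<close>: \<open>F\<close> serves unchanged between the opposites, and an induced map
  is also the one induced by the reversed diagrams.\<close>

theorem exact_functor_hat: "exact_functor (Adel C) D (hat D h F)"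
proof (rule additive_functor.exact_functorI[OF additive_functor_hat])
  let ?H = "hat D h F"
  fix x assume "x \<in> Arr (Adel C)"
  then obtain f where f: "f \<in> diagram_arrows C" "x = Adel_class C f" by (rule C.Arr_AdelE)
  obtain a0 a1 f0 f1 f2 b0 b1 where fe: "f = ((a0, a1), (f0, f1, f2), (b0, b1))"
    using f(1) by (rule diagram_arrowE)
  note fa = f(1)[unfolded fe]
  have A: "(a0, a1) \<in> diagrams C" and B: "(b0, b1) \<in> diagrams C"
    using fa by (simp_all add: diagram_arrows_iff diagrams_iff)
  show "\<exists>k. is_kernel (Adel C) x k \<and> is_kernel D (amap ?H x) (amap ?H k)"
  proof -
    obtain k where k: "kernel_diagram C f k" using C.kernel_diagram_exists[OF f(1)] by blast
    have ka: "k \<in> diagram_arrows C" by (rule C.kernel_diagram_arrow[OF k])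
    have "Cod (diagram_category C) k = (a0, a1)"
      using C.kernel_mod_kernel_diagram[OF k] by (simp add: kernel_mod_def fe diagram_sel)
    then obtain d0 d1 k0 k1 k2 where ke: "k = ((d0, d1), (k0, k1, k2), (a0, a1))"
      by (cases k) (auto simp: diagram_sel)
    note ka' = ka[unfolded ke]
    have E: "(d0, d1) \<in> diagrams C" using ka' by (simp_all add: diagram_arrows_iff diagrams_iff)
    have "is_kernel D (amap ?H x) (amap ?H (Adel_class C k))"
      using D'.is_kernel_induced[OF kernel_diagram_dia_arr_map[OF k, unfolded ke fe dia_arr_map_simp]
        homology_dia_map[OF A] homology_dia_map[OF B] homology_dia_map[OF E] hat_induced[OF ka'] hat_induced[OF fa]]
      by (simp add: f fe ke)
    thus ?thesis using C.is_kernel_AdelI[OF C.kernel_mod_kernel_diagram[OF k]] f(2) by blast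
  qed
  show "\<exists>c. is_cokernel (Adel C) x c \<and> is_cokernel D (amap ?H x) (amap ?H c)"
  proof -
    interpret oC: additive_category "opp C" by (rule C.additive_category_opp)
    interpret oD: abelian_category "opp D" by (rule D'.abelian_category_opp)
    have "dual f \<in> diagram_arrows (opp C)" using f by simp
    then obtain k where k: "kernel_diagram (opp C) (dual f) k" using oC.kernel_diagram_exists by blast
    have ka: "k \<in> diagram_arrows (opp C)" by (rule oC.kernel_diagram_arrow[OF k])
    have "Cod (diagram_category (opp C)) k = (b1, b0)"
      using oC.kernel_mod_kernel_diagram[OF k] by (simp add: kernel_mod_def fe diagram_sel)
    \<comment> \<open>The components are named in reverse so that reversing \<open>k\<close> gives
      an arrow \<open>c\<close> from \<open>(b0, b1)\<close> in the usual order.\<close>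
    then obtain d0 d1 k0 k1 k2 where ke: "k = ((d1, d0), (k2, k1, k0), (b1, b0))"
      by (cases k) (auto simp: diagram_sel)
    define c where "c = ((b0, b1), (k0, k1, k2), (d0, d1))"
    have kc: "k = dual c" by (simp add: ke c_def)
    have ca: "((b0, b1), (k0, k1, k2), (d0, d1)) \<in> diagram_arrows C" using ka by (simp add: kc c_def[symmetric])
    have E: "(d0, d1) \<in> diagrams C" using ca by (simp_all add: diagram_arrows_iff diagrams_iff)
    have swap: "is_homology (opp D) (amap F a1, amap F a0) (hcok h (dia_map F (a0, a1))) (hker h (dia_map F (a0, a1)))
      (hmono h (dia_map F (a0, a1))) (hepi h (dia_map F (a0, a1)))" if "(a0, a1) \<in> diagrams C" for a0 a1
      using homology_dia_map[OF that] is_homology_opp[of D "(amap F a0, amap F a1)"] by simp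
    have "kernel_diagram (opp D) (dia_arr_map F (dual f)) (dia_arr_map F k)"
      by (rule additive_functor.kernel_diagram_dia_arr_map[OF additive_functor_opp k])
    note kd = this[unfolded ke fe dual_simp dia_arr_map_simp]
    note indf = D.induced_opp[OF homology_dia_map[OF A] homology_dia_map[OF B]
        dia_arr_map_arrow[OF fa, unfolded dia_arr_map_simp] hat_induced[OF fa]]
    note indc = D.induced_opp[OF homology_dia_map[OF B] homology_dia_map[OF E]
        dia_arr_map_arrow[OF ca, unfolded dia_arr_map_simp] hat_induced[OF ca]]
    have "is_kernel (opp D) (amap ?H x) (amap ?H (Adel_class C c))"
      using oD.is_kernel_induced[OF kd swap[OF B] swap[OF A] swap[OF E] indc indf] by (simp add: f fe c_def)
    moreover have "is_cokernel (Adel C) (Adel_class C f) (Adel_class C c)"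
      by (rule C.is_cokernel_AdelI) (use oC.kernel_mod_kernel_diagram[OF k] in \<open>simp add: kc\<close>)
    ultimately show ?thesis using f(2) by auto
  qed
qed

text \<open>Both outer objects of the image of \<open>I(X)\<close> are zero objects, so the
  normalisation clauses of the choice apply. They make the extension restrict to \<open>F\<close>
  itself and not merely to an isomorphic functor.\<close>

lemma choice_incl:
  assumes X: "X \<in> Obj C"
  shows "hker h (dia_map F (Adel_incl_ob C X)) = Ide D (omap F X)"
    "hcok h (dia_map F (Adel_incl_ob C X)) = Ide D (omap F X)"
    "hepi h (dia_map F (Adel_incl_ob C X)) = Ide D (omap F X)"
    "hmono h (dia_map F (Adel_incl_ob C X)) = Ide D (omap F X)"
proof -
  let ?A = "dia_map F (Adel_incl_ob C X)"
  have z: "is_zero_object D (omap F (Zob C))" by (rule omap_zero_object[OF C.zero_object_Zob])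
  have "Adel_incl_ob C X \<in> diagrams C" using X by (simp add: Adel_incl_ob_def diagrams_iff C.add_simps)
  hence A: "?A \<in> diagrams D" by (rule dia_map_diagrams)
  have "ob0 D ?A = omap F (Zob C)" "ob1 D ?A = omap F X" "ob2 D ?A = omap F (Zob C)"
    using X by (simp_all add: dia_map_def Adel_incl_ob_def ob0_def ob1_def ob2_def functor_simps C.add_simps)
  thus "hker h ?A = Ide D (omap F X)" "hcok h ?A = Ide D (omap F X)" "hepi h ?A = Ide D (omap F X)"
    "hmono h ?A = Ide D (omap F X)"
    using choice A z unfolding is_homology_choice_def by auto
qed

theorem hat_Adel_incl: "functor_eq C (hat D h F \<circ>\<^sub>F Adel_incl C) F"
  unfolding functor_eq_def
proof (intro conjI ballI)
  fix X assume X: "X \<in> Obj C"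
  thus "omap (hat D h F \<circ>\<^sub>F Adel_incl C) X = omap F X"
    by (simp add: functor_comp_def omap_hat Adel_incl_def choice_incl functor_simps D.cat_simps)
next
  fix f assume f: "f \<in> Arr C"
  let ?n = "Zer C (Zob C) (Zob C)"
  let ?f = "(Adel_incl_ob C (Dom C f), (?n, f, ?n), Adel_incl_ob C (Cod C f))"
  let ?u = "amap (hat D h F) (Adel_class C ?f)"
  have "?f \<in> diagram_arrows C"
    using f by (simp add: Adel_incl_ob_def diagram_arrows_iff C.add_simps)
  note i = hat_induced[OF this[unfolded Adel_incl_ob_def], folded Adel_incl_ob_def]
  have u: "?u \<in> Arr D" "Dom D ?u = omap F (Dom C f)" "Cod D ?u = omap F (Cod C f)"
    using i f by (simp_all add: choice_incl C.cat_simps induced_def Hom_iff functor_simps D.cat_simps)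
  have "Ide D (omap F (Dom C f)) \<cdot>\<^bsub>D\<^esub> (?u \<cdot>\<^bsub>D\<^esub> Ide D (omap F (Cod C f))) = amap F f"
    using i f by (simp add: choice_incl C.cat_simps induced_def functor_simps D.cat_simps)
  hence "?u = amap F f" using u by (simp add: D.cat_simps)
  thus "amap (hat D h F \<circ>\<^sub>F Adel_incl C) f = amap F f"
    by (simp add: functor_comp_def Adel_incl_def)
qed

end

end

section \<open>Every object of the Adelman category is a homology object\<close>

definition incl_arrow :: "('o, 'm, 'z) add_category_scheme \<Rightarrow> 'm \<Rightarrow> 'm dia_arr" where
  "incl_arrow C f = (Adel_incl_ob C (Dom C f), (Zer C (Zob C) (Zob C), f, Zer C (Zob C) (Zob C)),
     Adel_incl_ob C (Cod C f))"

text \<open>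
  In the Adelman category, \<open>(0 \<rightarrow> A\<^sub>1 \<rightarrow> A\<^sub>2)\<close> is a kernel of \<open>I(a\<^sub>1)\<close>, \<open>(A\<^sub>0 \<rightarrow> A\<^sub>1 \<rightarrow> 0)\<close> is a cokernel
  of \<open>I(a\<^sub>0)\<close>, and \<open>A\<close> is the image of the composite of the two.
\<close>

definition ker_arrow :: "('o, 'm, 'z) add_category_scheme \<Rightarrow> 'm \<Rightarrow> 'm dia_arr" where
  "ker_arrow C a = ((Zer C (Zob C) (Dom C a), a),
     (Zer C (Zob C) (Zob C), Ide C (Dom C a), Zer C (Cod C a) (Zob C)), Adel_incl_ob C (Dom C a))"

text \<open>Defined by duality, so that its cokernel property is the kernel property of
  \<open>ker_arrow\<close> over the opposite category.\<close>

definition cok_arrow :: "('o, 'm, 'z) add_category_scheme \<Rightarrow> 'm \<Rightarrow> 'm dia_arr" where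
  "cok_arrow C a = dual (ker_arrow (opp C) a)"

definition epi_arrow :: "('o, 'm, 'z) add_category_scheme \<Rightarrow> 'm dia \<Rightarrow> 'm dia_arr" where
  "epi_arrow C = (\<lambda>(a0, a1). ((Zer C (Zob C) (Dom C a1), a1),
     (Zer C (Zob C) (Dom C a0), Ide C (Dom C a1), Ide C (Cod C a1)), (a0, a1)))"

definition mono_arrow :: "('o, 'm, 'z) add_category_scheme \<Rightarrow> 'm dia \<Rightarrow> 'm dia_arr" where
  "mono_arrow C = (\<lambda>(a0, a1). ((a0, a1),
     (Ide C (Dom C a0), Ide C (Dom C a1), Zer C (Cod C a1) (Zob C)), (a0, Zer C (Dom C a1) (Zob C))))"

lemma dual_incl_arrow: "dual (incl_arrow C f) = incl_arrow (opp C) f"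
  by (simp add: incl_arrow_def Adel_incl_ob_def)

lemma cok_arrow_eq:
  "cok_arrow C a = (Adel_incl_ob C (Cod C a), (Zer C (Zob C) (Dom C a), Ide C (Cod C a), Zer C (Zob C) (Zob C)),
     (a, Zer C (Cod C a) (Zob C)))"
  by (simp add: cok_arrow_def ker_arrow_def Adel_incl_ob_def)

lemma amap_Adel_incl: "amap (Adel_incl C) f = Adel_class C (incl_arrow C f)"
  by (simp add: Adel_incl_def incl_arrow_def)

context additive_category
begin

lemma incl_arrow_in: "f \<in> Arr C \<Longrightarrow> incl_arrow C f \<in> diagram_arrows C"
  by (simp add: incl_arrow_def Adel_incl_ob_def diagram_arrows_iff add_simps)

lemma ker_arrow_in: "a \<in> Arr C \<Longrightarrow> ker_arrow C a \<in> diagram_arrows C"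
  by (simp add: ker_arrow_def Adel_incl_ob_def diagram_arrows_iff add_simps)

lemma cok_arrow_in: "a \<in> Arr C \<Longrightarrow> cok_arrow C a \<in> diagram_arrows C"
  by (simp add: cok_arrow_eq Adel_incl_ob_def diagram_arrows_iff add_simps)

lemma epi_arrow_in: "A \<in> diagrams C \<Longrightarrow> epi_arrow C A \<in> diagram_arrows C"
  by (cases A) (simp add: epi_arrow_def diagram_arrows_iff diagrams_iff add_simps)

lemma mono_arrow_in: "A \<in> diagrams C \<Longrightarrow> mono_arrow C A \<in> diagram_arrows C"
  by (cases A) (simp add: mono_arrow_def diagram_arrows_iff diagrams_iff add_simps)

text \<open>The kernel built from biproducts would give this one only up to isomorphism; here the
  middle component is an identity. In a null-homotopy of \<open>t I(a)\<close> the part through the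
  zero object vanishes, which leaves \<open>t1 a = x1 r\<close>, and \<open>r\<close> completes
  \<open>t1\<close> to a lift.\<close>

lemma kernel_mod_ker_arrow:
  assumes a: "a \<in> Arr C"
  shows "kernel_mod (diagram_category C) (null_homotopic C) (incl_arrow C a) (ker_arrow C a)"
  unfolding kernel_mod_def
proof (intro conjI ballI impI; (elim conjE)?)
  let ?D = "diagram_category C"
  let ?K = "(Zer C (Zob C) (Dom C a), a)"
  let ?n = "Zer C (Zob C) (Zob C)"
  let ?I = "\<lambda>X. (Zer C (Zob C) X, Zer C X (Zob C))"
  have k: "ker_arrow C a = (?K, (?n, Ide C (Dom C a), Zer C (Cod C a) (Zob C)), ?I (Dom C a))"
    by (simp add: ker_arrow_def Adel_incl_ob_def)
  have i: "incl_arrow C a = (?I (Dom C a), (?n, a, ?n), ?I (Cod C a))"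
    by (simp add: incl_arrow_def Adel_incl_ob_def)
  note ka = ker_arrow_in[OF a, unfolded k] and ia = incl_arrow_in[OF a, unfolded i]
  show "incl_arrow C a \<in> Arr ?D" "ker_arrow C a \<in> Arr ?D" using a by (simp_all add: diagram_sel incl_arrow_in ker_arrow_in)
  show "Cod ?D (ker_arrow C a) = Dom ?D (incl_arrow C a)" by (simp add: k i diagram_sel)
  show "ker_arrow C a \<cdot>\<^bsub>?D\<^esub> incl_arrow C a \<in> null_homotopic C"
    unfolding k i diagram_sel
    by (rule null_homotopicI[OF diagram_Comp[OF ka ia], of "Zer C (Dom C a) (Zob C)" "Ide C (Cod C a)"])
      (use a in \<open>simp_all add: add_simps\<close>)
  {
    fix t assume t: "t \<in> Arr ?D" "Cod ?D t = Dom ?D (incl_arrow C a)" "t \<cdot>\<^bsub>?D\<^esub> incl_arrow C a \<in> null_homotopic C"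
    then obtain x0 x1 t0 t1 t2 where te: "t = ((x0, x1), (t0, t1, t2), ?I (Dom C a))"
      by (cases t) (auto simp: i diagram_sel)
    have ta: "((x0, x1), (t0, t1, t2), ?I (Dom C a)) \<in> diagram_arrows C" using t(1) by (simp add: te diagram_sel)
    note T = ta[unfolded diagram_arrows_iff]
    obtain s r where s: "s \<in> Arr C" "Dom C s = Dom C x1" "Cod C s = Zob C" and
      r: "r \<in> Arr C" "Dom C r = Cod C x1" "Cod C r = Cod C a" and
      sr: "s \<cdot> Zer C (Zob C) (Cod C a) \<boxplus> x1 \<cdot> r = t1 \<cdot> a"
      using t(3) a by (auto simp: te i diagram_sel null_homotopic_iff add_simps)
    have e: "x1 \<cdot> r = t1 \<cdot> a" using sr s r T a by (simp add: add_simps)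
    let ?u = "((x0, x1), (Zer C (Dom C x0) (Zob C), t1, r), ?K)"
    have ua: "?u \<in> diagram_arrows C" using T s r a e by (simp add: diagram_arrows_iff add_simps)
    have uk: "?u \<cdot>\<^bsub>?D\<^esub> ker_arrow C a \<in> diagram_arrows C"
      unfolding k diagram_sel by (rule diagram_Comp[OF ua ka])
    \<comment> \<open>It is enough to see that the middle component of the difference is
      zero.\<close>
    have "(?u \<cdot>\<^bsub>?D\<^esub> ker_arrow C a) \<boxplus>\<^bsub>?D\<^esub> neg ?D t =
        ((x0, x1), (Zer C (Dom C x0) (Zob C) \<cdot> ?n \<boxplus> neg C t0, Zer C (Dom C x1) (Dom C (Zer C (Dom C a) (Zob C))),
          r \<cdot> Zer C (Cod C a) (Zob C) \<boxplus> neg C t2), ?I (Dom C a))"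
      unfolding te neg_diagram[OF ta] k diagram_sel using T a by (simp add: add_simps)
    moreover have "(?u \<cdot>\<^bsub>?D\<^esub> ker_arrow C a) \<boxplus>\<^bsub>?D\<^esub> neg ?D t \<in> diagram_arrows C"
      unfolding te neg_diagram[OF ta] k diagram_sel
      by (rule diagram_Add[OF uk[unfolded k diagram_sel] diagram_neg[OF ta]])
    ultimately have "(?u \<cdot>\<^bsub>?D\<^esub> ker_arrow C a) \<boxplus>\<^bsub>?D\<^esub> neg ?D t \<in> null_homotopic C"
      using null_homotopic_Zer_middle by metis
    thus "\<exists>u\<in>Arr ?D. Dom ?D u = Dom ?D t \<and> Cod ?D u = Dom ?D (ker_arrow C a) \<and>
        (u \<cdot>\<^bsub>?D\<^esub> ker_arrow C a) \<boxplus>\<^bsub>?D\<^esub> neg ?D t \<in> null_homotopic C"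
      using ua by (intro bexI[of _ ?u]) (simp_all add: diagram_sel te k)
  }
  fix u assume u: "u \<in> Arr ?D" "Cod ?D u = Dom ?D (ker_arrow C a)" "u \<cdot>\<^bsub>?D\<^esub> ker_arrow C a \<in> null_homotopic C"
  then obtain x0 x1 u0 u1 u2 where ue: "u = ((x0, x1), (u0, u1, u2), ?K)"
    by (cases u) (auto simp: k diagram_sel)
  have ua: "((x0, x1), (u0, u1, u2), ?K) \<in> diagram_arrows C" using u(1) by (simp add: ue diagram_sel)
  \<comment> \<open>Composition with \<open>ker_arrow\<close> leaves the middle component and the
    first arrow of the target unchanged, so a null-homotopy of the composite is one of
    \<open>u\<close>, with the same two parts.\<close>
  obtain s r where "s \<in> Arr C" "Dom C s = Dom C x1" "Cod C s = Zob C"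
    "r \<in> Arr C" "Dom C r = Cod C x1" "Cod C r = Dom C a"
    "s \<cdot> Zer C (Zob C) (Dom C a) \<boxplus> x1 \<cdot> r = u1 \<cdot> Ide C (Dom C a)"
    using u(3) a by (auto simp: ue k diagram_sel null_homotopic_iff add_simps)
  thus "u \<in> null_homotopic C"
    unfolding ue using ua a by (intro null_homotopicI[OF ua, of s r]) (simp_all add: diagram_arrows_iff add_simps)
qed

lemma is_kernel_ker_arrow: "a \<in> Arr C \<Longrightarrow>
    is_kernel (Adel C) (amap (Adel_incl C) a) (Adel_class C (ker_arrow C a))"
  unfolding amap_Adel_incl by (rule is_kernel_AdelI[OF kernel_mod_ker_arrow])

lemma is_cokernel_cok_arrow: "a \<in> Arr C \<Longrightarrow>
    is_cokernel (Adel C) (amap (Adel_incl C) a) (Adel_class C (cok_arrow C a))"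
  unfolding amap_Adel_incl
  using additive_category.kernel_mod_ker_arrow[OF additive_category_opp, of a]
  by (intro is_cokernel_AdelI) (simp add: dual_incl_arrow cok_arrow_def)

text \<open>The middle component is an identity and the second arrows of the two diagrams agree, so
  a null-homotopy of the composite with \<open>u\<close> is already one of \<open>u\<close>. For
  \<open>mono_arrow\<close> the same holds with the first arrows.\<close>

lemma epi_epi_arrow:
  assumes "A \<in> diagrams C" shows "is_epi (Adel C) (Adel_class C (epi_arrow C A))"
proof (rule epi_AdelI[OF epi_arrow_in[OF assms]])
  let ?D = "diagram_category C"
  obtain a0 a1 where A: "A = (a0, a1)" by (cases A)
  fix u assume u: "u \<in> diagram_arrows C" "Dom ?D u = Cod ?D (epi_arrow C A)"
    "epi_arrow C A \<cdot>\<^bsub>?D\<^esub> u \<in> null_homotopic C"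
  then obtain u0 u1 u2 b0 b1 where ue: "u = ((a0, a1), (u0, u1, u2), (b0, b1))"
    by (cases u) (auto simp: A epi_arrow_def diagram_sel)
  note ua = u(1)[unfolded ue]
  obtain s t where "s \<in> Arr C" "Dom C s = Dom C a1" "Cod C s = Dom C b0"
    "t \<in> Arr C" "Dom C t = Cod C a1" "Cod C t = Dom C b1" "s \<cdot> b0 \<boxplus> a1 \<cdot> t = Ide C (Dom C a1) \<cdot> u1"
    using u(3) by (auto simp: A ue epi_arrow_def diagram_sel null_homotopic_iff)
  thus "u \<in> null_homotopic C"
    unfolding ue using ua by (intro null_homotopicI[OF ua, of s t]) (simp_all add: diagram_arrows_iff add_simps)
qed

lemma mono_mono_arrow:
  assumes "A \<in> diagrams C" shows "is_mono (Adel C) (Adel_class C (mono_arrow C A))"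
proof (rule mono_AdelI[OF mono_arrow_in[OF assms]])
  let ?D = "diagram_category C"
  obtain a0 a1 where A: "A = (a0, a1)" by (cases A)
  fix u assume u: "u \<in> diagram_arrows C" "Cod ?D u = Dom ?D (mono_arrow C A)"
    "u \<cdot>\<^bsub>?D\<^esub> mono_arrow C A \<in> null_homotopic C"
  then obtain u0 u1 u2 b0 b1 where ue: "u = ((b0, b1), (u0, u1, u2), (a0, a1))"
    by (cases u) (auto simp: A mono_arrow_def diagram_sel)
  note ua = u(1)[unfolded ue]
  have a1: "Dom C (Zer C (Dom C a1) (Zob C)) = Dom C a1" using ua by (simp add: diagram_arrows_iff add_simps)
  obtain s t where "s \<in> Arr C" "Dom C s = Dom C b1" "Cod C s = Dom C a0"
    "t \<in> Arr C" "Dom C t = Cod C b1" "Cod C t = Dom C a1" "s \<cdot> a0 \<boxplus> b1 \<cdot> t = u1 \<cdot> Ide C (Dom C a1)"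
    using u(3) a1 by (auto simp: A ue mono_arrow_def diagram_sel null_homotopic_iff)
  thus "u \<in> null_homotopic C"
    unfolding ue using ua by (intro null_homotopicI[OF ua, of s t]) (simp_all add: diagram_arrows_iff add_simps)
qed

lemma Dom_epi_arrow: "(a0, a1) \<in> diagrams C \<Longrightarrow> Dom (diagram_category C) (epi_arrow C (a0, a1)) = Dom (diagram_category C) (ker_arrow C a1)"
  and Cod_epi_arrow: "Cod (diagram_category C) (epi_arrow C A) = A"
  and Dom_mono_arrow: "Dom (diagram_category C) (mono_arrow C A) = A"
  and Cod_mono_arrow: "(a0, a1) \<in> diagrams C \<Longrightarrow> Cod (diagram_category C) (mono_arrow C (a0, a1)) = Cod (diagram_category C) (cok_arrow C a0)"
  and Cod_ker_arrow: "Cod (diagram_category C) (ker_arrow C a) = Adel_incl_ob C (Dom C a)"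
  and Dom_cok_arrow: "Dom (diagram_category C) (cok_arrow C a) = Adel_incl_ob C (Cod C a)"
  and Dom_incl_arrow: "Dom (diagram_category C) (incl_arrow C a) = Adel_incl_ob C (Dom C a)"
  and Cod_incl_arrow: "Cod (diagram_category C) (incl_arrow C a) = Adel_incl_ob C (Cod C a)"
  by (cases A; simp add: ker_arrow_def cok_arrow_eq epi_arrow_def mono_arrow_def incl_arrow_def diagram_sel diagrams_iff)+

text \<open>Exhibits an arbitrary arrow as the map induced on homology by the inclusion of its
  middle component. The equation is strict, since the auxiliary arrows have only identities and zero
  morphisms as components.\<close>

lemma arrow_through_incl:
  assumes f: "((a0, a1), (f0, f1, f2), (b0, b1)) \<in> diagram_arrows C"
  shows "epi_arrow C (a0, a1) \<cdot>\<^bsub>diagram_category C\<^esub> (((a0, a1), (f0, f1, f2), (b0, b1)) \<cdot>\<^bsub>diagram_category C\<^esub> mono_arrow C (b0, b1)) =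
    ker_arrow C a1 \<cdot>\<^bsub>diagram_category C\<^esub> (incl_arrow C f1 \<cdot>\<^bsub>diagram_category C\<^esub> cok_arrow C b0)"
  using f by (simp add: epi_arrow_def mono_arrow_def ker_arrow_def cok_arrow_eq incl_arrow_def diagram_sel
      diagram_arrows_iff add_simps)

lemma Adel_incl_ob_diagrams: "X \<in> Obj C \<Longrightarrow> Adel_incl_ob C X \<in> diagrams C"
  by (simp add: Adel_incl_ob_def diagrams_iff add_simps)

lemma Ide_Zob: "Ide C (Zob C) = Zer C (Zob C) (Zob C)"
  by (rule zero_object_unique[OF zero_object_Zob]) (simp_all add: add_simps)

lemma category_functor_Adel_incl: "category_functor C (Adel C) (Adel_incl C)"
proof (intro category_functor.intro category_functor_axioms.intro category_axioms
    additive_category.axioms(1)[OF additive_category_Adel])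
  fix X assume X: "X \<in> Obj C"
  show "omap (Adel_incl C) X \<in> Obj (Adel C)" using X by (simp add: Adel_incl_def Obj_Adel Adel_incl_ob_diagrams)
  show "amap (Adel_incl C) (Ide C X) = Ide (Adel C) (omap (Adel_incl C) X)"
    using X by (simp add: Adel_incl_def Ide_Adel Adel_incl_ob_def diagram_sel add_simps Ide_Zob)
next
  fix f X Y assume f: "f \<in> Hom C X Y"
  hence f': "f \<in> Arr C" "Dom C f = X" "Cod C f = Y" by (simp_all add: Hom_iff)
  show "amap (Adel_incl C) f \<in> Hom (Adel C) (omap (Adel_incl C) X) (omap (Adel_incl C) Y)"
    using f' incl_arrow_in[OF f'(1)]
    by (simp add: amap_Adel_incl Hom_iff Arr_Adel Dom_Adel Cod_Adel Dom_incl_arrow Cod_incl_arrow)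
      (simp add: Adel_incl_def)
  fix g Z assume "g \<in> Hom C Y Z"
  hence g': "g \<in> Arr C" "Dom C g = Y" "Cod C g = Z" by (simp_all add: Hom_iff)
  show "amap (Adel_incl C) (f \<cdot> g) = amap (Adel_incl C) f \<cdot>\<^bsub>Adel C\<^esub> amap (Adel_incl C) g"
    using f' g' incl_arrow_in[OF f'(1)] incl_arrow_in[OF g'(1)]
    by (simp add: amap_Adel_incl Comp_Adel Dom_incl_arrow Cod_incl_arrow)
      (simp add: incl_arrow_def diagram_sel add_simps)
qed

end

lemma category_functor_comp:
  assumes "category_functor C D F" "category_functor D E G"
  shows "category_functor C E (G \<circ>\<^sub>F F)"
proof -
  interpret F: category_functor C D F by (rule assms)
  interpret G: category_functor D E G by (rule assms)
  show ?thesis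
    by unfold_locales (simp_all add: functor_comp_def F.omap_closed G.omap_closed F.amap_Ide G.amap_Ide
        G.amap_closed[OF F.amap_closed] F.amap_Comp G.amap_Comp[OF F.amap_closed F.amap_closed])
qed

section \<open>Extension of natural transformations\<close>

text \<open>The inverses of the three components again commute with the arrows of the diagrams and
  so induce a map back; uniqueness of induced maps makes it an inverse.\<close>

lemma (in abelian_category) induced_iso:
  assumes "is_homology C (a0, a1) k c p i" "is_homology C (b0, b1) k' c' p' i'"
    "((a0, a1), (f0, f1, f2), (b0, b1)) \<in> diagram_arrows C" "induced C k p c' i' f1 u"
    "is_iso C f0" "is_iso C f1" "is_iso C f2"
  shows "is_iso C u"
proof -
  note f = assms(3)[unfolded diagram_arrows_iff]
  obtain g0 g1 g2 where g0: "g0 \<in> Arr C" "Dom C g0 = Cod C f0" "Cod C g0 = Dom C f0"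
      "f0 \<cdot> g0 = Ide C (Dom C f0)" "g0 \<cdot> f0 = Ide C (Cod C f0)" and
    g1: "g1 \<in> Arr C" "Dom C g1 = Cod C f1" "Cod C g1 = Dom C f1"
      "f1 \<cdot> g1 = Ide C (Dom C f1)" "g1 \<cdot> f1 = Ide C (Cod C f1)" and
    g2: "g2 \<in> Arr C" "Dom C g2 = Cod C f2" "Cod C g2 = Dom C f2"
      "f2 \<cdot> g2 = Ide C (Dom C f2)" "g2 \<cdot> f2 = Ide C (Cod C f2)"
    using assms(5-7) unfolding is_iso_def Bex_def Hom_iff by blast
  have inverse: "y \<cdot> v = u' \<cdot> x"
    if "x \<cdot> u = w \<cdot> y" "x \<in> Arr C" "y \<in> Arr C" "u \<in> Arr C" "w \<in> Arr C" "v \<in> Arr C" "u' \<in> Arr C"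
      "Cod C x = Dom C u" "Cod C u = Cod C y" "Dom C x = Dom C w" "Cod C w = Dom C y"
      "Dom C v = Cod C u" "Cod C v = Dom C u" "Dom C u' = Cod C w" "Cod C u' = Dom C w"
      "u \<cdot> v = Ide C (Dom C u)" "u' \<cdot> w = Ide C (Cod C w)" for x y u v w u'
  proof -
    have "y \<cdot> v = (u' \<cdot> w) \<cdot> (y \<cdot> v)" unfolding that(17) using that(2-15) by (simp add: cat_simps)
    also have "\<dots> = u' \<cdot> ((w \<cdot> y) \<cdot> v)" using that(2-15) by (simp add: cat_simps)
    also have "\<dots> = u' \<cdot> (x \<cdot> (u \<cdot> v))" unfolding that(1)[symmetric] using that(2-15) by (simp add: cat_simps)
    also have "\<dots> = u' \<cdot> x" unfolding that(16) using that(2-15) by (simp add: cat_simps)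
    finally show ?thesis .
  qed
  have "b0 \<cdot> g1 = g0 \<cdot> a0" by (rule inverse[of a0 f1 f0]) (use f g0 g1 in simp_all)
  moreover have "b1 \<cdot> g2 = g1 \<cdot> a1" by (rule inverse[of a1 f2 f1]) (use f g1 g2 in simp_all)
  ultimately have g: "((b0, b1), (g0, g1, g2), (a0, a1)) \<in> diagram_arrows C"
    using f g0 g1 g2 by (simp add: diagram_arrows_iff)
  obtain v where v: "induced C k' p' c i g1 v" using induced_exists[OF assms(2,1) g] by blast
  note a = homologyD[OF assms(1)] and b = homologyD[OF assms(2)]
  have "u \<cdot> v = Ide C (Cod C p)"
    using induced_unique[OF assms(1,1) _ induced_Ide[OF assms(1)]] induced_Comp[OF assms(1,2,1,3,4) g v] g1(4) f
    by simp
  moreover have "v \<cdot> u = Ide C (Cod C p')"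
    using induced_unique[OF assms(2,2) _ induced_Ide[OF assms(2)]] induced_Comp[OF assms(2,1,2) g v assms(3,4)] g1(5) f
    by simp
  ultimately show ?thesis
    using assms(4) v a b unfolding is_iso_def by (auto simp: induced_def Hom_iff intro!: bexI[of _ v])
qed

section \<open>Exact functors on the Adelman category computed as homology\<close>

locale exact_functor_Adel = base: additive_category C + target: abelian_category D + exact_functor "Adel C" D G
  for C :: "('o, 'm, 'y) add_category_scheme" and D :: "('p, 'n, 'z) add_category_scheme" and G
begin

abbreviation "gk A \<equiv> amap G (Adel_class C (ker_arrow C (snd A)))"
abbreviation "gc A \<equiv> amap G (Adel_class C (cok_arrow C (fst A)))"
abbreviation "gp A \<equiv> amap G (Adel_class C (epi_arrow C A))"
abbreviation "gi A \<equiv> amap G (Adel_class C (mono_arrow C A))"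
abbreviation "gm f \<equiv> amap G (amap (Adel_incl C) f)"

lemmas Adel_simps = base.Arr_Adel base.Dom_Adel base.Cod_Adel base.Comp_Adel base.incl_arrow_in base.ker_arrow_in base.cok_arrow_in
  base.epi_arrow_in base.mono_arrow_in base.Dom_epi_arrow base.Cod_epi_arrow base.Dom_mono_arrow base.Cod_mono_arrow
  base.Cod_ker_arrow base.Dom_cok_arrow base.Dom_incl_arrow base.Cod_incl_arrow

lemma Hom_gm: "f \<in> Arr C \<Longrightarrow> gm f \<in> Arr D"
  "f \<in> Arr C \<Longrightarrow> Dom D (gm f) = omap G (Adel_incl_ob C (Dom C f))"
  "f \<in> Arr C \<Longrightarrow> Cod D (gm f) = omap G (Adel_incl_ob C (Cod C f))"
  by (simp_all add: amap_Adel_incl functor_simps Adel_simps)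

lemma amap_arrow_through_incl:
  assumes f: "((a0, a1), (f0, f1, f2), (b0, b1)) \<in> diagram_arrows C"
  shows "gp (a0, a1) \<cdot>\<^bsub>D\<^esub> (amap G (Adel_class C ((a0, a1), (f0, f1, f2), (b0, b1))) \<cdot>\<^bsub>D\<^esub> gi (b0, b1)) =
    gk (a0, a1) \<cdot>\<^bsub>D\<^esub> (gm f1 \<cdot>\<^bsub>D\<^esub> gc (b0, b1))"
proof -
  let ?D = "diagram_category C"
  let ?f = "((a0, a1), (f0, f1, f2), (b0, b1))"
  have A: "(a0, a1) \<in> diagrams C" "(b0, b1) \<in> diagrams C" using f by (simp_all add: diagram_arrows_iff diagrams_iff)
  have a: "a1 \<in> Arr C" "b0 \<in> Arr C" "f1 \<in> Arr C" "Dom C f1 = Dom C a1" "Cod C f1 = Cod C b0"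
    using f by (simp_all add: diagram_arrows_iff)
  have df: "Dom ?D ?f = (a0, a1)" "Cod ?D ?f = (b0, b1)" by (simp_all add: diagram_sel)
  interpret DC: additive_category ?D by (rule base.additive_category_diagram)
  have m: "?f \<cdot>\<^bsub>?D\<^esub> mono_arrow C (b0, b1) \<in> diagram_arrows C"
    "Dom ?D (?f \<cdot>\<^bsub>?D\<^esub> mono_arrow C (b0, b1)) = (a0, a1)"
    using DC.Comp_Arr[of ?f "mono_arrow C (b0, b1)"] DC.Dom_Comp[of ?f "mono_arrow C (b0, b1)"] f A df
    by (simp_all add: Adel_simps diagram_sel(2))
  have n: "incl_arrow C f1 \<cdot>\<^bsub>?D\<^esub> cok_arrow C b0 \<in> diagram_arrows C"
    "Dom ?D (incl_arrow C f1 \<cdot>\<^bsub>?D\<^esub> cok_arrow C b0) = Adel_incl_ob C (Dom C a1)"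
    using DC.Comp_Arr[of "incl_arrow C f1" "cok_arrow C b0"] DC.Dom_Comp[of "incl_arrow C f1" "cok_arrow C b0"] a
    by (simp_all add: Adel_simps diagram_sel(2))
  have "gp (a0, a1) \<cdot>\<^bsub>D\<^esub> (amap G (Adel_class C ?f) \<cdot>\<^bsub>D\<^esub> gi (b0, b1)) =
      amap G (Adel_class C (epi_arrow C (a0, a1) \<cdot>\<^bsub>?D\<^esub> (?f \<cdot>\<^bsub>?D\<^esub> mono_arrow C (b0, b1))))"
    using f A df m by (simp add: amap_Comp_Arr[symmetric] Adel_simps)
  also have "\<dots> = gk (a0, a1) \<cdot>\<^bsub>D\<^esub> (gm f1 \<cdot>\<^bsub>D\<^esub> gc (b0, b1))"
    unfolding base.arrow_through_incl[OF f] using a n by (simp add: amap_Comp_Arr[symmetric] Adel_simps amap_Adel_incl)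
  finally show ?thesis .
qed

text \<open>\<open>G\<close> preserves the kernel, the cokernel, the epimorphism and the
  monomorphism of the explicit data. The remaining equation \<open>k c = p i\<close> is the formula
  of \<open>amap_arrow_through_incl\<close> for an identity arrow.\<close>

lemma homology_gm:
  assumes A: "(a0, a1) \<in> diagrams C"
  shows "is_homology D (gm a0, gm a1) (gk (a0, a1)) (gc (a0, a1)) (gp (a0, a1)) (gi (a0, a1))"
proof -
  have a: "a0 \<in> Arr C" "a1 \<in> Arr C" "Cod C a0 = Dom C a1" using A by (simp_all add: diagrams_iff)
  have "gk (a0, a1) \<cdot>\<^bsub>D\<^esub> gc (a0, a1) = gp (a0, a1) \<cdot>\<^bsub>D\<^esub> gi (a0, a1)"
    using amap_arrow_through_incl[OF base.diagram_Ide[OF A]] base.Ide_Adel[of "(a0, a1)"] a A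
      amap_Ide[of "(a0, a1)"] category_functor.amap_Ide[OF base.category_functor_Adel_incl, of "Dom C a1"]
      amap_Ide[of "Adel_incl_ob C (Dom C a1)"] base.Adel_incl_ob_diagrams[of "Dom C a1"] base.Dom_closed[of a1]
    by (simp add: diagram_sel Adel_incl_def base.Obj_Adel functor_simps Adel_simps target.cat_simps del: functor_simps(5))
  thus ?thesis
    using a A base.is_kernel_ker_arrow[of a1] base.is_cokernel_cok_arrow[of a0]
    by (simp add: is_homology_def diagrams_iff Hom_gm preserves_kernel preserves_cokernel amap_epi amap_mono
        base.epi_epi_arrow base.mono_mono_arrow amap_Arr Dom_amap Cod_amap Adel_simps)
qed

text \<open>The value of \<open>G\<close> on a morphism is thereby determined by its value on the
  inclusion of the middle component and by the homology data.\<close>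

lemma induced_gm:
  assumes f: "((a0, a1), (f0, f1, f2), (b0, b1)) \<in> diagram_arrows C"
  shows "induced D (gk (a0, a1)) (gp (a0, a1)) (gc (b0, b1)) (gi (b0, b1)) (gm f1)
    (amap G (Adel_class C ((a0, a1), (f0, f1, f2), (b0, b1))))"
proof -
  have "(a0, a1) \<in> diagrams C" "(b0, b1) \<in> diagrams C" using f by (simp_all add: diagram_arrows_iff diagrams_iff)
  thus ?thesis
    using amap_arrow_through_incl[OF f] f by (simp add: induced_def Hom_iff amap_Arr Dom_amap Cod_amap Adel_simps diagram_sel(3,4))
qed

lemma gm_arrow:
  assumes f: "((a0, a1), (f0, f1, f2), (b0, b1)) \<in> diagram_arrows C"
  shows "((gm a0, gm a1), (gm f0, gm f1, gm f2), (gm b0, gm b1)) \<in> diagram_arrows D"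
proof -
  interpret GI: category_functor C D "G \<circ>\<^sub>F Adel_incl C"
    by (rule category_functor_comp[OF base.category_functor_Adel_incl]) (rule category_functor_axioms)
  have c: "gm (x \<cdot>\<^bsub>C\<^esub> y) = gm x \<cdot>\<^bsub>D\<^esub> gm y" if "x \<in> Arr C" "y \<in> Arr C" "Cod C x = Dom C y" for x y
    using GI.amap_Comp_Arr[OF that] by (simp add: functor_comp_def)
  show ?thesis using f unfolding diagram_arrows_iff by (simp add: Hom_gm c[symmetric])
qed

text \<open>For the diagram \<open>I(X)\<close> the four auxiliary arrows coincide with its identity
  arrow. A map induced there is therefore the given middle component itself, which yields a strict
  extension.\<close>

lemma incl_data:
  assumes X: "X \<in> Obj C"
  shows "gk (Adel_incl_ob C X) = Ide D (omap G (Adel_incl_ob C X))"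
    "gc (Adel_incl_ob C X) = Ide D (omap G (Adel_incl_ob C X))"
    "gp (Adel_incl_ob C X) = Ide D (omap G (Adel_incl_ob C X))"
    "gi (Adel_incl_ob C X) = Ide D (omap G (Adel_incl_ob C X))"
proof -
  have i: "Ide D (omap G (Adel_incl_ob C X)) =
      amap G (Adel_class C (Ide (diagram_category C) (Adel_incl_ob C X)))"
    using amap_Ide[of "Adel_incl_ob C X"] base.Adel_incl_ob_diagrams[OF X] by (simp add: base.Obj_Adel base.Ide_Adel)
  show "gk (Adel_incl_ob C X) = Ide D (omap G (Adel_incl_ob C X))"
    "gc (Adel_incl_ob C X) = Ide D (omap G (Adel_incl_ob C X))"
    "gp (Adel_incl_ob C X) = Ide D (omap G (Adel_incl_ob C X))"
    "gi (Adel_incl_ob C X) = Ide D (omap G (Adel_incl_ob C X))"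
    unfolding i using X
    by (simp_all add: Adel_incl_ob_def ker_arrow_def cok_arrow_eq epi_arrow_def mono_arrow_def diagram_sel
        base.add_simps base.Ide_Zob)
qed

end

text \<open>The components of \<sigma> at the three objects of \<open>A\<close> form a morphism of
  diagrams in the target category, and \<tau> at \<open>A\<close> is the map it induces on homology.
  Invertibility and uniqueness are included in the conclusion because they concern this same
  \<tau>.\<close>

theorem Adel_extend_natural_transformation:
  assumes C: "additive_category C" and D: "abelian_category D"
    and G: "exact_functor (Adel C) D G" and G': "exact_functor (Adel C) D G'"
    and \<sigma>: "natural_transformation C D (G \<circ>\<^sub>F Adel_incl C) (G' \<circ>\<^sub>F Adel_incl C) \<sigma>"
  shows "\<exists>\<tau>. natural_transformation (Adel C) D G G' \<tau> \<and> nt_eq C (\<tau> \<star> Adel_incl C) \<sigma> \<and>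
    ((\<forall>X\<in>Obj C. is_iso D (\<sigma> X)) \<longrightarrow> (\<forall>A\<in>Obj (Adel C). is_iso D (\<tau> A))) \<and>
    (\<forall>\<gamma>. natural_transformation (Adel C) D G G' \<gamma> \<and> nt_eq C (\<gamma> \<star> Adel_incl C) \<sigma> \<longrightarrow> nt_eq (Adel C) \<gamma> \<tau>)"
proof -
  interpret C: additive_category C by (rule C)
  interpret D: abelian_category D by (rule D)
  interpret G: exact_functor_Adel C D G by (intro exact_functor_Adel.intro C D G)
  interpret G': exact_functor_Adel C D G' by (intro exact_functor_Adel.intro C D G')
  interpret \<sigma>: natural_transformation C D "G \<circ>\<^sub>F Adel_incl C" "G' \<circ>\<^sub>F Adel_incl C" \<sigma> by (rule \<sigma>)
  have s: "\<sigma> X \<in> Arr D" "Dom D (\<sigma> X) = omap G (Adel_incl_ob C X)" "Cod D (\<sigma> X) = omap G' (Adel_incl_ob C X)"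
    if "X \<in> Obj C" for X
    using \<sigma>.component[OF that] by (simp_all add: Hom_iff functor_comp_def Adel_incl_def)
  have nat: "G.gm f \<cdot>\<^bsub>D\<^esub> \<sigma> (Cod C f) = \<sigma> (Dom C f) \<cdot>\<^bsub>D\<^esub> G'.gm f" if "f \<in> Arr C" for f
    using \<sigma>.naturality[of f "Dom C f" "Cod C f"] that by (simp add: Hom_iff functor_comp_def)
  have sa: "((G.gm a0, G.gm a1), (\<sigma> (Dom C a0), \<sigma> (Dom C a1), \<sigma> (Cod C a1)), (G'.gm a0, G'.gm a1)) \<in> diagram_arrows D"
    if "(a0, a1) \<in> diagrams C" for a0 a1
    using that nat[of a0] nat[of a1]
    by (simp add: diagrams_iff diagram_arrows_iff G.Hom_gm G'.Hom_gm s C.cat_simps)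
  define ind where "ind A u \<longleftrightarrow> induced D (G.gk A) (G.gp A) (G'.gc A) (G'.gi A) (\<sigma> (Dom C (snd A))) u" for A u
  define \<tau> where "\<tau> A = (SOME u. ind A u)" for A
  have \<tau>: "ind A (\<tau> A)" if A: "A \<in> diagrams C" for A
  proof -
    obtain a0 a1 where Ae: "A = (a0, a1)" by (cases A)
    have "\<exists>u. ind A u" unfolding ind_def
      using D.induced_exists[OF G.homology_gm G'.homology_gm sa] A by (simp add: Ae)
    thus ?thesis unfolding \<tau>_def by (rule someI_ex)
  qed
  have uniq: "u = v" if A: "A \<in> diagrams C" and uv: "ind A u" "ind A v" for A u v
  proof -
    obtain a0 a1 where Ae: "A = (a0, a1)" by (cases A)
    show ?thesis
      using D.induced_unique[OF G.homology_gm G'.homology_gm] A uv by (simp add: Ae ind_def)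
  qed
  have "natural_transformation (Adel C) D G G' \<tau>"
  proof (intro natural_transformation.intro natural_transformation_axioms.intro
      G.category_functor_axioms G'.category_functor_axioms)
    fix A assume "A \<in> Obj (Adel C)"
    hence A: "A \<in> diagrams C" by (simp add: C.Obj_Adel)
    show "\<tau> A \<in> Hom D (omap G A) (omap G' A)"
      using \<tau>[OF A] A by (simp add: ind_def induced_def G.Cod_amap G'.Dom_amap G.Adel_simps)
  next
    fix x A B assume "x \<in> Hom (Adel C) A B"
    then obtain a0 a1 f0 f1 f2 b0 b1 where xe: "A = (a0, a1)" "B = (b0, b1)"
      "x = Adel_class C ((a0, a1), (f0, f1, f2), (b0, b1))"
      and f: "((a0, a1), (f0, f1, f2), (b0, b1)) \<in> diagram_arrows C" by (rule C.Hom_AdelE)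
    have A: "(a0, a1) \<in> diagrams C" and B: "(b0, b1) \<in> diagrams C"
      using f by (simp_all add: diagram_arrows_iff diagrams_iff)
    \<comment> \<open>Both paths of the naturality square are induced maps. Their middle components
      agree by naturality of \<sigma> at \<open>f1\<close>.\<close>
    have "induced D (G.gk A) (G.gp A) (G'.gc B) (G'.gi B) (G.gm f1 \<cdot>\<^bsub>D\<^esub> \<sigma> (Dom C b1)) (amap G x \<cdot>\<^bsub>D\<^esub> \<tau> B)"
      using D.induced_Comp[OF G.homology_gm[OF A] G.homology_gm[OF B] G'.homology_gm[OF B]
          G.gm_arrow[OF f] G.induced_gm[OF f] sa[OF B]] \<tau>[OF B] by (simp add: xe ind_def)
    moreover have "induced D (G.gk A) (G.gp A) (G'.gc B) (G'.gi B) (\<sigma> (Dom C a1) \<cdot>\<^bsub>D\<^esub> G'.gm f1) (\<tau> A \<cdot>\<^bsub>D\<^esub> amap G' x)"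
      using D.induced_Comp[OF G.homology_gm[OF A] G'.homology_gm[OF A] G'.homology_gm[OF B]
          sa[OF A] _ G'.gm_arrow[OF f] G'.induced_gm[OF f]] \<tau>[OF A] by (simp add: xe ind_def)
    moreover have "G.gm f1 \<cdot>\<^bsub>D\<^esub> \<sigma> (Dom C b1) = \<sigma> (Dom C a1) \<cdot>\<^bsub>D\<^esub> G'.gm f1"
      using nat[of f1] f by (simp add: diagram_arrows_iff)
    ultimately show "amap G x \<cdot>\<^bsub>D\<^esub> \<tau> B = \<tau> A \<cdot>\<^bsub>D\<^esub> amap G' x"
      using D.induced_unique[OF G.homology_gm[OF A] G'.homology_gm[OF B]] by (simp add: xe)
  qed
  moreover have "nt_eq C (\<tau> \<star> Adel_incl C) \<sigma>"
    unfolding nt_eq_def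
  proof
    fix X assume X: "X \<in> Obj C"
    have A: "Adel_incl_ob C X \<in> diagrams C" using X by (rule C.Adel_incl_ob_diagrams)
    have O: "omap G (Adel_incl_ob C X) \<in> Obj D" "omap G' (Adel_incl_ob C X) \<in> Obj D"
      using A G.omap_closed G'.omap_closed by (simp_all add: C.Obj_Adel)
    have d: "Dom C (snd (Adel_incl_ob C X)) = X" using X by (simp add: Adel_incl_ob_def C.add_simps)
    have "ind (Adel_incl_ob C X) (\<sigma> X)"
      using s[OF X] O by (simp add: ind_def d induced_def G.incl_data[OF X] G'.incl_data[OF X] Hom_iff D.cat_simps)
    from uniq[OF A \<tau>[OF A] this] show "(\<tau> \<star> Adel_incl C) X = \<sigma> X" by (simp add: whisker_def Adel_incl_def)
  qed
  moreover have "is_iso D (\<tau> A)" if iso: "\<forall>X\<in>Obj C. is_iso D (\<sigma> X)" and A: "A \<in> diagrams C" for A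
  proof -
    obtain a0 a1 where Ae: "A = (a0, a1)" by (cases A)
    have "Dom C a0 \<in> Obj C" "Dom C a1 \<in> Obj C" "Cod C a1 \<in> Obj C"
      using A by (simp_all add: Ae diagrams_iff C.cat_simps)
    thus ?thesis
      using D.induced_iso[OF G.homology_gm G'.homology_gm sa] A \<tau>[OF A] iso by (simp add: Ae ind_def)
  qed
  moreover have "nt_eq (Adel C) \<gamma> \<tau>"
    if \<gamma>: "natural_transformation (Adel C) D G G' \<gamma>" "nt_eq C (\<gamma> \<star> Adel_incl C) \<sigma>" for \<gamma>
    unfolding nt_eq_def
  proof
    interpret \<gamma>: natural_transformation "Adel C" D G G' \<gamma> by (rule \<gamma>)
    fix A assume "A \<in> Obj (Adel C)"
    hence A: "A \<in> diagrams C" by (simp add: C.Obj_Adel)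
    obtain a0 a1 where Ae: "A = (a0, a1)" by (cases A)
    note A' = A[unfolded Ae]
    have a: "a0 \<in> Arr C" "a1 \<in> Arr C" "Cod C a0 = Dom C a1" "Dom C a1 \<in> Obj C"
      using A' by (simp_all add: diagrams_iff C.cat_simps)
    have g: "\<gamma> X \<in> Arr D" "Dom D (\<gamma> X) = omap G X" "Cod D (\<gamma> X) = omap G' X" if "X \<in> diagrams C" for X
      using \<gamma>.component[of X] that by (simp_all add: Hom_iff C.Obj_Adel)
    have n: "amap G (Adel_class C f) \<cdot>\<^bsub>D\<^esub> \<gamma> (Cod (diagram_category C) f) =
        \<gamma> (Dom (diagram_category C) f) \<cdot>\<^bsub>D\<^esub> amap G' (Adel_class C f)" if "f \<in> diagram_arrows C" for f
      using \<gamma>.naturality[of "Adel_class C f" "Dom (diagram_category C) f" "Cod (diagram_category C) f"] that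
      by (simp add: Hom_iff G.Adel_simps)
    \<comment> \<open>The monomorphism out of \<open>A\<close> and the cokernel out of
      \<open>?I\<close> both end at \<open>?Q\<close>. Naturality of \<gamma> at these two arrows
      shows that \<open>p\<close>, then \<gamma> at \<open>A\<close>, then \<open>i'\<close> equals
      \<open>k\<close>, then \<sigma> at the middle object, then \<open>c'\<close>; this is the
      equation that determines \<tau> at \<open>A\<close>.\<close>
    let ?I = "Adel_incl_ob C (Dom C a1)" and ?Q = "Cod (diagram_category C) (cok_arrow C a0)"
    have I: "?I \<in> diagrams C" using a by (simp add: C.Adel_incl_ob_diagrams)
    have Q: "?Q \<in> diagrams C" using a by (simp add: cok_arrow_eq diagram_sel diagrams_iff C.add_simps)
    have \<sigma>I: "\<gamma> ?I = \<sigma> (Dom C a1)"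
      using \<gamma>(2) a by (simp add: nt_eq_def whisker_def Adel_incl_def)
    have n1: "G.gi A \<cdot>\<^bsub>D\<^esub> \<gamma> ?Q = \<gamma> A \<cdot>\<^bsub>D\<^esub> G'.gi A"
      using n[OF C.mono_arrow_in[OF A]] A' by (simp add: Ae C.Cod_mono_arrow C.Dom_mono_arrow)
    have n2: "G.gc A \<cdot>\<^bsub>D\<^esub> \<gamma> ?Q = \<sigma> (Dom C a1) \<cdot>\<^bsub>D\<^esub> G'.gc A"
      using n[OF C.cok_arrow_in[OF a(1)]] \<sigma>I a by (simp add: Ae C.Dom_cok_arrow)
    note hA = D.homologyD[OF G.homology_gm[OF A']] and hA' = D.homologyD[OF G'.homology_gm[OF A']]
    have cQ: "Cod D (G.gi A) = omap G ?Q" "Cod D (G.gc A) = omap G ?Q"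
      using a A' by (simp_all add: Ae G.Cod_amap G.Adel_simps)
    have "G.gp A \<cdot>\<^bsub>D\<^esub> (\<gamma> A \<cdot>\<^bsub>D\<^esub> G'.gi A) = (G.gp A \<cdot>\<^bsub>D\<^esub> G.gi A) \<cdot>\<^bsub>D\<^esub> \<gamma> ?Q"
      unfolding n1[symmetric] using hA(14-18) g[OF Q] cQ by (simp add: Ae D.cat_simps)
    also have "\<dots> = G.gk A \<cdot>\<^bsub>D\<^esub> (\<sigma> (Dom C a1) \<cdot>\<^bsub>D\<^esub> G'.gc A)"
      unfolding Ae hA(19)[symmetric] using hA(8,9,11,12) g[OF Q] cQ n2 by (simp add: Ae D.cat_simps)
    finally have "ind A (\<gamma> A)"
      using g[OF A] A by (simp add: ind_def induced_def Hom_iff Ae G.Cod_amap G'.Dom_amap G.Adel_simps)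
    thus "\<gamma> A = \<tau> A" using uniq[OF A] \<tau>[OF A] by blast
  qed
  ultimately show ?thesis by (intro exI[of _ \<tau>]) (simp add: C.Obj_Adel)
qed

section \<open>The universal property\<close>

text \<open>Restricted along the inclusion, a hat functor agrees with the given functor on the
  objects and arrows of the category, which need not be an equality of records. The transformation
  is carried over that difference here.\<close>

lemma functor_eq_natural_transformation:
  assumes "natural_transformation C D F G \<alpha>" "functor_eq C F' F" "functor_eq C G' G"
    "category_functor C D F'" "category_functor C D G'"
  shows "natural_transformation C D F' G' \<alpha>"
proof -
  interpret \<alpha>: natural_transformation C D F G \<alpha> by (rule assms)
  show ?thesis
  proof (intro natural_transformation.intro natural_transformation_axioms.intro assms)
    show "\<alpha> X \<in> Hom D (omap F' X) (omap G' X)" if "X \<in> Obj C" for X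
      using \<alpha>.component[OF that] assms(2,3) that by (simp add: functor_eq_def)
    show "amap F' f \<cdot>\<^bsub>D\<^esub> \<alpha> Y = \<alpha> X \<cdot>\<^bsub>D\<^esub> amap G' f" if "f \<in> Hom C X Y" for f X Y
      using \<alpha>.naturality[OF that] assms(2,3) that by (simp add: functor_eq_def Hom_iff)
  qed
qed

text \<open>Makes the case of equal restrictions an instance of the extension theorem.\<close>

lemma functor_eq_id_nt:
  assumes "category_functor C D F" "category_functor C D G" "functor_eq C F G"
  shows "natural_transformation C D F G (id_nt D F)" "\<forall>X\<in>Obj C. is_iso D (id_nt D F X)"
proof -
  interpret F: category_functor C D F by (rule assms)
  show "natural_transformation C D F G (id_nt D F)"
  proof (intro natural_transformation.intro natural_transformation_axioms.intro assms)
    show "id_nt D F X \<in> Hom D (omap F X) (omap G X)" if "X \<in> Obj C" for X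
      using that assms(3) F.D.Ide_closed[OF F.omap_closed] by (simp add: id_nt_def functor_eq_def)
    show "amap F f \<cdot>\<^bsub>D\<^esub> id_nt D F Y = id_nt D F X \<cdot>\<^bsub>D\<^esub> amap G f" if "f \<in> Hom C X Y" for f X Y
    proof -
      have "amap G f = amap F f" using that assms(3) by (simp add: functor_eq_def Hom_iff)
      thus ?thesis using F.amap_closed[OF that] by (simp add: id_nt_def F.D.Ide_left F.D.Ide_right)
    qed
  qed
  show "\<forall>X\<in>Obj C. is_iso D (id_nt D F X)"
    using F.omap_closed by (auto simp: is_iso_def id_nt_def Hom_iff F.D.cat_simps intro!: bexI[of _ "Ide D (omap F _)"])
qed

theorem theorem61:
  fixes \<A> :: "('o, 'm, 'y) add_category_scheme"
    and \<B> :: "('p, 'n, 'z) add_category_scheme"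
    and h :: "'n homology_data"
  assumes "additive_category \<A>"
    and "abelian_category \<B>"
    and "is_homology_choice \<B> h"
  shows
    "(\<forall>F. additive_functor \<A> \<B> F \<longrightarrow>
        exact_functor (Adel \<A>) \<B> (hat \<B> h F) \<and>
        functor_eq \<A> (hat \<B> h F \<circ>\<^sub>F Adel_incl \<A>) F) \<and>
     (\<forall>G G' \<sigma>. exact_functor (Adel \<A>) \<B> G \<and> exact_functor (Adel \<A>) \<B> G' \<and>
        natural_isomorphism \<A> \<B> (G \<circ>\<^sub>F Adel_incl \<A>) (G' \<circ>\<^sub>F Adel_incl \<A>) \<sigma> \<longrightarrow>
        (\<exists>\<tau>. natural_isomorphism (Adel \<A>) \<B> G G' \<tau> \<and> nt_eq \<A> (\<tau> \<star> Adel_incl \<A>) \<sigma>)) \<and>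
     (\<forall>G G'. exact_functor (Adel \<A>) \<B> G \<and> exact_functor (Adel \<A>) \<B> G' \<and>
        functor_eq \<A> (G \<circ>\<^sub>F Adel_incl \<A>) (G' \<circ>\<^sub>F Adel_incl \<A>) \<longrightarrow>
        (\<exists>\<tau>. natural_isomorphism (Adel \<A>) \<B> G G' \<tau> \<and>
             nt_eq \<A> (\<tau> \<star> Adel_incl \<A>) (id_nt \<B> (G \<circ>\<^sub>F Adel_incl \<A>)))) \<and>
     (\<forall>F G \<alpha>. additive_functor \<A> \<B> F \<and> additive_functor \<A> \<B> G \<and>
        natural_transformation \<A> \<B> F G \<alpha> \<longrightarrow>
        (\<exists>\<beta>. natural_transformation (Adel \<A>) \<B> (hat \<B> h F) (hat \<B> h G) \<beta> \<and>
             nt_eq \<A> (\<beta> \<star> Adel_incl \<A>) \<alpha> \<and>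
             (\<forall>\<gamma>. natural_transformation (Adel \<A>) \<B> (hat \<B> h F) (hat \<B> h G) \<gamma> \<and>
                  nt_eq \<A> (\<gamma> \<star> Adel_incl \<A>) \<alpha> \<longrightarrow> nt_eq (Adel \<A>) \<gamma> \<beta>)))"
proof (intro conjI allI impI; (elim conjE)?)
  fix F assume F: "additive_functor \<A> \<B> F"
  show "exact_functor (Adel \<A>) \<B> (hat \<B> h F)"
    by (rule additive_functor.exact_functor_hat[OF F assms(2,3)])
  show "functor_eq \<A> (hat \<B> h F \<circ>\<^sub>F Adel_incl \<A>) F"
    by (rule additive_functor.hat_Adel_incl[OF F assms(2,3)])
next
  fix G G' \<sigma>
  assume *: "exact_functor (Adel \<A>) \<B> G" "exact_functor (Adel \<A>) \<B> G'"
    "natural_isomorphism \<A> \<B> (G \<circ>\<^sub>F Adel_incl \<A>) (G' \<circ>\<^sub>F Adel_incl \<A>) \<sigma>"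
  interpret \<sigma>: natural_isomorphism \<A> \<B> "G \<circ>\<^sub>F Adel_incl \<A>" "G' \<circ>\<^sub>F Adel_incl \<A>" \<sigma> by (rule *)
  show "\<exists>\<tau>. natural_isomorphism (Adel \<A>) \<B> G G' \<tau> \<and> nt_eq \<A> (\<tau> \<star> Adel_incl \<A>) \<sigma>"
    using Adel_extend_natural_transformation[OF assms(1,2) *(1,2) \<sigma>.natural_transformation_axioms] \<sigma>.component_iso
    unfolding natural_isomorphism_def natural_isomorphism_axioms_def by blast
next
  fix G G'
  assume *: "exact_functor (Adel \<A>) \<B> G" "exact_functor (Adel \<A>) \<B> G'"
    "functor_eq \<A> (G \<circ>\<^sub>F Adel_incl \<A>) (G' \<circ>\<^sub>F Adel_incl \<A>)"
  have cf: "category_functor \<A> \<B> (H \<circ>\<^sub>F Adel_incl \<A>)" if "exact_functor (Adel \<A>) \<B> H" for H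
    using category_functor_comp[OF additive_category.category_functor_Adel_incl[OF assms(1)]]
      additive_functor.axioms(3)[OF exact_functor.axioms(1)[OF that]] by blast
  note identity = functor_eq_id_nt[OF cf[OF *(1)] cf[OF *(2)] *(3)]
  show "\<exists>\<tau>. natural_isomorphism (Adel \<A>) \<B> G G' \<tau> \<and>
      nt_eq \<A> (\<tau> \<star> Adel_incl \<A>) (id_nt \<B> (G \<circ>\<^sub>F Adel_incl \<A>))"
    using Adel_extend_natural_transformation[OF assms(1,2) *(1,2) identity(1)] identity(2)
    unfolding natural_isomorphism_def natural_isomorphism_axioms_def by blast
next
  fix F G \<alpha>
  assume *: "additive_functor \<A> \<B> F" "additive_functor \<A> \<B> G" "natural_transformation \<A> \<B> F G \<alpha>"
  note exact = additive_functor.exact_functor_hat[OF *(1) assms(2,3)] additive_functor.exact_functor_hat[OF *(2) assms(2,3)]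
  have cf: "category_functor \<A> \<B> (H \<circ>\<^sub>F Adel_incl \<A>)" if "exact_functor (Adel \<A>) \<B> H" for H
    using category_functor_comp[OF additive_category.category_functor_Adel_incl[OF assms(1)]]
      additive_functor.axioms(3)[OF exact_functor.axioms(1)[OF that]] by blast
  have "natural_transformation \<A> \<B> (hat \<B> h F \<circ>\<^sub>F Adel_incl \<A>) (hat \<B> h G \<circ>\<^sub>F Adel_incl \<A>) \<alpha>"
    by (rule functor_eq_natural_transformation[OF *(3) additive_functor.hat_Adel_incl[OF *(1) assms(2,3)]
          additive_functor.hat_Adel_incl[OF *(2) assms(2,3)] cf[OF exact(1)] cf[OF exact(2)]])
  from Adel_extend_natural_transformation[OF assms(1,2) exact this]
  show "\<exists>\<beta>. natural_transformation (Adel \<A>) \<B> (hat \<B> h F) (hat \<B> h G) \<beta> \<and>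
             nt_eq \<A> (\<beta> \<star> Adel_incl \<A>) \<alpha> \<and>
             (\<forall>\<gamma>. natural_transformation (Adel \<A>) \<B> (hat \<B> h F) (hat \<B> h G) \<gamma> \<and>
                  nt_eq \<A> (\<gamma> \<star> Adel_incl \<A>) \<alpha> \<longrightarrow> nt_eq (Adel \<A>) \<gamma> \<beta>)"
    by blast
qed

end
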